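(* Let $(X,d)$ be a proper geodesic Gromov hyperbolic metric space, and let $f\colon X\to X$ be a non-expanding map which is not weakly elliptic. Let $p\in X$ and let $(x_n)_{n\ge0}$ be a backward orbit of $f$ with bounded step. If $(x_n)$ is not relatively compact in $X$, then it converges to a boundary regular fixed point $\eta\in\partial_GX$ of $f$. Moreover, one has the following dichotomy: either (i) $b(x_n)>0$, $\eta$ is repelling with stable dilation satisfying $\log\Lambda_\eta=b(x_n)$, and $(x_n)$ is a discrete quasi-geodesic ray converging to $\eta$ inside a geodesic region with vertex $\eta$; or (ii) $b(x_n)=0$, $f$ is parabolic, $\eta$ is the Denjoy--Wolff point of $f$, and $(x_n)$ converges to $\eta$ avoiding a horosphere centered at a point associated with $\eta$, i.e. there exist $a\in\Phi^{-1}(\eta)\subset\partial_HX$ and $c\in\mathbb R$ such that no $x_n$ belongs to $\{h_{a,p}\le c\}$.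
   Context: $f$ is non-expanding if $d(f(x),f(y))\le d(x,y)$. $X$ is $\delta$-hyperbolic ($\delta>0$) if in every geodesic triangle each side is contained in the $\delta$-neighborhood of the union of the other two; Gromov hyperbolic means $\delta$-hyperbolic for some $\delta$. $\partial_GX$ is the Gromov boundary and $\overline X^G=X\sqcup\partial_GX$ the Gromov compactification; convergence to boundary points is in $\overline X^G$. Horofunctions: $\overline X^H$ is the closure, in $C(X)$ (topology of uniform convergence on compacta) modulo constants, of the classes of the functions $y\mapsto d(x,y)$, $x\in X$; $\partial_HX=\overline X^H\setminus X$. For $a\in\partial_HX$, $h_{a,p}$ is the unique representative of $a$ vanishing at $p$. There is a (unique) continuous map $\Phi\colon\overline X^H\to\overline X^G$ restricting to the identity on $X$. Geodesic region: $A(\gamma,R)=\{x\in X: d(x,\gamma)<R\}$ for a geodesic ray $\gamma$ and $R>0$, with vertex $[\gamma]\in\partial_GX$. $g\colon X\to X$ has geodesic limit $\xi$ at $\eta\in\partial_GX$ if $g(x_n)\to\xi$ for every sequence $x_n\to\eta$ contained in a geodesic region with vertex $\eta$. Dilation: $\log\lambda_{\eta,p}(g)=\liminf_{z\to\eta}[d(z,p)-d(g(z),p)]$. $\eta\in\partial_GX$ is a boundary regular fixed point (BRFP) of $g$ if $\lambda_{\eta,p}(g)<+\infty$ (independent of $p$) and $g$ has geodesic limit $\eta$ at $\eta$. A BRFP of $f$ is a BRFP of all $f^n$; its stable dilation is given by $\log\Lambda_\eta=\lim_n\frac1n\log\lambda_{\eta,p}(f^n)$ (the limit exists, is finite, independent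 of $p$). $\eta$ is attracting, indifferent, repelling if $\Lambda_\eta<1$, $=1$, $>1$ respectively. $f$ is elliptic if some (equivalently every) forward orbit is bounded. In that case the limit retract $\omega_f$ is the union over $x\in X$ of the sets of limit points of $(f^n(x))_n$; $f$ is strongly elliptic if $\omega_f$ is compact and weakly elliptic otherwise. If $f$ is non-elliptic, all forward orbits converge to one point $\zeta\in\partial_GX$, the Denjoy--Wolff point, which is a BRFP; $f$ is parabolic if it is non-elliptic and $\zeta$ is indifferent. A backward orbit is a sequence $(x_n)_{n\ge0}$ with $f(x_{n+1})=x_n$; it has bounded step if $\sup_nd(x_n,x_{n+1})<\infty$. Then $\sigma_m(x_n)=\lim_{n\to\infty}d(x_n,x_{n+m})$ and the backward step rate is $b(x_n)=\lim_{m\to\infty}\sigma_m(x_n)/m$. A sequence $(x_n)_{n\ge0}$ is a discrete quasi-geodesic ray if there are $A\ge1$, $B\ge0$ with $A^{-1}|n-m|-B\le d(x_n,x_m)\le A|n-m|+B$ for all $n,m\ge0$. *)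

theory Defs
  imports "HOL-Analysis.Analysis"
begin

section \<open>Geodesic Gromov hyperbolic spaces\<close>

definition geodesic_segment :: "'a::metric_space set \<Rightarrow> 'a \<Rightarrow> 'a \<Rightarrow> bool" where
  "geodesic_segment S x y \<longleftrightarrow>
    (\<exists>\<gamma>::real \<Rightarrow> 'a. \<gamma> 0 = x \<and> \<gamma> (dist x y) = y \<and> S = \<gamma> ` {0..dist x y} \<and>
       (\<forall>s\<in>{0..dist x y}. \<forall>t\<in>{0..dist x y}. dist (\<gamma> s) (\<gamma> t) = \<bar>s - t\<bar>))"

definition geodesic_space :: "'a::metric_space itself \<Rightarrow> bool" where
  "geodesic_space _ \<longleftrightarrow> (\<forall>x y::'a. \<exists>S. geodesic_segment S x y)"

definition nbhd_of :: "real \<Rightarrow> 'a::metric_space set \<Rightarrow> 'a set" where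
  "nbhd_of \<delta> S = (\<Union>w\<in>S. ball w \<delta>)"

definition delta_hyperbolic :: "'a::metric_space itself \<Rightarrow> real \<Rightarrow> bool" where
  "delta_hyperbolic _ \<delta> \<longleftrightarrow>
    (\<forall>(x::'a) y z S1 S2 S3.
       geodesic_segment S1 x y \<and> geodesic_segment S2 y z \<and> geodesic_segment S3 z x \<longrightarrow>
       S1 \<subseteq> nbhd_of \<delta> (S2 \<union> S3) \<and> S2 \<subseteq> nbhd_of \<delta> (S3 \<union> S1) \<and> S3 \<subseteq> nbhd_of \<delta> (S1 \<union> S2))"

definition gromov_hyperbolic :: "'a::metric_space itself \<Rightarrow> bool" where
  "gromov_hyperbolic X \<longleftrightarrow> (\<exists>\<delta>>0. delta_hyperbolic X \<delta>)"

section \<open>The Gromov compactification\<close>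

text \<open>
  Only the restriction of a function to \<open>{0..}\<close> matters for being a ray; since boundary
  points are full equivalence classes of functions, the values at negative numbers are harmless.
\<close>

definition geodesic_ray :: "(real \<Rightarrow> 'a::metric_space) \<Rightarrow> bool" where
  "geodesic_ray \<gamma> \<longleftrightarrow> (\<forall>s\<ge>0. \<forall>t\<ge>0. dist (\<gamma> s) (\<gamma> t) = \<bar>s - t\<bar>)"

definition asymptotic_rays :: "((real \<Rightarrow> 'a::metric_space) \<times> (real \<Rightarrow> 'a)) set" where
  "asymptotic_rays = {(\<gamma>, \<sigma>). geodesic_ray \<gamma> \<and> geodesic_ray \<sigma> \<and>
     bdd_above ((\<lambda>t. dist (\<gamma> t) (\<sigma> t)) ` {0..})}"

definition gromov_boundary :: "(real \<Rightarrow> 'a::metric_space) set set" where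
  "gromov_boundary = {\<gamma>. geodesic_ray \<gamma>} // asymptotic_rays"

text \<open>A point of \<open>X \<squnion> \<partial>X\<close> is \<open>Inl x\<close> with \<open>x\<close> in \<open>X\<close>, or \<open>Inr \<eta>\<close> with \<open>\<eta>\<close> in the Gromov boundary.\<close>

type_synonym 'a gromov_point = "'a + (real \<Rightarrow> 'a) set"

definition gromov_product :: "'a::metric_space \<Rightarrow> 'a \<Rightarrow> 'a \<Rightarrow> real" where
  "gromov_product p x y = (dist x p + dist y p - dist x y) / 2"

text \<open>
  The Gromov product extends to \<open>X \<squnion> \<partial>X\<close> as the supremum of
  \<open>liminf\<close> of the products along paths representing the two points: constant paths for
  points of \<open>X\<close>, geodesic rays in the class for points of the boundary.
\<close>

fun representing_paths :: "'a gromov_point \<Rightarrow> (real \<Rightarrow> 'a) set" where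
  "representing_paths (Inl x) = {\<lambda>_. x}"
| "representing_paths (Inr \<eta>) = \<eta>"

definition extended_gromov_product ::
    "'a::metric_space \<Rightarrow> 'a gromov_point \<Rightarrow> 'a gromov_point \<Rightarrow> ereal" where
  "extended_gromov_product p \<xi> \<zeta> =
    (SUP \<gamma>\<in>representing_paths \<xi>. SUP \<sigma>\<in>representing_paths \<zeta>.
       Liminf (at_top \<times>\<^sub>F at_top) (\<lambda>(s, t). ereal (gromov_product p (\<gamma> s) (\<sigma> t))))"

definition gromov_points :: "'a::metric_space gromov_point set" where
  "gromov_points = range Inl \<union> Inr ` gromov_boundary"

text \<open>
  The usual topology: that of \<open>X\<close> on \<open>X\<close>, and the sets \<open>{\<xi>. (\<xi>|\<eta>)\<^sub>p > r}\<close> for real \<open>r\<close>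
  as a neighbourhood base at a boundary point \<open>\<eta>\<close>.  Changing \<open>p\<close> to \<open>q\<close> changes the products
  by at most \<open>dist p q\<close>, so quantifying over all \<open>p\<close> imposes no more than one \<open>p\<close> would.
\<close>

definition gromov_open :: "'a::metric_space gromov_point set \<Rightarrow> bool" where
  "gromov_open U \<longleftrightarrow> U \<subseteq> gromov_points \<and> open {x. Inl x \<in> U} \<and>
     (\<forall>\<eta>. Inr \<eta> \<in> U \<longrightarrow>
        (\<forall>p. \<exists>r::real. {\<xi> \<in> gromov_points. extended_gromov_product p \<xi> (Inr \<eta>) > ereal r} \<subseteq> U))"

definition gromov_topology :: "'a::metric_space gromov_point topology" where
  "gromov_topology = topology gromov_open"

lemma istopology_gromov_open: "istopology (gromov_open :: 'a::metric_space gromov_point set \<Rightarrow> bool)"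
  unfolding istopology_def
proof (intro conjI allI impI)
  fix S T :: "'a gromov_point set"
  assume S: "gromov_open S" and T: "gromov_open T"
  have "\<exists>r::real. {\<xi> \<in> gromov_points. extended_gromov_product p \<xi> (Inr \<eta>) > ereal r} \<subseteq> S \<inter> T"
    if \<eta>: "Inr \<eta> \<in> S \<inter> T" for \<eta> p
  proof -
    obtain r where r: "{\<xi> \<in> gromov_points. extended_gromov_product p \<xi> (Inr \<eta>) > ereal r} \<subseteq> S"
      using S \<eta> unfolding gromov_open_def by blast
    obtain s where s: "{\<xi> \<in> gromov_points. extended_gromov_product p \<xi> (Inr \<eta>) > ereal s} \<subseteq> T"
      using T \<eta> unfolding gromov_open_def by blast
    have "{\<xi> \<in> gromov_points. extended_gromov_product p \<xi> (Inr \<eta>) > ereal (max r s)} \<subseteq> S \<inter> T"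
    proof
      fix \<xi> :: "'a gromov_point"
      assume "\<xi> \<in> {\<xi> \<in> gromov_points. extended_gromov_product p \<xi> (Inr \<eta>) > ereal (max r s)}"
      then have \<xi>: "\<xi> \<in> gromov_points" "ereal (max r s) < extended_gromov_product p \<xi> (Inr \<eta>)"
        by auto
      have "ereal r \<le> ereal (max r s)" "ereal s \<le> ereal (max r s)"
        by simp_all
      then have "ereal r < extended_gromov_product p \<xi> (Inr \<eta>)"
          "ereal s < extended_gromov_product p \<xi> (Inr \<eta>)"
        using \<xi>(2) by (blast intro: le_less_trans)+
      then show "\<xi> \<in> S \<inter> T"
        using r s \<xi>(1) by blast
    qed
    then show ?thesis by blast
  qed
  moreover have "open {x. Inl x \<in> S \<inter> T}"
    using S T open_Int[of "{x. Inl x \<in> S}" "{x. Inl x \<in> T}"]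
    by (simp add: gromov_open_def Collect_conj_eq)
  moreover have "S \<inter> T \<subseteq> gromov_points"
    using S by (auto simp: gromov_open_def)
  ultimately show "gromov_open (S \<inter> T)"
    unfolding gromov_open_def by simp
next
  fix \<K> :: "'a gromov_point set set"
  assume K: "\<forall>K\<in>\<K>. gromov_open K"
  have "{x. Inl x \<in> \<Union>\<K>} = (\<Union>K\<in>\<K>. {x. Inl x \<in> K})"
    by auto
  then have "open {x. Inl x \<in> \<Union>\<K>}"
    using K by (auto simp: gromov_open_def)
  moreover have "\<exists>r::real. {\<xi> \<in> gromov_points. extended_gromov_product p \<xi> (Inr \<eta>) > ereal r} \<subseteq> \<Union>\<K>"
    if \<eta>: "Inr \<eta> \<in> \<Union>\<K>" for \<eta> p
  proof -
    obtain K where "K \<in> \<K>" "Inr \<eta> \<in> K" using \<eta> by blast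
    moreover from this obtain r
      where "{\<xi> \<in> gromov_points. extended_gromov_product p \<xi> (Inr \<eta>) > ereal r} \<subseteq> K"
      using K unfolding gromov_open_def by blast
    ultimately show ?thesis by blast
  qed
  moreover have "\<Union>\<K> \<subseteq> gromov_points"
    using K by (auto simp: gromov_open_def)
  ultimately show "gromov_open (\<Union>\<K>)"
    unfolding gromov_open_def by simp
qed

lemma openin_gromov_topology: "openin gromov_topology U \<longleftrightarrow> gromov_open U"
  by (simp add: gromov_topology_def istopology_gromov_open)

lemma topspace_gromov_topology: "topspace gromov_topology = gromov_points"
proof
  show "topspace gromov_topology \<subseteq> gromov_points"
    by (auto simp: topspace_def openin_gromov_topology gromov_open_def)
  have "gromov_open gromov_points"
    by (auto simp: gromov_open_def gromov_points_def)
  then show "gromov_points \<subseteq> topspace gromov_topology"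
    by (intro openin_subset) (simp add: openin_gromov_topology)
qed

abbreviation converges_to_boundary ::
    "(nat \<Rightarrow> 'a::metric_space) \<Rightarrow> (real \<Rightarrow> 'a) set \<Rightarrow> bool" where
  "converges_to_boundary x \<eta> \<equiv> limitin gromov_topology (\<lambda>n. Inl (x n)) (Inr \<eta>) sequentially"

section \<open>Horofunctions\<close>

definition compact_convergence_open :: "('a::metric_space \<Rightarrow> real) set \<Rightarrow> bool" where
  "compact_convergence_open U \<longleftrightarrow> U \<subseteq> {h. continuous_on UNIV h} \<and>
     (\<forall>h\<in>U. \<exists>K \<epsilon>. compact K \<and> \<epsilon> > 0 \<and>
        {g. continuous_on UNIV g \<and> (\<forall>y\<in>K. dist (g y) (h y) < \<epsilon>)} \<subseteq> U)"

definition class_mod_const :: "('a \<Rightarrow> real) \<Rightarrow> ('a \<Rightarrow> real) set" where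
  "class_mod_const h = {(\<lambda>y. h y + c) | c. True}"

definition cts_mod_const :: "('a::metric_space \<Rightarrow> real) set set" where
  "cts_mod_const = class_mod_const ` {h. continuous_on UNIV h}"

definition cts_mod_const_topology :: "('a::metric_space \<Rightarrow> real) set topology" where
  "cts_mod_const_topology = topology (\<lambda>W. W \<subseteq> cts_mod_const \<and>
     compact_convergence_open {h. continuous_on UNIV h \<and> class_mod_const h \<in> W})"

lemma compact_convergence_openE:
  assumes "compact_convergence_open U" "h \<in> U"
  obtains K \<epsilon> where "compact K" "\<epsilon> > 0"
    "{g. continuous_on UNIV g \<and> (\<forall>y\<in>K. dist (g y) (h y) < \<epsilon>)} \<subseteq> U"
proof -
  have "\<exists>K \<epsilon>. compact K \<and> \<epsilon> > 0 \<and>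
      {g. continuous_on UNIV g \<and> (\<forall>y\<in>K. dist (g y) (h y) < \<epsilon>)} \<subseteq> U"
    using assms unfolding compact_convergence_open_def by (elim conjE) (erule (1) bspec)
  then show thesis
    by (elim exE conjE) (rule that)
qed

lemma compact_convergence_open_Int:
  assumes "compact_convergence_open U" "compact_convergence_open V"
  shows "compact_convergence_open (U \<inter> V)"
proof -
  have "\<exists>K \<epsilon>. compact K \<and> \<epsilon> > 0 \<and>
        {g. continuous_on UNIV g \<and> (\<forall>y\<in>K. dist (g y) (h y) < \<epsilon>)} \<subseteq> U \<inter> V"
    if h: "h \<in> U \<inter> V" for h
  proof -
    from h have "h \<in> U" "h \<in> V"
      by auto
    obtain K d where K: "compact K" "d > 0"
      "{g. continuous_on UNIV g \<and> (\<forall>y\<in>K. dist (g y) (h y) < d)} \<subseteq> U"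
      using \<open>h \<in> U\<close> by (rule compact_convergence_openE[OF assms(1)])
    obtain L e where L: "compact L" "e > 0"
      "{g. continuous_on UNIV g \<and> (\<forall>y\<in>L. dist (g y) (h y) < e)} \<subseteq> V"
      using \<open>h \<in> V\<close> by (rule compact_convergence_openE[OF assms(2)])
    have "{g. continuous_on UNIV g \<and> (\<forall>y\<in>K \<union> L. dist (g y) (h y) < min d e)} \<subseteq> U \<inter> V"
    proof
      fix g
      assume "g \<in> {g. continuous_on UNIV g \<and> (\<forall>y\<in>K \<union> L. dist (g y) (h y) < min d e)}"
      then have "g \<in> {g. continuous_on UNIV g \<and> (\<forall>y\<in>K. dist (g y) (h y) < d)}"
          "g \<in> {g. continuous_on UNIV g \<and> (\<forall>y\<in>L. dist (g y) (h y) < e)}"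
        by simp_all
      then show "g \<in> U \<inter> V"
        using K(3) L(3) by (intro IntI subsetD[OF K(3)] subsetD[OF L(3)])
    qed
    moreover have "compact (K \<union> L)" "min d e > 0"
      using K L by auto
    ultimately show ?thesis by blast
  qed
  moreover have "U \<inter> V \<subseteq> {h. continuous_on UNIV h}"
    using assms(1) by (auto simp: compact_convergence_open_def)
  ultimately show ?thesis
    unfolding compact_convergence_open_def by simp
qed

lemma compact_convergence_open_Union:
  assumes "\<And>U. U \<in> \<U> \<Longrightarrow> compact_convergence_open U"
  shows "compact_convergence_open (\<Union>\<U>)"
  unfolding compact_convergence_open_def
proof (intro conjI ballI)
  show "\<Union>\<U> \<subseteq> {h. continuous_on UNIV h}"
    using assms unfolding compact_convergence_open_def by blast
next
  fix h assume "h \<in> \<Union>\<U>"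
  then obtain U where U: "U \<in> \<U>" "h \<in> U" by blast
  obtain K \<epsilon> where "compact K" "\<epsilon> > 0"
      "{g. continuous_on UNIV g \<and> (\<forall>y\<in>K. dist (g y) (h y) < \<epsilon>)} \<subseteq> U"
    using U(2) by (rule compact_convergence_openE[OF assms[OF U(1)]])
  with U show "\<exists>K \<epsilon>. compact K \<and> \<epsilon> > 0 \<and>
      {g. continuous_on UNIV g \<and> (\<forall>y\<in>K. dist (g y) (h y) < \<epsilon>)} \<subseteq> \<Union>\<U>"
    by blast
qed

lemma openin_cts_mod_const_topology:
  "openin cts_mod_const_topology W \<longleftrightarrow> W \<subseteq> (cts_mod_const :: ('a::metric_space \<Rightarrow> real) set set) \<and>
     compact_convergence_open {h. continuous_on UNIV h \<and> class_mod_const h \<in> W}"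
proof -
  let ?pre = "\<lambda>W. {h::'a \<Rightarrow> real. continuous_on UNIV h \<and> class_mod_const h \<in> W}"
  have Int: "?pre (S \<inter> T) = ?pre S \<inter> ?pre T" for S T
    by auto
  have Union: "?pre (\<Union>\<K>) = \<Union>(?pre ` \<K>)" for \<K>
    by auto
  have "istopology (\<lambda>W. W \<subseteq> (cts_mod_const :: ('a \<Rightarrow> real) set set) \<and>
      compact_convergence_open (?pre W))"
    unfolding istopology_def Int Union
  proof (intro conjI allI impI)
    fix \<K> assume K: "\<forall>K\<in>\<K>. K \<subseteq> (cts_mod_const :: ('a \<Rightarrow> real) set set) \<and>
      compact_convergence_open (?pre K)"
    then show "\<Union>\<K> \<subseteq> cts_mod_const"
      by blast
    show "compact_convergence_open (\<Union>(?pre ` \<K>))"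
      by (rule compact_convergence_open_Union) (use K in \<open>elim imageE, simp\<close>)
  qed (simp_all add: compact_convergence_open_Int le_infI1)
  then show ?thesis
    by (simp add: cts_mod_const_topology_def)
qed

definition horo_compactification :: "('a::metric_space \<Rightarrow> real) set set" where
  "horo_compactification =
    cts_mod_const_topology closure_of (range (\<lambda>x. class_mod_const (dist x)))"

definition horo_boundary :: "('a::metric_space \<Rightarrow> real) set set" where
  "horo_boundary = horo_compactification - range (\<lambda>x. class_mod_const (dist x))"

definition horofunction :: "('a::metric_space \<Rightarrow> real) set \<Rightarrow> 'a \<Rightarrow> 'a \<Rightarrow> real" where
  "horofunction a p = (THE h. h \<in> a \<and> h p = 0)"

text \<open>
  \<open>X\<close> sits in the horofunction compactification via \<open>x \<mapsto> [dist x]\<close>.  On a proper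
  geodesic Gromov hyperbolic space a map as below exists, and its values on the compactification
  are unique; only values there are ever used.
\<close>

definition horo_to_gromov :: "('a::metric_space \<Rightarrow> real) set \<Rightarrow> 'a gromov_point" where
  "horo_to_gromov = (SOME \<Phi>.
     continuous_map (subtopology cts_mod_const_topology horo_compactification) gromov_topology \<Phi> \<and>
     (\<forall>x. \<Phi> (class_mod_const (dist x)) = Inl x))"

section \<open>Boundary regular fixed points\<close>

text \<open>\<open>A(\<gamma>, R)\<close>; its vertex is the class of \<open>\<gamma>\<close>.\<close>

definition geodesic_region :: "(real \<Rightarrow> 'a::metric_space) \<Rightarrow> real \<Rightarrow> 'a set" where
  "geodesic_region \<gamma> R = {x. infdist x (\<gamma> ` {0..}) < R}"

definition has_geodesic_limit ::
    "('a::metric_space \<Rightarrow> 'a) \<Rightarrow> 'a gromov_point \<Rightarrow> (real \<Rightarrow> 'a) set \<Rightarrow> bool" where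
  "has_geodesic_limit g \<xi> \<eta> \<longleftrightarrow>
    (\<forall>\<gamma>\<in>\<eta>. \<forall>R>0. \<forall>x::nat \<Rightarrow> 'a.
       (\<forall>n. x n \<in> geodesic_region \<gamma> R) \<and> converges_to_boundary x \<eta> \<longrightarrow>
       limitin gromov_topology (\<lambda>n. Inl (g (x n))) \<xi> sequentially)"

text \<open>The logarithm of the dilation, with the dilation being infinite iff this is \<open>\<infinity>\<close>.\<close>

definition log_dilation ::
    "('a::metric_space \<Rightarrow> 'a) \<Rightarrow> (real \<Rightarrow> 'a) set \<Rightarrow> 'a \<Rightarrow> ereal" where
  "log_dilation g \<eta> p =
    Liminf (filtercomap Inl (nhdsin gromov_topology (Inr \<eta>)))
      (\<lambda>z. ereal (dist z p - dist (g z) p))"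

definition brfp :: "('a::metric_space \<Rightarrow> 'a) \<Rightarrow> (real \<Rightarrow> 'a) set \<Rightarrow> bool" where
  "brfp g \<eta> \<longleftrightarrow> \<eta> \<in> gromov_boundary \<and> (\<forall>p. log_dilation g \<eta> p < \<infinity>) \<and>
     has_geodesic_limit g (Inr \<eta>) \<eta>"

definition stable_dilation :: "('a::metric_space \<Rightarrow> 'a) \<Rightarrow> (real \<Rightarrow> 'a) set \<Rightarrow> real" where
  "stable_dilation f \<eta> =
    exp (THE l. \<forall>p. (\<lambda>n. log_dilation (f ^^ n) \<eta> p / ereal (real n)) \<longlonglongrightarrow> ereal l)"

definition indifferent_brfp :: "('a::metric_space \<Rightarrow> 'a) \<Rightarrow> (real \<Rightarrow> 'a) set \<Rightarrow> bool" where
  "indifferent_brfp f \<eta> \<longleftrightarrow> brfp f \<eta> \<and> stable_dilation f \<eta> = 1"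

definition repelling_brfp :: "('a::metric_space \<Rightarrow> 'a) \<Rightarrow> (real \<Rightarrow> 'a) set \<Rightarrow> bool" where
  "repelling_brfp f \<eta> \<longleftrightarrow> brfp f \<eta> \<and> stable_dilation f \<eta> > 1"

section \<open>Non-expanding maps\<close>

definition non_expanding :: "('a::metric_space \<Rightarrow> 'a) \<Rightarrow> bool" where
  "non_expanding f \<longleftrightarrow> (\<forall>x y. dist (f x) (f y) \<le> dist x y)"

definition elliptic :: "('a::metric_space \<Rightarrow> 'a) \<Rightarrow> bool" where
  "elliptic f \<longleftrightarrow> (\<exists>x. bounded (range (\<lambda>n. (f ^^ n) x)))"

definition limit_retract :: "('a::metric_space \<Rightarrow> 'a) \<Rightarrow> 'a set" where
  "limit_retract f =
    (\<Union>x. {y. \<exists>r::nat \<Rightarrow> nat. strict_mono r \<and> (\<lambda>n. (f ^^ r n) x) \<longlonglongrightarrow> y})"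

definition weakly_elliptic :: "('a::metric_space \<Rightarrow> 'a) \<Rightarrow> bool" where
  "weakly_elliptic f \<longleftrightarrow> elliptic f \<and> \<not> compact (limit_retract f)"

definition denjoy_wolff_point :: "('a::metric_space \<Rightarrow> 'a) \<Rightarrow> (real \<Rightarrow> 'a) set \<Rightarrow> bool" where
  "denjoy_wolff_point f \<zeta> \<longleftrightarrow> \<not> elliptic f \<and> \<zeta> \<in> gromov_boundary \<and>
     (\<forall>x. converges_to_boundary (\<lambda>n. (f ^^ n) x) \<zeta>)"

definition parabolic :: "('a::metric_space \<Rightarrow> 'a) \<Rightarrow> bool" where
  "parabolic f \<longleftrightarrow> \<not> elliptic f \<and> (\<exists>\<zeta>. denjoy_wolff_point f \<zeta> \<and> indifferent_brfp f \<zeta>)"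

section \<open>Backward orbits\<close>

definition backward_orbit :: "('a \<Rightarrow> 'a) \<Rightarrow> (nat \<Rightarrow> 'a) \<Rightarrow> bool" where
  "backward_orbit f x \<longleftrightarrow> (\<forall>n. f (x (Suc n)) = x n)"

definition bounded_step :: "(nat \<Rightarrow> 'a::metric_space) \<Rightarrow> bool" where
  "bounded_step x \<longleftrightarrow> bdd_above (range (\<lambda>n. dist (x n) (x (Suc n))))"

definition backward_step :: "nat \<Rightarrow> (nat \<Rightarrow> 'a::metric_space) \<Rightarrow> real" where
  "backward_step m x = lim (\<lambda>n. dist (x n) (x (n + m)))"

definition backward_step_rate :: "(nat \<Rightarrow> 'a::metric_space) \<Rightarrow> real" where
  "backward_step_rate x = lim (\<lambda>m. backward_step m x / real m)"

definition discrete_quasi_geodesic_ray :: "(nat \<Rightarrow> 'a::metric_space) \<Rightarrow> bool" where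
  "discrete_quasi_geodesic_ray x \<longleftrightarrow>
    (\<exists>A B. A \<ge> 1 \<and> B \<ge> 0 \<and>
       (\<forall>n m. inverse A * \<bar>real n - real m\<bar> - B \<le> dist (x n) (x m) \<and>
              dist (x n) (x m) \<le> A * \<bar>real n - real m\<bar> + B))"

end

theory Submission
  imports Defs
begin

text \<open>
  Thin triangles give the four-point inequality for Gromov products, and the points far out along a
  geodesic ray measure its Busemann function up to a constant.

  Write \<open>D n = dist (x 0) (x n)\<close>, \<open>\<sigma> m\<close> for the limit of the increasing sequence
  \<open>dist (x n) (x (n + m))\<close>, and \<open>b = lim \<sigma> m / m\<close>.  If \<open>b > 0\<close>, a sparse tail of \<open>x\<close> is a broken geodesic with
  long segments and small Gromov products at the breaks, so \<open>D\<close> grows linearly and all the products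
  \<open>(x 0|x m)\<close> at \<open>x k\<close>, \<open>k \<le> m\<close>, are bounded; convergence, the geodesic region and the stable dilation follow.
  If \<open>b = 0\<close>, an elliptic \<open>f\<close> with compact limit retract would force linear growth of \<open>D\<close>, so \<open>f\<close> is
  non-elliptic and \<open>D n \<rightarrow> \<infinity>\<close> by Calka's theorem.  Sublinearity of \<open>\<sigma>\<close> gives, within bounded distance of each
  \<open>x m\<close>, an \<open>x n\<close> with \<open>D (n + k) \<le> D n + 1\<close>, whence \<open>dist (f\<^sup>k (x 0)) (x n) \<le> D n + 1\<close>: the backward orbit
  converges to the limit of the forward orbits, and the same \<open>x n\<close> show that it avoids a horoball.
\<close>

text \<open>All estimates hold up to additive constants, whereas the boundary, its topology and the
  map from horofunctions are given by suprema, lower limits and a choice. Two devices bridge this.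
  Convergence to a boundary point is tested on one ray of its class through
  \<open>ray_product\<close>, a true limit expressed by the Busemann function; changing the ray
  costs at most \<open>\<Delta>\<close>. And \<open>horo_to_gromov\<close> is picked among all
  continuous extensions, so nothing is known of its values until one extension is constructed; what
  is needed afterwards is its value at a Busemann class, which continuity along the ray determines.
  The upper bound for the dilation is tested along the orbit itself, but the lower bound must hold
  at all points near \<open>\<eta>\<close>. For \<open>b > 0\<close> it comes from the fact that
  geodesics from \<open>x 0\<close> towards \<open>\<eta>\<close> pass near every
  \<open>x m\<close>; for \<open>b = 0\<close> the displacement of \<open>x 0\<close> under
  \<open>f ^^ n\<close> is already sublinear. Excluding weak ellipticity provides uniformity: a
  compact limit retract gives one time after which a whole ball is mapped into a smaller
  one.\<close>

lemma gromov_product_commute: "gromov_product p x y = gromov_product p y x"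
  by (simp add: gromov_product_def dist_commute)

lemma gromov_product_nonneg: "0 \<le> gromov_product p x y"
  using dist_triangle2[of x y p] by (simp add: gromov_product_def)

lemma gromov_product_self [simp]: "gromov_product p x x = dist x p"
  by (simp add: gromov_product_def)

lemma gromov_product_le_dist: "gromov_product p x y \<le> dist x p" "gromov_product p x y \<le> dist y p"
  using dist_triangle3[of y p x] dist_triangle[of x p y]
  by (simp_all add: gromov_product_def dist_commute)

lemma gromov_product_diff: "gromov_product p x y - gromov_product p x' y \<le> dist x x'"
  using dist_triangle[of x p x'] dist_triangle[of x' y x]
  by (simp add: gromov_product_def dist_commute field_simps)

lemma gromov_product_diff': "gromov_product p x y - gromov_product p x y' \<le> dist y y'"
  using gromov_product_diff[of p y x y'] by (simp add: gromov_product_commute)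

lemma gromov_product_base_diff: "gromov_product p x y - gromov_product q x y \<le> dist p q"
  using dist_triangle[of x p q] dist_triangle[of y p q]
  by (simp add: gromov_product_def dist_commute field_simps)

section \<open>Geodesic segments and thin triangles\<close>

lemma geodesic_segmentE:
  assumes "geodesic_segment S x y"
  obtains \<gamma> where "\<gamma> 0 = x" "\<gamma> (dist x y) = y" "S = \<gamma> ` {0..dist x y}"
    "\<forall>s\<in>{0..dist x y}. \<forall>t\<in>{0..dist x y}. dist (\<gamma> s) (\<gamma> t) = \<bar>s - t\<bar>"
  using assms unfolding geodesic_segment_def by blast

lemma geodesic_segment_endpoints:
  assumes "geodesic_segment S x y"
  shows "x \<in> S" "y \<in> S"
proof -
  obtain \<gamma> where g: "\<gamma> 0 = x" "\<gamma> (dist x y) = y" "S = \<gamma> ` {0..dist x y}"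
    "\<forall>s\<in>{0..dist x y}. \<forall>t\<in>{0..dist x y}. dist (\<gamma> s) (\<gamma> t) = \<bar>s - t\<bar>"
    using geodesic_segmentE[OF assms] by blast
  show "x \<in> S" unfolding g(3) by (rule image_eqI[of _ _ 0]) (simp_all add: g(1))
  show "y \<in> S" unfolding g(3) by (rule image_eqI[of _ _ "dist x y"]) (simp_all add: g(2))
qed

lemma geodesic_segment_dist_add:
  assumes "geodesic_segment S x y" "w \<in> S"
  shows "dist x w + dist w y = dist x y"
proof -
  obtain \<gamma> where g: "\<gamma> 0 = x" "\<gamma> (dist x y) = y" "S = \<gamma> ` {0..dist x y}"
    "\<forall>s\<in>{0..dist x y}. \<forall>t\<in>{0..dist x y}. dist (\<gamma> s) (\<gamma> t) = \<bar>s - t\<bar>"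
    using geodesic_segmentE[OF assms(1)] by blast
  obtain t where t: "t \<in> {0..dist x y}" "w = \<gamma> t"
    using assms(2) unfolding g(3) by blast
  have "dist (\<gamma> 0) (\<gamma> t) = t" "dist (\<gamma> t) (\<gamma> (dist x y)) = dist x y - t"
    using t(1) by (subst g(4)[rule_format]; simp)+
  then show ?thesis
    unfolding g(1,2) t(2) by simp
qed

text \<open>Go from \<open>p\<close> to each endpoint through \<open>w\<close> and add: the two
  pieces of the side sum to its length. This half of the comparison holds in any metric
  space.\<close>

lemma gromov_product_le_dist_geodesic:
  assumes "geodesic_segment S x y" "w \<in> S"
  shows "gromov_product p x y \<le> dist p w"
  using dist_triangle[of x p w] dist_triangle[of y p w] geodesic_segment_dist_add[OF assms]
  by (simp add: gromov_product_def dist_commute)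

lemma geodesic_segment_connected:
  assumes "geodesic_segment S x y"
  shows "connected S"
proof -
  obtain \<gamma> where g0: "\<gamma> 0 = x" "\<gamma> (dist x y) = y" and g: "S = \<gamma> ` {0..dist x y}"
    "\<forall>s\<in>{0..dist x y}. \<forall>t\<in>{0..dist x y}. dist (\<gamma> s) (\<gamma> t) = \<bar>s - t\<bar>"
    using geodesic_segmentE[OF assms(1)] by blast
  have "continuous_on {0..dist x y} \<gamma>"
    unfolding continuous_on_iff by (intro ballI allI impI exI conjI) (auto simp: g(2) dist_real_def)
  then show ?thesis
    unfolding g(1) by (intro connected_continuous_image) auto
qed

lemma geodesic_space_segment:
  assumes "geodesic_space TYPE('a::metric_space)"
  obtains S where "geodesic_segment S x (y::'a)"
  using assms unfolding geodesic_space_def by blast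

lemma delta_hyperbolicD:
  assumes "delta_hyperbolic TYPE('a::metric_space) \<delta>"
    and "geodesic_segment S1 x (y::'a)" "geodesic_segment S2 y z" "geodesic_segment S3 z x"
  shows "S1 \<subseteq> nbhd_of \<delta> (S2 \<union> S3)" "S3 \<subseteq> nbhd_of \<delta> (S1 \<union> S2)"
proof -
  have "S1 \<subseteq> nbhd_of \<delta> (S2 \<union> S3) \<and> S2 \<subseteq> nbhd_of \<delta> (S3 \<union> S1) \<and> S3 \<subseteq> nbhd_of \<delta> (S1 \<union> S2)"
    using assms(1)[unfolded delta_hyperbolic_def, rule_format, OF conjI[OF assms(2) conjI[OF assms(3,4)]]] .
  then show "S1 \<subseteq> nbhd_of \<delta> (S2 \<union> S3)" "S3 \<subseteq> nbhd_of \<delta> (S1 \<union> S2)"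
    by simp_all
qed

lemma nbhd_of_Un: "nbhd_of \<delta> (S \<union> T) = nbhd_of \<delta> S \<union> nbhd_of \<delta> T"
  by (simp add: nbhd_of_def)

lemma nbhd_of_iff: "w \<in> nbhd_of \<delta> S \<longleftrightarrow> (\<exists>u\<in>S. dist u w < \<delta>)"
  by (simp add: nbhd_of_def)

text \<open>Up to \<open>2\<delta>\<close>, the product \<open>(x|y)\<^sub>p\<close> is the distance from \<open>p\<close> to a side \<open>[x,y]\<close>: by
  connectedness some point of the side is close to both other sides.\<close>

lemma delta_hyperbolic_projection:
  assumes geo: "geodesic_space TYPE('a::metric_space)" and hyp: "delta_hyperbolic TYPE('a) \<delta>" "\<delta> > 0"
    and S: "geodesic_segment S x (y::'a)"
  obtains w where "w \<in> S" "dist p w \<le> gromov_product p x y + 2 * \<delta>"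
proof -
  obtain S1 where S1: "geodesic_segment S1 p x"
    by (rule geodesic_space_segment[OF geo])
  obtain S2 where S2: "geodesic_segment S2 y p"
    by (rule geodesic_space_segment[OF geo])
  have sub: "S \<subseteq> nbhd_of \<delta> S2 \<union> nbhd_of \<delta> S1"
    using delta_hyperbolicD(1)[OF hyp(1) S S2 S1] by (simp add: nbhd_of_Un)
  have op: "open (nbhd_of \<delta> S1)" "open (nbhd_of \<delta> S2)"
    unfolding nbhd_of_def by auto
  have "x \<in> nbhd_of \<delta> S1" "y \<in> nbhd_of \<delta> S2"
    using geodesic_segment_endpoints[OF S1] geodesic_segment_endpoints[OF S2] hyp(2)
    unfolding nbhd_of_iff by (metis dist_self)+
  then have "nbhd_of \<delta> S1 \<inter> nbhd_of \<delta> S2 \<inter> S \<noteq> {}"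
    using connectedD[OF geodesic_segment_connected[OF S], of "nbhd_of \<delta> S1" "nbhd_of \<delta> S2"]
      sub op geodesic_segment_endpoints[OF S] by blast
  then obtain w u v where w: "w \<in> S" "u \<in> S1" "dist u w < \<delta>" "v \<in> S2" "dist v w < \<delta>"
    by (auto simp: nbhd_of_iff)
  have "dist p u + dist u x = dist p x" "dist y v + dist v p = dist y p"
    using geodesic_segment_dist_add[OF S1 w(2)] geodesic_segment_dist_add[OF S2 w(4)] by auto
  moreover have "dist p w \<le> dist p u + dist u w" "dist p w \<le> dist v p + dist v w"
    "dist x w \<le> dist u x + dist u w" "dist w y \<le> dist v w + dist y v"
    using dist_triangle[of p w u] dist_triangle[of p w v] dist_triangle[of x w u] dist_triangle[of w y v]
    by (simp_all add: dist_commute)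
  moreover have "dist x w + dist w y = dist x y"
    using geodesic_segment_dist_add[OF S w(1)] .
  \<comment> \<open>The detours through \<open>u\<close> and \<open>v\<close> cost
    \<open>\<delta>\<close> four times in the sum of these inequalities; halving leaves
    \<open>2 * \<delta>\<close>.\<close>
  ultimately have "dist p w \<le> gromov_product p x y + 2 * \<delta>"
    using w(3,5) by (simp add: gromov_product_def dist_commute field_simps)
  with w(1) show thesis by (rule that)
qed

text \<open>A point of the side from \<open>z\<close> to \<open>x\<close> realises its product up to
  \<open>2 * \<delta>\<close>. Thinness moves it by less than \<open>\<delta>\<close> to another
  side, whose product is at most the distance from \<open>p\<close>.\<close>

lemma delta_hyperbolic_four_point:
  assumes geo: "geodesic_space TYPE('a::metric_space)" and hyp: "delta_hyperbolic TYPE('a) \<delta>" "\<delta> > 0"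
  shows "min (gromov_product p x (y::'a)) (gromov_product p y z) - 3 * \<delta> \<le> gromov_product p x z"
proof -
  obtain S1 where S1: "geodesic_segment S1 x y"
    by (rule geodesic_space_segment[OF geo])
  obtain S2 where S2: "geodesic_segment S2 y z"
    by (rule geodesic_space_segment[OF geo])
  obtain S3 where S3: "geodesic_segment S3 z x"
    by (rule geodesic_space_segment[OF geo])
  obtain w where w: "w \<in> S3" "dist p w \<le> gromov_product p x z + 2 * \<delta>"
    using delta_hyperbolic_projection[OF geo hyp S3, of p] unfolding gromov_product_commute[of p z x] .
  obtain u where u: "u \<in> S1 \<union> S2" "dist u w < \<delta>"
    using delta_hyperbolicD(2)[OF hyp(1) S1 S2 S3] w(1) using nbhd_of_iff[of w \<delta>] that by blast
  have "min (gromov_product p x y) (gromov_product p y z) \<le> dist p u"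
    using u(1) gromov_product_le_dist_geodesic[OF S1, of u p] gromov_product_le_dist_geodesic[OF S2, of u p]
    by auto
  also have "\<dots> \<le> dist p w + dist u w"
    by (rule dist_triangle2)
  finally show ?thesis using w(2) u(2) by linarith
qed

section \<open>Geodesic rays as limits of segments\<close>

lemma geodesic_spaceE:
  assumes "geodesic_space TYPE('a::metric_space)"
  obtains \<gamma> where "\<gamma> 0 = (x::'a)" "\<gamma> (dist x y) = y"
    "\<forall>s\<in>{0..dist x y}. \<forall>t\<in>{0..dist x y}. dist (\<gamma> s) (\<gamma> t) = \<bar>s - t\<bar>"
proof -
  obtain S where S: "geodesic_segment S x y"
    using assms unfolding geodesic_space_def by blast
  show thesis
    using geodesic_segmentE[OF S] that by blast
qed

lemma geodesic_space_point:
  assumes "geodesic_space TYPE('a::metric_space)" "0 \<le> R" "R \<le> dist x (y::'a)"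
  obtains z where "dist x z = R" "dist z y = dist x y - R"
proof -
  obtain \<gamma> where g: "\<gamma> 0 = x" "\<gamma> (dist x y) = y"
    "\<forall>s\<in>{0..dist x y}. \<forall>t\<in>{0..dist x y}. dist (\<gamma> s) (\<gamma> t) = \<bar>s - t\<bar>"
    using geodesic_spaceE[OF assms(1), of x y] by blast
  have "dist (\<gamma> 0) (\<gamma> R) = R" "dist (\<gamma> R) (\<gamma> (dist x y)) = dist x y - R"
    using assms(2,3) by (subst g(3)[rule_format]; simp)+
  then show thesis
    unfolding g(1,2) by (rule that)
qed

text \<open>Arzela-Ascoli by Tychonoff: the values at rational times lie in a product of closed
  balls, compact by properness and sequentially compact because the index set is countable. The
  Lipschitz bound extends convergence to real times.\<close>

lemma lipschitz_convergent_subsequence: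
  fixes G :: "nat \<Rightarrow> real \<Rightarrow> 'a::heine_borel"
  assumes lip: "\<And>n s t. dist (G n s) (G n t) \<le> \<bar>s - t\<bar>" and G0: "\<And>n. G n 0 = p"
  obtains r \<gamma> where "strict_mono r" "\<forall>t. (\<lambda>n. G (r n) t) \<longlonglongrightarrow> \<gamma> t"
proof -
  define K where "K = PiE UNIV (\<lambda>q::rat. cball p \<bar>real_of_rat q\<bar>)"
  have "compactin (product_topology (\<lambda>i. euclidean) UNIV) K"
    unfolding K_def by (subst compactin_PiE) auto
  then have "compact K"
    by (simp add: euclidean_product_topology)
  then have sc: "seq_compact K"
    by (simp add: compact_imp_seq_compact)
  have inK: "\<forall>n. (\<lambda>q. G n (real_of_rat q)) \<in> K"
  proof -
    have "dist p (G n (real_of_rat q)) \<le> \<bar>real_of_rat q\<bar>" for n q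
      using lip[of n 0 "real_of_rat q"] unfolding G0 by simp
    then show ?thesis
      unfolding K_def by (intro allI PiE_I) (simp_all only: mem_cball UNIV_I not_True_eq_False)
  qed
  obtain \<phi> r where "\<phi> \<in> K" and r: "strict_mono r" "((\<lambda>n q. G n (real_of_rat q)) \<circ> r) \<longlonglongrightarrow> \<phi>"
    using seq_compactE[OF sc inK] .
  have cq: "(\<lambda>n. G (r n) (real_of_rat q)) \<longlonglongrightarrow> \<phi> q" for q
    using continuous_on_tendsto_compose[OF continuous_on_product_coordinates[of q] r(2)]
    by (simp add: o_def)
  have "Cauchy (\<lambda>n. G (r n) t)" for t
  proof (rule metric_CauchyI)
    fix e :: real assume e: "e > 0"
    have "t - e / 3 < t + e / 3" using e by simp
    then obtain q where "t - e / 3 < real_of_rat q" "real_of_rat q < t + e / 3"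
      using of_rat_dense by blast
    then have q: "\<bar>t - real_of_rat q\<bar> < e / 3" by linarith
    obtain N where N: "\<And>m n. m \<ge> N \<Longrightarrow> n \<ge> N \<Longrightarrow> dist (G (r m) (real_of_rat q)) (G (r n) (real_of_rat q)) < e / 3"
      using LIMSEQ_imp_Cauchy[OF cq[of q]] e unfolding Cauchy_def by (metis divide_pos_pos zero_less_numeral)
    have "dist (G (r m) t) (G (r n) t) < e" if mn: "m \<ge> N" "n \<ge> N" for m n
    proof -
      have "dist (G (r m) t) (G (r n) t) \<le> dist (G (r m) t) (G (r m) (real_of_rat q))
          + dist (G (r m) (real_of_rat q)) (G (r n) (real_of_rat q)) + dist (G (r n) (real_of_rat q)) (G (r n) t)"
        using dist_triangle[of "G (r m) t" "G (r n) t" "G (r m) (real_of_rat q)"]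
          dist_triangle[of "G (r m) (real_of_rat q)" "G (r n) t" "G (r n) (real_of_rat q)"] by linarith
      then show ?thesis
        using lip[of "r m" t "real_of_rat q"] lip[of "r n" "real_of_rat q" t] N[OF mn] q by linarith
    qed
    then show "\<exists>N. \<forall>m\<ge>N. \<forall>n\<ge>N. dist (G (r m) t) (G (r n) t) < e" by blast
  qed
  then have "(\<lambda>n. G (r n) t) \<longlonglongrightarrow> lim (\<lambda>n. G (r n) t)" for t
    using Cauchy_convergent convergent_LIMSEQ_iff by blast
  then show thesis by (intro that[OF r(1)] allI)
qed

lemma geodesic_ray_limit:
  fixes y :: "nat \<Rightarrow> 'a::heine_borel"
  assumes geo: "geodesic_space TYPE('a)" and inf: "filterlim (\<lambda>n. dist p (y n)) at_top sequentially"
  obtains r \<gamma> where "strict_mono r" "geodesic_ray \<gamma>" "\<gamma> 0 = p"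
    "\<forall>t\<ge>0. (\<lambda>n. gromov_product p (y (r n)) (\<gamma> t)) \<longlonglongrightarrow> t"
proof -
  define L where "L n = dist p (y n)" for n
  have "\<exists>g. g 0 = p \<and> g (L n) = y n \<and> (\<forall>s\<in>{0..L n}. \<forall>t\<in>{0..L n}. dist (g s) (g t) = \<bar>s - t\<bar>)" for n
    unfolding L_def using geodesic_spaceE[OF geo, of p "y n"] by metis
  then obtain g where "\<forall>n. g n 0 = p \<and> g n (L n) = y n \<and>
      (\<forall>s\<in>{0..L n}. \<forall>t\<in>{0..L n}. dist (g n s) (g n t) = \<bar>s - t\<bar>)"
    using choice[of "\<lambda>n g. g 0 = p \<and> g (L n) = y n \<and>
      (\<forall>s\<in>{0..L n}. \<forall>t\<in>{0..L n}. dist (g s) (g t) = \<bar>s - t\<bar>)"] by blast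
  then have g: "\<And>n. g n 0 = p" "\<And>n. g n (L n) = y n"
      "\<And>n s t. 0 \<le> s \<Longrightarrow> s \<le> L n \<Longrightarrow> 0 \<le> t \<Longrightarrow> t \<le> L n \<Longrightarrow> dist (g n s) (g n t) = \<bar>s - t\<bar>"
    by auto
  have L0: "0 \<le> L n" for n
    by (simp add: L_def)
  \<comment> \<open>Clamping the parameter turns segments of different lengths into 1-Lipschitz maps
    of the whole line.\<close>
  define G where "G n t = g n (max 0 (min t (L n)))" for n t
  have G_eq: "G n t = g n t" if "0 \<le> t" "t \<le> L n" for n t
    using that by (simp add: G_def)
  have lip: "dist (G n s) (G n t) \<le> \<bar>s - t\<bar>" for n s t
    unfolding G_def using L0[of n] by (subst g(3)) auto
  have G0: "G n 0 = p" for n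
    using L0[of n] by (simp add: G_eq g(1))
  obtain r \<gamma> where r: "strict_mono r" and lim': "\<forall>t. (\<lambda>n. G (r n) t) \<longlonglongrightarrow> \<gamma> t"
    using lipschitz_convergent_subsequence[of G p, OF lip G0] .
  have lim: "(\<lambda>n. G (r n) t) \<longlonglongrightarrow> \<gamma> t" for t
    using lim' by blast
  have inf': "\<forall>\<^sub>F n in sequentially. t \<le> L (r n)" for t
    unfolding L_def using filterlim_compose[OF inf filterlim_subseq[OF r]] by (simp add: filterlim_at_top)
  have "dist (\<gamma> s) (\<gamma> t) = \<bar>s - t\<bar>" if "s \<ge> 0" "t \<ge> 0" for s t
  proof (rule LIMSEQ_unique)
    show "(\<lambda>n. dist (G (r n) s) (G (r n) t)) \<longlonglongrightarrow> dist (\<gamma> s) (\<gamma> t)"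
      by (intro tendsto_dist lim)
    show "(\<lambda>n. dist (G (r n) s) (G (r n) t)) \<longlonglongrightarrow> \<bar>s - t\<bar>"
      by (rule tendsto_eventually, rule eventually_mono[OF eventually_conj[OF inf'[of s] inf'[of t]]])
        (use that in \<open>auto simp: G_eq g(3)\<close>)
  qed
  then have ray: "geodesic_ray \<gamma>"
    by (simp add: geodesic_ray_def)
  have g0: "\<gamma> 0 = p"
    using lim[of 0] by (simp add: G0 LIMSEQ_const_iff)
  have "(\<lambda>n. gromov_product p (y (r n)) (\<gamma> t)) \<longlonglongrightarrow> t" if t: "t \<ge> 0" for t
  proof -
    \<comment> \<open>Before the limit the product with the point of the segment at parameter
      \<open>t\<close> is exactly \<open>t\<close>; replacing that point by
      \<open>\<gamma> t\<close> costs their distance.\<close>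
    have "\<forall>\<^sub>F n in sequentially. norm (gromov_product p (y (r n)) (\<gamma> t) - t) \<le> dist (G (r n) t) (\<gamma> t)"
      using inf'[of t]
    proof eventually_elim
      case (elim n)
      have "dist (g (r n) (L (r n))) (g (r n) t) = L (r n) - t" "dist (g (r n) 0) (g (r n) t) = t"
        using t elim by (simp_all add: g(3))
      then have "dist (y (r n)) (G (r n) t) = dist p (y (r n)) - t" "dist p (G (r n) t) = t"
        unfolding g(1,2) using t elim by (simp_all add: G_eq) (simp_all add: L_def)
      then have "gromov_product p (y (r n)) (G (r n) t) = t"
        by (simp add: gromov_product_def dist_commute)
      then show ?case
        using gromov_product_diff'[of p "y (r n)" "G (r n) t" "\<gamma> t"]
          gromov_product_diff'[of p "y (r n)" "\<gamma> t" "G (r n) t"] by (simp add: dist_commute)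
    qed
    moreover have "(\<lambda>n. dist (G (r n) t) (\<gamma> t)) \<longlonglongrightarrow> 0"
      using lim[of t] by (simp add: tendsto_dist_iff[symmetric])
    ultimately have "(\<lambda>n. gromov_product p (y (r n)) (\<gamma> t) - t) \<longlonglongrightarrow> 0"
      by (rule Lim_null_comparison)
    then show ?thesis by (simp add: LIM_zero_iff)
  qed
  then show thesis by (intro that[OF r ray g0]) blast
qed

section \<open>Busemann functions\<close>

text \<open>The expression is decreasing in \<open>t\<close> along a ray, so the infimum is the
  usual limit.\<close>

definition busemann :: "(real \<Rightarrow> 'a::metric_space) \<Rightarrow> 'a \<Rightarrow> real" where
  "busemann \<gamma> x = (INF t\<in>{0..}. dist (\<gamma> t) x - t)"

text \<open>The limit of the products of \<open>x\<close> with \<open>\<gamma> t\<close>, written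
  through the Busemann function: the product of \<open>x\<close> with the end of
  \<open>\<gamma>\<close>, measured along this one ray.\<close>

definition ray_product :: "'a::metric_space \<Rightarrow> 'a \<Rightarrow> (real \<Rightarrow> 'a) \<Rightarrow> real" where
  "ray_product p x \<gamma> = (dist x p + busemann \<gamma> p - busemann \<gamma> x) / 2"

lemma geodesic_rayD: "geodesic_ray \<gamma> \<Longrightarrow> s \<ge> 0 \<Longrightarrow> t \<ge> 0 \<Longrightarrow> dist (\<gamma> s) (\<gamma> t) = \<bar>s - t\<bar>"
  by (simp add: geodesic_ray_def)

lemma geodesic_ray_dist_ge: "geodesic_ray \<gamma> \<Longrightarrow> t \<ge> 0 \<Longrightarrow> t - dist (\<gamma> 0) x \<le> dist (\<gamma> t) x"
  using geodesic_rayD[of \<gamma> 0 t] dist_triangle[of "\<gamma> 0" "\<gamma> t" x] by (simp add: dist_commute)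

lemma busemann_bdd_below:
  assumes "geodesic_ray \<gamma>"
  shows "bdd_below ((\<lambda>t. dist (\<gamma> t) x - t) ` {0..})"
  using geodesic_ray_dist_ge[OF assms, of _ x] by (intro bdd_belowI2[of _ "- dist (\<gamma> 0) x"]) force

lemma busemann_le: "geodesic_ray \<gamma> \<Longrightarrow> t \<ge> 0 \<Longrightarrow> busemann \<gamma> x \<le> dist (\<gamma> t) x - t"
  unfolding busemann_def by (rule cINF_lower[OF busemann_bdd_below]) auto

lemma busemann_tendsto:
  assumes "geodesic_ray \<gamma>"
  shows "((\<lambda>t. dist (\<gamma> t) x - t) \<longlongrightarrow> busemann \<gamma> x) at_top"
proof (rule decreasing_tendsto)
  show "\<forall>\<^sub>F t in at_top. busemann \<gamma> x \<le> dist (\<gamma> t) x - t"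
    using eventually_ge_at_top[of 0] by eventually_elim (rule busemann_le[OF assms])
  fix y assume "busemann \<gamma> x < y"
  then obtain s where s: "s \<ge> 0" "dist (\<gamma> s) x - s < y"
    unfolding busemann_def using cINF_less_iff[OF _ busemann_bdd_below[OF assms, of x], of y] by auto
  show "\<forall>\<^sub>F t in at_top. dist (\<gamma> t) x - t < y"
    using eventually_ge_at_top[of s]
  proof eventually_elim
    case (elim t)
    then show ?case
      using dist_triangle[of "\<gamma> t" x "\<gamma> s"] geodesic_rayD[OF assms, of t s] s by simp
  qed
qed

lemma busemann_eqI:
  "geodesic_ray \<gamma> \<Longrightarrow> ((\<lambda>t. dist (\<gamma> t) x - t) \<longlongrightarrow> l) at_top \<Longrightarrow> busemann \<gamma> x = l"
  using busemann_tendsto tendsto_unique trivial_limit_at_top_linorder by blast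

lemma busemann_diff_le:
  assumes "geodesic_ray \<gamma>"
  shows "busemann \<gamma> x - busemann \<gamma> y \<le> dist x y"
proof -
  have "busemann \<gamma> x \<le> busemann \<gamma> y + dist x y"
  proof (rule tendsto_le[OF trivial_limit_at_top_linorder _ busemann_tendsto[OF assms, of x]])
    show "((\<lambda>t. dist (\<gamma> t) y - t + dist x y) \<longlongrightarrow> busemann \<gamma> y + dist x y) at_top"
      by (intro tendsto_intros busemann_tendsto assms)
    show "\<forall>\<^sub>F t in at_top. dist (\<gamma> t) x - t \<le> dist (\<gamma> t) y - t + dist x y"
      using dist_triangle[of "\<gamma> _" x y] by (simp add: dist_commute)
  qed
  then show ?thesis by simp
qed

lemma busemann_on_ray:
  assumes "geodesic_ray \<gamma>" "t \<ge> 0"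
  shows "busemann \<gamma> (\<gamma> t) = - t"
proof (rule busemann_eqI[OF assms(1)], rule tendsto_eventually)
  show "\<forall>\<^sub>F s in at_top. dist (\<gamma> s) (\<gamma> t) - s = - t"
    using eventually_ge_at_top[of t] by eventually_elim (use assms in \<open>simp add: geodesic_rayD\<close>)
qed

lemma ray_product_tendsto:
  assumes "geodesic_ray \<gamma>"
  shows "((\<lambda>t. gromov_product p x (\<gamma> t)) \<longlongrightarrow> ray_product p x \<gamma>) at_top"
proof -
  have "((\<lambda>t. (dist x p + (dist (\<gamma> t) p - t) - (dist (\<gamma> t) x - t)) / 2) \<longlongrightarrow> ray_product p x \<gamma>) at_top"
    unfolding ray_product_def by (intro tendsto_intros busemann_tendsto assms) simp
  then show ?thesis
    by (simp add: gromov_product_def dist_commute algebra_simps)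
qed

lemma ray_product_diff:
  "geodesic_ray \<gamma> \<Longrightarrow> ray_product p x \<gamma> - ray_product p y \<gamma> \<le> dist x y"
  using busemann_diff_le[of \<gamma> y x] dist_triangle[of x p y]
  by (simp add: ray_product_def dist_commute field_simps)

lemma ray_product_le_dist: "geodesic_ray \<gamma> \<Longrightarrow> ray_product p x \<gamma> \<le> dist x p"
  using busemann_diff_le[of \<gamma> p x] by (simp add: ray_product_def dist_commute field_simps)

lemma ray_product_ge_busemann:
  "(busemann \<gamma> p - busemann \<gamma> x) / 2 \<le> ray_product p x \<gamma>"
  by (simp add: ray_product_def field_simps)

lemma ray_product_on_ray:
  assumes "geodesic_ray \<gamma>" "t \<ge> 0"
  shows "t - dist (\<gamma> 0) p \<le> ray_product p (\<gamma> t) \<gamma>"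
  using geodesic_ray_dist_ge[OF assms, of p] busemann_diff_le[OF assms(1), of "\<gamma> 0" p]
    busemann_on_ray[OF assms(1), of 0] busemann_on_ray[OF assms]
  by (simp add: ray_product_def field_simps)

lemma ray_product_on_ray_base:
  assumes "geodesic_ray \<gamma>" "t \<ge> 0" "\<gamma> 0 = p"
  shows "ray_product p (\<gamma> t) \<gamma> = t"
  using busemann_on_ray[OF assms(1), of 0] busemann_on_ray[OF assms(1,2)] geodesic_rayD[OF assms(1,2), of 0] assms(2,3)
  by (simp add: ray_product_def field_simps)

section \<open>Asymptotic rays\<close>

lemma asymptotic_rays_iff:
  "(\<gamma>, \<sigma>) \<in> asymptotic_rays \<longleftrightarrow> geodesic_ray \<gamma> \<and> geodesic_ray \<sigma> \<and> (\<exists>C. \<forall>t\<ge>0. dist (\<gamma> t) (\<sigma> t) \<le> C)"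
  unfolding asymptotic_rays_def bdd_above_def by auto

lemma equiv_asymptotic_rays: "equiv {\<gamma>. geodesic_ray \<gamma>} asymptotic_rays"
proof (rule equivI)
  show "asymptotic_rays \<subseteq> {\<gamma>. geodesic_ray \<gamma>} \<times> {\<gamma>. geodesic_ray \<gamma>}"
    by (auto simp: asymptotic_rays_def)
  show "refl_on {\<gamma>. geodesic_ray \<gamma>} asymptotic_rays"
    by (auto simp: refl_on_def asymptotic_rays_iff)
  show "sym asymptotic_rays"
    by (auto simp: sym_def asymptotic_rays_iff dist_commute)
  show "trans asymptotic_rays"
  proof (rule transI)
    fix \<gamma> \<sigma> \<tau>
    assume "(\<gamma>, \<sigma>) \<in> asymptotic_rays" "(\<sigma>, \<tau>) \<in> asymptotic_rays"
    then obtain C D where h: "geodesic_ray \<gamma>" "geodesic_ray \<tau>"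
      "\<forall>t\<ge>0. dist (\<gamma> t) (\<sigma> t) \<le> C" "\<forall>t\<ge>0. dist (\<sigma> t) (\<tau> t) \<le> D"
      by (auto simp: asymptotic_rays_iff)
    have "dist (\<gamma> t) (\<tau> t) \<le> C + D" if "t \<ge> 0" for t
      using dist_triangle[of "\<gamma> t" "\<tau> t" "\<sigma> t"] h(3,4)[rule_format, OF that] by linarith
    then show "(\<gamma>, \<tau>) \<in> asymptotic_rays"
      using h(1,2) by (auto simp: asymptotic_rays_iff)
  qed
qed

definition ray_class :: "(real \<Rightarrow> 'a::metric_space) \<Rightarrow> (real \<Rightarrow> 'a) set" where
  "ray_class \<gamma> = asymptotic_rays `` {\<gamma>}"

lemma ray_class_in_boundary: "geodesic_ray \<gamma> \<Longrightarrow> ray_class \<gamma> \<in> gromov_boundary"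
  unfolding ray_class_def gromov_boundary_def by (rule quotientI) simp

lemma self_in_ray_class: "geodesic_ray \<gamma> \<Longrightarrow> \<gamma> \<in> ray_class \<gamma>"
  unfolding ray_class_def using equiv_class_self[OF equiv_asymptotic_rays] by blast

lemma gromov_boundary_ray:
  assumes "\<eta> \<in> gromov_boundary" "\<gamma> \<in> \<eta>"
  shows "geodesic_ray \<gamma>" "\<eta> = ray_class \<gamma>"
proof -
  obtain \<sigma> where s: "geodesic_ray \<sigma>" "\<eta> = asymptotic_rays `` {\<sigma>}"
    using assms(1) unfolding gromov_boundary_def by (auto elim: quotientE)
  then have "(\<sigma>, \<gamma>) \<in> asymptotic_rays" using assms(2) by simp
  then show "geodesic_ray \<gamma>" "\<eta> = ray_class \<gamma>"
    using s(2) equiv_class_eq[OF equiv_asymptotic_rays] by (auto simp: asymptotic_rays_iff ray_class_def)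
qed

lemma gromov_boundary_nonempty:
  assumes "\<eta> \<in> gromov_boundary"
  obtains \<gamma> where "\<gamma> \<in> \<eta>"
proof -
  obtain \<sigma> where "geodesic_ray \<sigma>" "\<eta> = ray_class \<sigma>"
    using assms unfolding gromov_boundary_def ray_class_def by (auto elim: quotientE)
  then show thesis using that self_in_ray_class by blast
qed

lemma ray_class_eqI: "(\<gamma>, \<sigma>) \<in> asymptotic_rays \<Longrightarrow> ray_class \<gamma> = ray_class \<sigma>"
  unfolding ray_class_def by (rule equiv_class_eq[OF equiv_asymptotic_rays])

lemma ray_class_mem_iff: "\<sigma> \<in> ray_class \<gamma> \<longleftrightarrow> (\<gamma>, \<sigma>) \<in> asymptotic_rays"
  by (simp add: ray_class_def)

text \<open>The two points are at distance at most \<open>\<bar>s - t\<bar> + C\<close>, so their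
  product is the smaller of \<open>s\<close> and \<open>t\<close> up to a constant.\<close>

lemma asymptotic_rays_gromov_product:
  assumes "(\<gamma>, \<sigma>) \<in> asymptotic_rays"
  shows "\<exists>N. \<forall>s\<ge>N. \<forall>t\<ge>N. gromov_product p (\<gamma> s) (\<sigma> t) > M"
proof -
  obtain C where h: "geodesic_ray \<gamma>" "geodesic_ray \<sigma>" "\<forall>t\<ge>0. dist (\<gamma> t) (\<sigma> t) \<le> C"
    using assms by (auto simp: asymptotic_rays_iff)
  define K where "K = (dist (\<gamma> 0) p + dist (\<sigma> 0) p + C) / 2"
  have "gromov_product p (\<gamma> s) (\<sigma> t) > M" if "s \<ge> max 0 (M + K + 1)" "t \<ge> max 0 (M + K + 1)" for s t
  proof -
    have "dist (\<gamma> s) (\<sigma> t) \<le> \<bar>s - t\<bar> + C"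
      using dist_triangle[of "\<gamma> s" "\<sigma> t" "\<gamma> t"] geodesic_rayD[OF h(1), of s t] h(3)[rule_format, of t] that by simp
    moreover have "s - dist (\<gamma> 0) p \<le> dist (\<gamma> s) p" "t - dist (\<sigma> 0) p \<le> dist (\<sigma> t) p"
      using geodesic_ray_dist_ge h(1,2) that by auto
    ultimately have "s + t - \<bar>s - t\<bar> - 2 * K \<le> 2 * gromov_product p (\<gamma> s) (\<sigma> t)"
      by (simp add: gromov_product_def K_def field_simps)
    then show ?thesis using that by linarith
  qed
  then show ?thesis by blast
qed

section \<open>The extended Gromov product\<close>

lemma eventually_at_top_prod_iff:
  "eventually P (at_top \<times>\<^sub>F at_top) \<longleftrightarrow> (\<exists>N::real. \<forall>s\<ge>N. \<forall>t\<ge>N. P (s, t))"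
proof
  assume "eventually P (at_top \<times>\<^sub>F at_top)"
  then obtain A B :: "real \<Rightarrow> bool" where AB: "eventually A at_top" "eventually B at_top" "\<forall>x y. A x \<longrightarrow> B y \<longrightarrow> P (x, y)"
    unfolding eventually_prod_filter by blast
  obtain M where M: "\<forall>s\<ge>M. A s" using AB(1) unfolding eventually_at_top_linorder by blast
  obtain N where N: "\<forall>s\<ge>N. B s" using AB(2) unfolding eventually_at_top_linorder by blast
  show "\<exists>N. \<forall>s\<ge>N. \<forall>t\<ge>N. P (s, t)"
    using M N AB(3) by (intro exI[of _ "max M N"]) simp
next
  assume "\<exists>N. \<forall>s\<ge>N. \<forall>t\<ge>N. P (s, t)"
  then obtain N :: real where "\<forall>s\<ge>N. \<forall>t\<ge>N. P (s, t)" by blast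
  then show "eventually P (at_top \<times>\<^sub>F at_top)"
    unfolding eventually_prod_filter
    by (intro exI[of _ "\<lambda>s. s \<ge> N"]) (auto simp: eventually_ge_at_top)
qed

lemma extended_gromov_product_ge:
  assumes "\<gamma> \<in> representing_paths \<xi>" "\<sigma> \<in> representing_paths \<zeta>"
    and "\<forall>s\<ge>N. \<forall>t\<ge>N. r \<le> gromov_product p (\<gamma> s) (\<sigma> t)"
  shows "ereal r \<le> extended_gromov_product p \<xi> \<zeta>"
proof -
  have "ereal r \<le> Liminf (at_top \<times>\<^sub>F at_top) (\<lambda>(s, t). ereal (gromov_product p (\<gamma> s) (\<sigma> t)))"
    by (rule Liminf_bounded) (use assms(3) in \<open>auto simp: eventually_at_top_prod_iff\<close>)
  then show ?thesis
    unfolding extended_gromov_product_def using assms(1,2) by (intro SUP_upper2[OF assms(1)] SUP_upper2[OF assms(2)])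
qed

lemma extended_gromov_product_gtE:
  assumes "ereal r < extended_gromov_product p \<xi> \<zeta>"
  obtains \<gamma> \<sigma> N where "\<gamma> \<in> representing_paths \<xi>" "\<sigma> \<in> representing_paths \<zeta>"
    "\<forall>s\<ge>N. \<forall>t\<ge>N. r < gromov_product p (\<gamma> s) (\<sigma> t)"
proof -
  obtain \<gamma> \<sigma> where g: "\<gamma> \<in> representing_paths \<xi>" "\<sigma> \<in> representing_paths \<zeta>"
    "ereal r < Liminf (at_top \<times>\<^sub>F at_top) (\<lambda>(s, t). ereal (gromov_product p (\<gamma> s) (\<sigma> t)))"
    using assms unfolding extended_gromov_product_def less_SUP_iff by blast
  from less_LiminfD[OF g(3)] obtain N where "\<forall>s\<ge>N. \<forall>t\<ge>N. r < gromov_product p (\<gamma> s) (\<sigma> t)"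
    by (auto simp: eventually_at_top_prod_iff)
  with g(1,2) show thesis by (rule that)
qed

section \<open>Proper geodesic hyperbolic spaces\<close>

text \<open>Properness is the class \<open>heine_borel\<close>. Hyperbolicity enters only as the
  four-point inequality, with one constant for all base points; \<open>base\<close> will become the
  first point of the backward orbit.\<close>

locale proper_hyperbolic =
  fixes base :: "'a::heine_borel" and \<Delta> :: real
  assumes geodesic: "geodesic_space TYPE('a)"
    and four_point: "min (gromov_product p x y) (gromov_product p y z) - \<Delta> \<le> gromov_product p x (z::'a)"
begin

abbreviation gp :: "'a \<Rightarrow> 'a \<Rightarrow> real" where "gp \<equiv> gromov_product base"
abbreviation rp :: "'a \<Rightarrow> (real \<Rightarrow> 'a) \<Rightarrow> real" where "rp \<equiv> ray_product base"

lemma \<Delta>_nonneg: "0 \<le> \<Delta>"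
  using four_point[of base base base base] by simp

lemma four_pointD:
  "r \<le> gromov_product p x y \<Longrightarrow> r \<le> gromov_product p y z \<Longrightarrow> r - \<Delta> \<le> gromov_product p x (z::'a)"
  using four_point[of p x y z] by linarith

lemma eventually_gp_gt:
  assumes "geodesic_ray \<gamma>" "r < rp x \<gamma>"
  shows "\<exists>N. \<forall>t\<ge>N. r < gp x (\<gamma> t)"
  using order_tendstoD(1)[OF ray_product_tendsto[OF assms(1)] assms(2)]
  by (simp add: eventually_at_top_linorder)

lemma ray_product_geI:
  assumes "geodesic_ray \<gamma>" "\<forall>t\<ge>N. r \<le> gp x (\<gamma> t)"
  shows "r \<le> rp x \<gamma>"
proof (rule tendsto_lowerbound[OF ray_product_tendsto[OF assms(1)]])
  show "\<forall>\<^sub>F t in at_top. r \<le> gp x (\<gamma> t)"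
    using assms(2) by (auto simp: eventually_at_top_linorder)
qed simp

lemma ray_product_four_point:
  assumes "geodesic_ray \<gamma>" "r \<le> gp x y" "r \<le> rp y \<gamma>"
  shows "r - \<Delta> \<le> rp x \<gamma>"
proof (rule field_le_epsilon)
  fix e :: real assume "e > 0"
  then obtain N where "\<forall>t\<ge>N. r - e < gp y (\<gamma> t)"
    using eventually_gp_gt[OF assms(1), of "r - e" y] assms(3) by auto
  then have "\<forall>t\<ge>N. r - e - \<Delta> \<le> gp x (\<gamma> t)"
    using four_pointD[of "r - e" base x y] assms(2) \<open>e > 0\<close> by force
  then have "r - e - \<Delta> \<le> rp x \<gamma>"
    by (rule ray_product_geI[OF assms(1)])
  then show "r - \<Delta> \<le> rp x \<gamma> + e" by simp
qed

lemma ray_product_four_point':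
  assumes "geodesic_ray \<gamma>" "r \<le> rp x \<gamma>" "r \<le> rp y \<gamma>"
  shows "r - \<Delta> \<le> gp x y"
proof (rule field_le_epsilon)
  fix e :: real assume e: "e > 0"
  obtain N where N: "\<forall>t\<ge>N. r - e < gp x (\<gamma> t)"
    using eventually_gp_gt[OF assms(1), of "r - e" x] assms(2) e by auto
  obtain M where M: "\<forall>t\<ge>M. r - e < gp y (\<gamma> t)"
    using eventually_gp_gt[OF assms(1), of "r - e" y] assms(3) e by auto
  have "r - e - \<Delta> \<le> gp x y"
    by (rule four_pointD[of _ _ _ "\<gamma> (max M N)"])
      (use N M in \<open>auto simp: gromov_product_commute intro: less_imp_le\<close>)
  then show "r - \<Delta> \<le> gp x y + e" by simp
qed

text \<open>Both products of \<open>z\<close> are at most \<open>dist z base\<close>, hence at most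
  the product of \<open>w\<close> with the end. In each use of the four-point inequality the minimum
  is therefore the product of \<open>z\<close>.\<close>

lemma gromov_product_near_end:
  assumes "geodesic_ray \<gamma>" "dist z base \<le> rp w \<gamma>"
  shows "\<bar>gp z w - rp z \<gamma>\<bar> \<le> \<Delta>"
  using ray_product_four_point[OF assms(1), of "gp z w" z w] ray_product_four_point'[OF assms(1), of "rp z \<gamma>" z w]
    gromov_product_le_dist(1)[of base z w] ray_product_le_dist[OF assms(1), of base z] assms(2)
  by (simp add: abs_le_iff)

lemma busemann_near_end:
  assumes "geodesic_ray \<gamma>" "dist z base \<le> rp w \<gamma>"
  shows "\<bar>(dist z w - dist base w) - (busemann \<gamma> z - busemann \<gamma> base)\<bar> \<le> 2 * \<Delta>"
  using gromov_product_near_end[OF assms]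
  by (simp add: gromov_product_def ray_product_def dist_commute abs_le_iff field_simps)

text \<open>Pass through a point far out on \<open>\<gamma>\<close>: its product with far points of
  \<open>\<sigma>\<close> is as large as desired, so only one \<open>\<Delta>\<close> is
  lost.\<close>

lemma ray_product_asymptotic:
  assumes "(\<gamma>, \<sigma>) \<in> asymptotic_rays"
  shows "rp x \<gamma> - \<Delta> \<le> rp x \<sigma>"
proof -
  have r: "geodesic_ray \<gamma>" "geodesic_ray \<sigma>"
    using assms by (auto simp: asymptotic_rays_iff)
  show ?thesis
  proof (rule field_le_epsilon)
    fix e :: real assume e: "e > 0"
    obtain N where N: "\<forall>t\<ge>N. rp x \<gamma> - e < gp x (\<gamma> t)"
      using eventually_gp_gt[OF r(1), of "rp x \<gamma> - e" x] e by auto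
    obtain M where M: "\<forall>s\<ge>M. \<forall>t\<ge>M. rp x \<gamma> < gp (\<gamma> s) (\<sigma> t)"
      using asymptotic_rays_gromov_product[OF assms] by blast
    have "rp x \<gamma> - e - \<Delta> \<le> gp x (\<sigma> t)" if "t \<ge> M" for t
    proof (rule four_pointD[of _ _ _ "\<gamma> (max M N)"])
      show "rp x \<gamma> - e \<le> gp x (\<gamma> (max M N))"
        using N by (simp add: less_imp_le)
      have "rp x \<gamma> < gp (\<gamma> (max M N)) (\<sigma> t)"
        using M that by simp
      then show "rp x \<gamma> - e \<le> gp (\<gamma> (max M N)) (\<sigma> t)"
        using e by simp
    qed
    then have "rp x \<gamma> - e - \<Delta> \<le> rp x \<sigma>"
      using ray_product_geI[OF r(2)] by blast
    then show "rp x \<gamma> - \<Delta> \<le> rp x \<sigma> + e" by simp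
  qed
qed

lemma asymptoticI:
  assumes r: "geodesic_ray \<gamma>" "geodesic_ray \<sigma>"
    and w: "\<And>M. \<exists>w. rp w \<gamma> > M \<and> rp w \<sigma> > M"
  shows "(\<gamma>, \<sigma>) \<in> asymptotic_rays"
proof -
  define K where "K = dist (\<gamma> 0) base + dist (\<sigma> 0) base"
  \<comment> \<open>Through \<open>w\<close> the product of \<open>\<gamma> t\<close> and
    \<open>\<sigma> t\<close> is at least \<open>t - K - 2 * \<Delta>\<close>, while their distances
    to \<open>base\<close> add up to at most \<open>2 * t + K\<close>.\<close>
  have "dist (\<gamma> t) (\<sigma> t) \<le> 3 * K + 4 * \<Delta>" if t: "t \<ge> 0" for t
  proof -
    obtain w where w: "rp w \<gamma> > t" "rp w \<sigma> > t"
      using assms(3) by blast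
    have K: "0 \<le> K" by (simp add: K_def)
    have a: "t - K \<le> rp (\<gamma> t) \<gamma>" "t - K \<le> rp (\<sigma> t) \<sigma>"
      using ray_product_on_ray[OF r(1) t, of base] ray_product_on_ray[OF r(2) t, of base]
      unfolding K_def by (smt (verit) zero_le_dist)+
    have "t - K - \<Delta> \<le> gp (\<gamma> t) w" "t - K - \<Delta> \<le> gp w (\<sigma> t)"
      using ray_product_four_point'[OF r(1) a(1), of w] ray_product_four_point'[OF r(2) _ a(2), of w] w K by auto
    then have "t - K - \<Delta> - \<Delta> \<le> gp (\<gamma> t) (\<sigma> t)"
      by (rule four_pointD)
    moreover have "dist (\<gamma> t) base \<le> t + dist (\<gamma> 0) base" "dist (\<sigma> t) base \<le> t + dist (\<sigma> 0) base"
      using dist_triangle[of "\<gamma> t" base "\<gamma> 0"] dist_triangle[of "\<sigma> t" base "\<sigma> 0"]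
        geodesic_rayD[OF r(1) t, of 0] geodesic_rayD[OF r(2) t, of 0] t by auto
    ultimately show ?thesis
      by (simp add: gromov_product_def K_def)
  qed
  then show ?thesis
    using r by (auto simp: asymptotic_rays_iff)
qed

section \<open>The Gromov topology\<close>

lemma extended_gromov_product_base_change:
  assumes "ereal r < extended_gromov_product p \<xi> \<zeta>"
  shows "ereal (r - dist p q) \<le> extended_gromov_product q \<xi> \<zeta>"
proof -
  obtain \<gamma> \<sigma> N where g: "\<gamma> \<in> representing_paths \<xi>" "\<sigma> \<in> representing_paths \<zeta>"
    "\<forall>s\<ge>N. \<forall>t\<ge>N. r < gromov_product p (\<gamma> s) (\<sigma> t)"
    using extended_gromov_product_gtE[OF assms] .
  show ?thesis
  proof (rule extended_gromov_product_ge[OF g(1,2)], intro allI impI)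
    fix s t assume "s \<ge> N" "t \<ge> N"
    then show "r - dist p q \<le> gromov_product q (\<gamma> s) (\<sigma> t)"
      using g(3)[rule_format, of s t] gromov_product_base_diff[of p "\<gamma> s" "\<sigma> t" q] by simp
  qed
qed

text \<open>The two products may be realised by different rays of \<open>\<eta>\<close>, so the
  chain has an additional link between asymptotic rays; this accounts for the second
  \<open>\<Delta>\<close>.\<close>

lemma extended_gromov_product_four_point:
  assumes \<eta>: "\<eta> \<in> gromov_boundary"
    and 1: "ereal r < extended_gromov_product base \<xi> (Inr \<eta>)"
    and 2: "ereal r < extended_gromov_product base (Inr \<eta>) \<zeta>"
  shows "ereal (r - 2 * \<Delta>) \<le> extended_gromov_product base \<xi> \<zeta>"
proof -
  obtain \<gamma> \<sigma> N where g: "\<gamma> \<in> representing_paths \<xi>" "\<sigma> \<in> representing_paths (Inr \<eta>)"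
    "\<forall>s\<ge>N. \<forall>t\<ge>N. r < gp (\<gamma> s) (\<sigma> t)"
    using extended_gromov_product_gtE[OF 1] .
  obtain \<sigma>' \<tau> M where h: "\<sigma>' \<in> representing_paths (Inr \<eta>)" "\<tau> \<in> representing_paths \<zeta>"
    "\<forall>s\<ge>M. \<forall>t\<ge>M. r < gp (\<sigma>' s) (\<tau> t)"
    using extended_gromov_product_gtE[OF 2] .
  have "(\<sigma>, \<sigma>') \<in> asymptotic_rays"
    using gromov_boundary_ray(2)[OF \<eta>, of \<sigma>] g(2) h(1) by (simp add: ray_class_mem_iff)
  then obtain L where L: "\<forall>s\<ge>L. \<forall>t\<ge>L. r < gp (\<sigma> s) (\<sigma>' t)"
    using asymptotic_rays_gromov_product by blast
  define T where "T = max L (max M N)"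
  show ?thesis
  proof (rule extended_gromov_product_ge[OF g(1) h(2)], intro allI impI)
    fix s t assume st: "s \<ge> T" "t \<ge> T"
    have "r - \<Delta> \<le> gp (\<gamma> s) (\<sigma>' T)"
      by (rule four_pointD[of _ _ _ "\<sigma> T"]) (use st g(3) L in \<open>auto simp: T_def intro: less_imp_le\<close>)
    moreover have "r - \<Delta> \<le> gp (\<sigma>' T) (\<tau> t)"
    proof -
      have "M \<le> T" "M \<le> t" using st by (simp_all add: T_def)
      then show ?thesis using h(3)[rule_format, of T t] \<Delta>_nonneg by simp
    qed
    ultimately show "r - 2 * \<Delta> \<le> gp (\<gamma> s) (\<tau> t)"
      using four_pointD[of "r - \<Delta>"] by fastforce
  qed
qed

text \<open>The set of points with product above \<open>r\<close> need not be open. \<open>V\<close>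
  retains its interior points in the space and those boundary points one of whose basic sets it
  contains; the four-point inequality makes \<open>V\<close> open.\<close>

lemma gromov_open_inside:
  assumes \<eta>: "\<eta> \<in> gromov_boundary"
  obtains V where "gromov_open V" "Inr \<eta> \<in> V"
    "\<forall>x. Inl x \<in> V \<longrightarrow> ereal r < extended_gromov_product base (Inl x) (Inr \<eta>)"
proof -
  let ?B = "\<lambda>z t. {\<zeta> \<in> gromov_points. ereal t < extended_gromov_product base \<zeta> (Inr z)}"
  define U where "U = ?B \<eta> r"
  define V where "V = Inl ` interior {x. Inl x \<in> U} \<union> Inr ` {z \<in> gromov_boundary. \<exists>t. ?B z t \<subseteq> U}"
  \<comment> \<open>In \<open>R\<close>, \<open>dist p base\<close> pays for the base point and
    \<open>2 * \<Delta>\<close> for the four-point inequality; the remaining 3 pays for strictness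
    and for moving by less than 1 in the space.\<close>
  have ball_in: "{\<xi> \<in> gromov_points. ereal R < extended_gromov_product p \<xi> (Inr z)} \<subseteq> V"
    if z: "z \<in> gromov_boundary" "?B z t \<subseteq> U" and R: "R = t + 2 * \<Delta> + 3 + dist p base" for z t p R
  proof
    fix \<xi> assume \<xi>: "\<xi> \<in> {\<xi> \<in> gromov_points. ereal R < extended_gromov_product p \<xi> (Inr z)}"
    define T where "T = t + 2 * \<Delta> + 2"
    have "ereal T < ereal (R - dist p base)" by (simp add: R T_def)
    also have "\<dots> \<le> extended_gromov_product base \<xi> (Inr z)"
      using \<xi> extended_gromov_product_base_change[of R p \<xi> "Inr z" base] by blast
    finally have T: "ereal T < extended_gromov_product base \<xi> (Inr z)" .
    consider (1) x where "\<xi> = Inl x" | (2) w where "\<xi> = Inr w" "w \<in> gromov_boundary"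
      using \<xi> unfolding gromov_points_def by blast
    then show "\<xi> \<in> V"
    proof cases
      case 1
      obtain \<gamma> \<sigma> N where g: "\<gamma> \<in> representing_paths \<xi>" "\<sigma> \<in> representing_paths (Inr z)"
        "\<forall>s\<ge>N. \<forall>t\<ge>N. T < gp (\<gamma> s) (\<sigma> t)"
        using extended_gromov_product_gtE[OF T] .
      have "Inl y \<in> U" if y: "y \<in> ball x 1" for y
      proof -
        have "ereal (T - 1) \<le> extended_gromov_product base (Inl y) (Inr z)"
        proof (rule extended_gromov_product_ge[OF _ g(2)])
          show "\<forall>s\<ge>N. \<forall>t\<ge>N. T - 1 \<le> gp ((\<lambda>_. y) s) (\<sigma> t)"
          proof (intro allI impI)
            fix s t assume "s \<ge> N" "t \<ge> N"
            then have "T < gp x (\<sigma> t)" using g(1,3) 1 by auto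
            then show "T - 1 \<le> gp y (\<sigma> t)"
              using gromov_product_diff[of base x "\<sigma> t" y] y by simp
          qed
        qed simp
        moreover have "ereal t < ereal (T - 1)" using \<Delta>_nonneg by (simp add: T_def)
        ultimately have "ereal t < extended_gromov_product base (Inl y) (Inr z)" by (rule less_le_trans[rotated])
        then have "Inl y \<in> ?B z t" by (auto simp: gromov_points_def)
        then show ?thesis using z(2) by blast
      qed
      then have "x \<in> interior {x. Inl x \<in> U}"
        unfolding mem_interior by (intro exI[of _ 1]) auto
      then show ?thesis by (simp add: V_def 1)
    next
      case 2
      have "?B w T \<subseteq> U"
      proof
        fix \<zeta> assume \<zeta>: "\<zeta> \<in> ?B w T"
        then have "ereal (T - 2 * \<Delta>) \<le> extended_gromov_product base \<zeta> (Inr z)"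
          using extended_gromov_product_four_point[OF 2(2), of T \<zeta> "Inr z"] T 2(1) by simp
        moreover have "ereal t < ereal (T - 2 * \<Delta>)" by (simp add: T_def)
        ultimately have "ereal t < extended_gromov_product base \<zeta> (Inr z)" by (rule less_le_trans[rotated])
        then have "\<zeta> \<in> ?B z t" using \<zeta> by simp
        then show "\<zeta> \<in> U" using z(2) by blast
      qed
      then show ?thesis unfolding V_def 2(1) using 2(2) by blast
    qed
  qed
  have "gromov_open V"
    unfolding gromov_open_def
  proof (intro conjI allI impI)
    show "V \<subseteq> gromov_points" by (auto simp: V_def gromov_points_def)
    have "{x. Inl x \<in> V} = interior {x. Inl x \<in> U}" by (auto simp: V_def)
    then show "open {x. Inl x \<in> V}" by simp
    fix z p assume "Inr z \<in> V"
    then obtain t where "z \<in> gromov_boundary" "?B z t \<subseteq> U" by (auto simp: V_def)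
    from ball_in[OF this refl] show "\<exists>r. {\<xi> \<in> gromov_points. ereal r < extended_gromov_product p \<xi> (Inr z)} \<subseteq> V"
      by blast
  qed
  moreover have "Inr \<eta> \<in> V" using \<eta> unfolding V_def U_def by blast
  moreover have "\<forall>x. Inl x \<in> V \<longrightarrow> ereal r < extended_gromov_product base (Inl x) (Inr \<eta>)"
    using interior_subset[of "{x. Inl x \<in> U}"] unfolding V_def by (auto simp: U_def)
  ultimately show thesis by (rule that)
qed

lemma gromov_open_ray_product:
  assumes "\<eta> \<in> gromov_boundary" "\<gamma> \<in> \<eta>"
  obtains V where "gromov_open V" "Inr \<eta> \<in> V" "\<forall>x. Inl x \<in> V \<longrightarrow> M < rp x \<gamma>"
proof -
  note ray = gromov_boundary_ray[OF assms]
  obtain V where V: "gromov_open V" "Inr \<eta> \<in> V"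
    "\<forall>x. Inl x \<in> V \<longrightarrow> ereal (M + \<Delta> + 1) < extended_gromov_product base (Inl x) (Inr \<eta>)"
    using gromov_open_inside[OF assms(1)] .
  have "M < rp x \<gamma>" if x: "Inl x \<in> V" for x
  proof -
    obtain \<beta> \<sigma> N where g: "\<beta> \<in> representing_paths (Inl x)" "\<sigma> \<in> representing_paths (Inr \<eta>)"
      "\<forall>s\<ge>N. \<forall>t\<ge>N. M + \<Delta> + 1 < gp (\<beta> s) (\<sigma> t)"
      using extended_gromov_product_gtE[OF V(3)[rule_format, OF x]] .
    have s: "(\<sigma>, \<gamma>) \<in> asymptotic_rays" "geodesic_ray \<sigma>"
      using gromov_boundary_ray[OF assms(1), of \<sigma>] assms(2) g(2) by (simp_all add: ray_class_mem_iff)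
    have "M + \<Delta> + 1 \<le> gp x (\<sigma> t)" if "t \<ge> N" for t
      using g(3)[rule_format, of N t] that g(1) by simp
    then have "M + \<Delta> + 1 \<le> rp x \<sigma>"
      using ray_product_geI[OF s(2)] by blast
    then show ?thesis using ray_product_asymptotic[OF s(1), of x] by simp
  qed
  with V(1,2) show thesis using that by blast
qed

lemma gromov_open_boundaryE:
  assumes "gromov_open U" "Inr \<eta> \<in> U" "\<eta> \<in> gromov_boundary" "\<gamma> \<in> \<eta>"
  obtains M where "\<forall>x. M < rp x \<gamma> \<longrightarrow> Inl x \<in> U"
proof -
  obtain r where r: "{\<xi> \<in> gromov_points. extended_gromov_product base \<xi> (Inr \<eta>) > ereal r} \<subseteq> U"
    using assms(1,2) unfolding gromov_open_def by blast
  have "Inl x \<in> U" if x: "r + 1 < rp x \<gamma>" for x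
  proof -
    obtain N where N: "\<forall>t\<ge>N. r + 1 < gp x (\<gamma> t)"
      using eventually_gp_gt[OF gromov_boundary_ray(1)[OF assms(3,4)] x] by blast
    have "ereal (r + 1) \<le> extended_gromov_product base (Inl x) (Inr \<eta>)"
      by (rule extended_gromov_product_ge[of "\<lambda>_. x" _ \<gamma>]) (use N assms(4) in \<open>auto intro: less_imp_le\<close>)
    moreover have "ereal r < ereal (r + 1)" by simp
    ultimately have "ereal r < extended_gromov_product base (Inl x) (Inr \<eta>)" by (rule less_le_trans[rotated])
    then show ?thesis using r by (auto simp: gromov_points_def)
  qed
  then show thesis using that by blast
qed

text \<open>The traces of neighbourhoods of \<open>\<eta>\<close> on the space are governed by a
  single ray, although the topology uses a supremum over all rays of the class. This makes the lower
  limit in \<open>log_dilation\<close> computable.\<close>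

lemma eventually_near_boundary:
  assumes "\<eta> \<in> gromov_boundary" "\<gamma> \<in> \<eta>"
  shows "eventually P (filtercomap Inl (nhdsin gromov_topology (Inr \<eta>))) \<longleftrightarrow> (\<exists>M. \<forall>x. M < rp x \<gamma> \<longrightarrow> P x)"
    (is "?L \<longleftrightarrow> ?R")
proof -
  have top: "Inr \<eta> \<in> topspace gromov_topology"
    using assms(1) by (simp add: topspace_gromov_topology gromov_points_def)
  show ?thesis
  proof
    assume ?L
    then obtain U where U: "gromov_open U" "Inr \<eta> \<in> U" "\<forall>x. Inl x \<in> U \<longrightarrow> P x"
      unfolding eventually_filtercomap eventually_nhdsin openin_gromov_topology using top by blast
    show ?R using gromov_open_boundaryE[OF U(1,2) assms] U(3) by metis
  next
    assume ?R
    then obtain M where M: "\<forall>x. M < rp x \<gamma> \<longrightarrow> P x" by blast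
    obtain V where V: "gromov_open V" "Inr \<eta> \<in> V" "\<forall>x. Inl x \<in> V \<longrightarrow> M < rp x \<gamma>"
      using gromov_open_ray_product[OF assms] .
    show ?L
      unfolding eventually_filtercomap eventually_nhdsin openin_gromov_topology
      using V M by (intro exI[of _ "\<lambda>\<xi>. \<xi> \<in> V"]) auto
  qed
qed

lemma converges_to_boundary_iff:
  assumes "\<eta> \<in> gromov_boundary" "\<gamma> \<in> \<eta>"
  shows "converges_to_boundary w \<eta> \<longleftrightarrow> (\<forall>M. \<forall>\<^sub>F n in sequentially. M < rp (w n) \<gamma>)"
    (is "?L \<longleftrightarrow> ?R")
proof
  assume L: ?L
  show ?R
  proof
    fix M
    obtain V where V: "gromov_open V" "Inr \<eta> \<in> V" "\<forall>x. Inl x \<in> V \<longrightarrow> M < rp x \<gamma>"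
      using gromov_open_ray_product[OF assms] .
    have "\<forall>\<^sub>F n in sequentially. Inl (w n) \<in> V"
      using L V(1,2) unfolding limitin_def openin_gromov_topology by blast
    then show "\<forall>\<^sub>F n in sequentially. M < rp (w n) \<gamma>"
      by eventually_elim (use V(3) in blast)
  qed
next
  assume R: ?R
  show ?L
    unfolding limitin_def openin_gromov_topology topspace_gromov_topology
  proof (intro conjI allI impI)
    show "Inr \<eta> \<in> gromov_points" using assms(1) by (simp add: gromov_points_def)
    fix U :: "'a gromov_point set" assume U: "gromov_open U \<and> Inr \<eta> \<in> U"
    then obtain M where M: "\<forall>x. M < rp x \<gamma> \<longrightarrow> Inl x \<in> U"
      using gromov_open_boundaryE[OF _ _ assms] by metis
    show "\<forall>\<^sub>F n in sequentially. Inl (w n) \<in> U"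
      using R[rule_format, of M] by eventually_elim (use M in blast)
  qed
qed

lemma converges_to_boundary_unique:
  fixes w :: "nat \<Rightarrow> 'a"
  assumes "\<eta> \<in> gromov_boundary" "\<zeta> \<in> gromov_boundary"
    and "converges_to_boundary w \<eta>" "converges_to_boundary w \<zeta>"
  shows "\<eta> = \<zeta>"
proof -
  obtain \<gamma> where g: "\<gamma> \<in> \<eta>" using gromov_boundary_nonempty[OF assms(1)] .
  obtain \<sigma> where s: "\<sigma> \<in> \<zeta>" using gromov_boundary_nonempty[OF assms(2)] .
  note rg = gromov_boundary_ray[OF assms(1) g] and rs = gromov_boundary_ray[OF assms(2) s]
  have "\<exists>w. rp w \<gamma> > M \<and> rp w \<sigma> > M" for M
  proof -
    have "\<forall>\<^sub>F n in sequentially. M < rp (w n) \<gamma> \<and> M < rp (w n) \<sigma>"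
      using assms(3,4) unfolding converges_to_boundary_iff[OF assms(1) g] converges_to_boundary_iff[OF assms(2) s]
      by (intro eventually_conj) blast+
    then show ?thesis using eventually_happens[of _ sequentially] by fastforce
  qed
  then have "(\<gamma>, \<sigma>) \<in> asymptotic_rays" by (rule asymptoticI[OF rg(1) rs(1)])
  then show ?thesis using ray_class_eqI rg(2) rs(2) by blast
qed

text \<open>Properness yields a ray followed by a subsequence; the large mutual products carry all
  other terms along.\<close>

lemma gromov_sequence_converges:
  assumes far: "\<And>M. \<exists>N. \<forall>m\<ge>N. \<forall>n\<ge>N. M \<le> gp (w m) (w n)"
  obtains \<gamma> :: "real \<Rightarrow> 'a" where "geodesic_ray \<gamma>" "\<gamma> 0 = base" "converges_to_boundary w (ray_class \<gamma>)"
proof -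
  have "filterlim (\<lambda>n. dist base (w n)) at_top sequentially"
    unfolding filterlim_at_top eventually_sequentially
  proof
    fix Z :: real
    obtain N where "\<forall>m\<ge>N. \<forall>n\<ge>N. Z \<le> gp (w m) (w n)" using far by blast
    then have "\<forall>n\<ge>N. Z \<le> dist base (w n)"
      by (metis dist_commute gromov_product_self)
    then show "\<exists>N. \<forall>n\<ge>N. Z \<le> dist base (w n)" by blast
  qed
  from geodesic_ray_limit[OF geodesic this] obtain r \<gamma> where r: "strict_mono r"
    and g: "geodesic_ray \<gamma>" "\<gamma> 0 = base" "\<forall>t\<ge>0. (\<lambda>n. gp (w (r n)) (\<gamma> t)) \<longlonglongrightarrow> t" .
  have "\<exists>N. \<forall>n\<ge>N. M < rp (w n) \<gamma>" for M
  proof -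
    obtain N where N: "\<forall>m\<ge>N. \<forall>n\<ge>N. M + \<Delta> + 1 \<le> gp (w m) (w n)" using far by blast
    have "M + \<Delta> + 1 - \<Delta> \<le> gp (w n) (\<gamma> t)" if n: "n \<ge> N" and t: "t \<ge> max 0 (M + \<Delta> + 2)" for n t
    proof -
      have "\<forall>\<^sub>F k in sequentially. M + \<Delta> + 1 < gp (w (r k)) (\<gamma> t)"
        using order_tendstoD(1)[OF g(3)[rule_format, of t], of "M + \<Delta> + 1"] t by simp
      then have "\<forall>\<^sub>F k in sequentially. M + \<Delta> + 1 < gp (w (r k)) (\<gamma> t) \<and> k \<ge> N"
        using eventually_ge_at_top[of N] by (rule eventually_conj)
      then obtain k where k: "M + \<Delta> + 1 < gp (w (r k)) (\<gamma> t)" "k \<ge> N"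
        using eventually_happens[of _ sequentially] by fastforce
      have "r k \<ge> N" using seq_suble[OF r, of k] k(2) by linarith
      then show ?thesis
        using four_pointD[of "M + \<Delta> + 1" base "w n" "w (r k)" "\<gamma> t"] N n k(1) by simp
    qed
    then have "M + \<Delta> + 1 - \<Delta> \<le> rp (w n) \<gamma>" if "n \<ge> N" for n
      using ray_product_geI[OF g(1)] that by blast
    then show ?thesis by (intro exI[of _ N]) force
  qed
  then have "converges_to_boundary w (ray_class \<gamma>)"
    unfolding converges_to_boundary_iff[OF ray_class_in_boundary[OF g(1)] self_in_ray_class[OF g(1)]]
      eventually_sequentially by blast
  with g(1,2) show thesis by (rule that)
qed

end

section \<open>The horofunction compactification\<close>

lemma class_mod_const_eq_iff: "class_mod_const g = class_mod_const h \<longleftrightarrow> (\<exists>c. \<forall>y. g y = h y + c)"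
proof
  assume "class_mod_const g = class_mod_const h"
  moreover have "g \<in> class_mod_const g"
    unfolding class_mod_const_def by (auto intro!: exI[of _ 0])
  ultimately show "\<exists>c. \<forall>y. g y = h y + c"
    unfolding class_mod_const_def by auto
next
  assume "\<exists>c. \<forall>y. g y = h y + c"
  then obtain c where c: "g = (\<lambda>y. h y + c)" by auto
  show "class_mod_const g = class_mod_const h"
    unfolding class_mod_const_def
  proof (intro equalityI subsetI)
    fix k assume "k \<in> {\<lambda>y. g y + d |d. True}"
    then obtain d where "k = (\<lambda>y. h y + (c + d))" by (auto simp: c add.assoc)
    then show "k \<in> {\<lambda>y. h y + c |c. True}" by blast
  next
    fix k assume "k \<in> {\<lambda>y. h y + c |c. True}"
    then obtain d where "k = (\<lambda>y. h y + d)" by blast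
    then have "k = (\<lambda>y. g y + (d - c))" by (simp add: c)
    then show "k \<in> {\<lambda>y. g y + d |d. True}" by blast
  qed
qed

lemma class_mod_const_eqD: "class_mod_const g = class_mod_const h \<Longrightarrow> g z - g q = h z - h q"
  by (auto simp: class_mod_const_eq_iff)

lemma class_mod_const_eqI: "(\<And>z. g z - g q = h z - h q) \<Longrightarrow> class_mod_const g = class_mod_const h"
  unfolding class_mod_const_eq_iff by (intro exI[of _ "g q - h q"]) (simp add: algebra_simps)

lemma class_dist_inj: "class_mod_const (dist x) = class_mod_const (dist y) \<Longrightarrow> x = y"
  using class_mod_const_eqD[of "dist x" "dist y" y x] by (simp add: dist_commute)

lemma horofunction_class: "horofunction (class_mod_const h) p = (\<lambda>y. h y - h p)"
  unfolding horofunction_def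
proof (rule the_equality)
  show "(\<lambda>y. h y - h p) \<in> class_mod_const h \<and> h p - h p = 0"
    unfolding class_mod_const_def by (auto intro!: exI[of _ "- h p"])
qed (auto simp: class_mod_const_def fun_eq_iff)

text \<open>Comparing differences from the value at \<open>q\<close> makes the condition independent
  of the representative; \<open>q\<close> need not lie in \<open>K\<close>.\<close>

definition horo_nbhd :: "'a::metric_space set \<Rightarrow> 'a \<Rightarrow> ('a \<Rightarrow> real) \<Rightarrow> real \<Rightarrow> ('a \<Rightarrow> real) set set" where
  "horo_nbhd K q h \<epsilon> = class_mod_const ` {g. continuous_on UNIV g \<and> (\<forall>z\<in>K. \<bar>(g z - g q) - (h z - h q)\<bar> < \<epsilon>)}"

lemma class_in_horo_nbhd_iff:
  assumes "continuous_on UNIV g"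
  shows "class_mod_const g \<in> horo_nbhd K q h \<epsilon> \<longleftrightarrow> (\<forall>z\<in>K. \<bar>(g z - g q) - (h z - h q)\<bar> < \<epsilon>)"
proof
  assume "class_mod_const g \<in> horo_nbhd K q h \<epsilon>"
  then obtain k where k: "class_mod_const g = class_mod_const k" "\<forall>z\<in>K. \<bar>(k z - k q) - (h z - h q)\<bar> < \<epsilon>"
    unfolding horo_nbhd_def by blast
  show "\<forall>z\<in>K. \<bar>(g z - g q) - (h z - h q)\<bar> < \<epsilon>"
    using k(2) unfolding class_mod_const_eqD[OF k(1), of _ q] .
qed (use assms in \<open>auto simp: horo_nbhd_def\<close>)

lemma openin_horo_nbhd:
  assumes K: "compact K" and h: "continuous_on UNIV h"
  shows "openin cts_mod_const_topology (horo_nbhd K q h \<epsilon>)"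
proof -
  let ?d = "\<lambda>g z. \<bar>(g z - g q) - (h z - h q)\<bar>"
  let ?S = "{g. continuous_on UNIV g \<and> (\<forall>z\<in>K. ?d g z < \<epsilon>)}"
  have "\<exists>L e. compact L \<and> e > 0 \<and> {k. continuous_on UNIV k \<and> (\<forall>y\<in>L. dist (k y) (g y) < e)} \<subseteq> ?S"
    if g: "g \<in> ?S" for g
  proof (cases "K = {}")
    case True
    then show ?thesis by (intro exI[of _ "{}"] exI[of _ 1]) auto
  next
    case False
    have "continuous_on K g" using g by (auto intro: continuous_on_subset)
    moreover have "continuous_on K h" using h by (rule continuous_on_subset) simp
    ultimately have cont: "continuous_on K (?d g)"
      by (intro continuous_on_rabs continuous_on_diff continuous_on_const)
    obtain m where m: "m \<in> K" "\<forall>z\<in>K. ?d g z \<le> ?d g m"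
      using continuous_attains_sup[OF K False cont] by blast
    have m_less: "?d g m < \<epsilon>" using g m(1) by blast
    \<comment> \<open>Half of the slack at the worst point of \<open>K\<close>, since a perturbation
      changes the values at \<open>z\<close> and at \<open>q\<close>.\<close>
    define e where "e = (\<epsilon> - ?d g m) / 2"
    show ?thesis
    proof (intro exI conjI subsetI)
      show "compact (insert q K)" using K by simp
      show "e > 0" using m_less by (simp add: e_def)
      fix k assume k: "k \<in> {k. continuous_on UNIV k \<and> (\<forall>y\<in>insert q K. dist (k y) (g y) < e)}"
      have "?d k z < \<epsilon>" if z: "z \<in> K" for z
      proof -
        have "\<bar>k z - g z\<bar> < e" "\<bar>k q - g q\<bar> < e" using k z by (auto simp: dist_real_def)
        then have "?d k z < ?d g z + 2 * e" by (simp add: abs_if split: if_splits)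
        also have "\<dots> \<le> ?d g m + 2 * e" using m(2) z by simp
        also have "\<dots> = \<epsilon>" by (simp add: e_def field_simps)
        finally show ?thesis .
      qed
      then show "k \<in> ?S" using k by simp
    qed
  qed
  moreover have "?S \<subseteq> {h. continuous_on UNIV h}" by blast
  ultimately have "compact_convergence_open ?S"
    unfolding compact_convergence_open_def by (intro conjI ballI)
  moreover have "{g. continuous_on UNIV g \<and> class_mod_const g \<in> horo_nbhd K q h \<epsilon>} = ?S"
    by (simp add: class_in_horo_nbhd_iff cong: conj_cong)
  moreover have "horo_nbhd K q h \<epsilon> \<subseteq> cts_mod_const"
    by (auto simp: horo_nbhd_def cts_mod_const_def)
  ultimately show ?thesis
    unfolding openin_cts_mod_const_topology by simp
qed

lemma class_in_topspace: "continuous_on UNIV h \<Longrightarrow> class_mod_const h \<in> topspace cts_mod_const_topology"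
  using openin_subset[OF openin_horo_nbhd[of "{}" h undefined 1]] class_in_horo_nbhd_iff[of h "{}"] by auto

lemma horo_compactificationE:
  assumes "a \<in> horo_compactification"
  obtains h where "continuous_on UNIV h" "a = class_mod_const h"
    "\<forall>K q \<epsilon>. compact K \<and> \<epsilon> > 0 \<longrightarrow> (\<exists>x. \<forall>z\<in>K. \<bar>(dist x z - dist x q) - (h z - h q)\<bar> < \<epsilon>)"
proof -
  have a: "a \<in> topspace cts_mod_const_topology"
    "\<And>T. a \<in> T \<Longrightarrow> openin cts_mod_const_topology T \<Longrightarrow> \<exists>x. class_mod_const (dist x) \<in> T"
    using assms unfolding horo_compactification_def in_closure_of by blast+
  obtain T where "openin cts_mod_const_topology T" "a \<in> T"
    using a(1) unfolding topspace_def by blast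
  then have "a \<in> cts_mod_const" unfolding openin_cts_mod_const_topology by blast
  then obtain h where h: "continuous_on UNIV h" "a = class_mod_const h"
    unfolding cts_mod_const_def by blast
  have "\<exists>x. \<forall>z\<in>K. \<bar>(dist x z - dist x q) - (h z - h q)\<bar> < \<epsilon>" if K: "compact K" "\<epsilon> > 0" for K q \<epsilon>
  proof -
    have "a \<in> horo_nbhd K q h \<epsilon>"
      unfolding h(2) class_in_horo_nbhd_iff[OF h(1)] using K(2) by simp
    then obtain x where "class_mod_const (dist x) \<in> horo_nbhd K q h \<epsilon>"
      using a(2) openin_horo_nbhd[OF K(1) h(1)] by blast
    then show ?thesis
      using class_in_horo_nbhd_iff[of "dist x" K q h \<epsilon>] continuous_on_dist[OF continuous_on_const continuous_on_id, of UNIV x]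
      by auto
  qed
  with h show thesis using that by blast
qed

lemma horo_compactificationI:
  assumes h: "continuous_on UNIV h"
    and approx: "\<And>K \<epsilon>. compact K \<Longrightarrow> \<epsilon> > 0 \<Longrightarrow> \<exists>x c. \<forall>z\<in>K. \<bar>dist x z + c - h z\<bar> < \<epsilon>"
  shows "class_mod_const h \<in> horo_compactification"
  unfolding horo_compactification_def in_closure_of
proof (intro conjI allI impI)
  show "class_mod_const h \<in> topspace cts_mod_const_topology"
    by (rule class_in_topspace[OF h])
  fix T assume T: "class_mod_const h \<in> T \<and> openin cts_mod_const_topology T"
  then obtain K \<epsilon> where K: "compact K" "\<epsilon> > 0"
    "{g. continuous_on UNIV g \<and> (\<forall>y\<in>K. dist (g y) (h y) < \<epsilon>)} \<subseteq> {h. continuous_on UNIV h \<and> class_mod_const h \<in> T}"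
    using compact_convergence_openE[of "{h. continuous_on UNIV h \<and> class_mod_const h \<in> T}" h] h
    unfolding openin_cts_mod_const_topology by blast
  obtain x c where x: "\<forall>z\<in>K. \<bar>dist x z + c - h z\<bar> < \<epsilon>" using approx[OF K(1,2)] by blast
  have "continuous_on UNIV (\<lambda>z. dist x z + c)" by (intro continuous_intros)
  then have "class_mod_const (\<lambda>z. dist x z + c) \<in> T"
    using K(3) x by (auto simp: dist_real_def)
  moreover have "class_mod_const (\<lambda>z. dist x z + c) = class_mod_const (dist x)"
    by (auto simp: class_mod_const_eq_iff)
  ultimately show "\<exists>y. y \<in> range (\<lambda>x. class_mod_const (dist x)) \<and> y \<in> T" by auto
qed

lemma class_dist_in_horo_compactification: "class_mod_const (dist x) \<in> horo_compactification"
  by (rule horo_compactificationI) (auto intro!: continuous_intros exI[of _ x] exI[of _ 0])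

text \<open>If approximating points returned to a ball infinitely often, they would accumulate at
  some \<open>y\<close>, and the class would be that of \<open>dist y\<close>.\<close>

lemma horo_boundary_escaping:
  fixes h :: "'a::heine_borel \<Rightarrow> real"
  assumes "class_mod_const h \<in> horo_boundary"
  obtains w where "filterlim (\<lambda>n. dist q (w n)) at_top sequentially"
    "\<forall>n. \<forall>z\<in>cball q (real n). \<bar>(dist (w n) z - dist (w n) q) - (h z - h q)\<bar> < inverse (real (Suc n))"
proof -
  have "class_mod_const h \<in> horo_compactification" using assms by (simp add: horo_boundary_def)
  then obtain k where k: "class_mod_const h = class_mod_const k"
    "\<forall>K q \<epsilon>. compact K \<and> \<epsilon> > 0 \<longrightarrow> (\<exists>x. \<forall>z\<in>K. \<bar>(dist x z - dist x q) - (k z - k q)\<bar> < \<epsilon>)"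
    using horo_compactificationE by metis
  have "\<forall>n. \<exists>x. \<forall>z\<in>cball q (real n). \<bar>(dist x z - dist x q) - (h z - h q)\<bar> < inverse (real (Suc n))"
    using k(2) unfolding class_mod_const_eqD[OF k(1), of _ q] by simp
  then obtain w where w: "\<forall>n. \<forall>z\<in>cball q (real n). \<bar>(dist (w n) z - dist (w n) q) - (h z - h q)\<bar> < inverse (real (Suc n))"
    using choice[of "\<lambda>n x. \<forall>z\<in>cball q (real n). \<bar>(dist x z - dist x q) - (h z - h q)\<bar> < inverse (real (Suc n))"] by blast
  have lim: "(\<lambda>n. dist (w n) z - dist (w n) q) \<longlonglongrightarrow> h z - h q" for z
  proof -
    have "\<forall>\<^sub>F n in sequentially. norm ((dist (w n) z - dist (w n) q) - (h z - h q)) \<le> inverse (real (Suc n))"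
    proof (rule eventually_sequentiallyI)
      fix n assume "nat \<lceil>dist q z\<rceil> \<le> n"
      then have "z \<in> cball q (real n)" by (simp add: nat_ceiling_le_eq)
      then show "norm ((dist (w n) z - dist (w n) q) - (h z - h q)) \<le> inverse (real (Suc n))"
        using w by (simp add: less_imp_le)
    qed
    then show ?thesis
      by (rule LIM_zero_cancel[OF Lim_null_comparison[OF _ LIMSEQ_inverse_real_of_nat]])
  qed
  have "filterlim (\<lambda>n. dist q (w n)) at_top sequentially"
  proof (rule ccontr)
    assume "\<not> filterlim (\<lambda>n. dist q (w n)) at_top sequentially"
    then obtain R where R: "\<exists>\<^sub>F n in sequentially. \<not> R \<le> dist q (w n)"
      unfolding filterlim_at_top by (auto simp: frequently_def)
    then have "infinite {n. \<not> R \<le> dist q (w n)}"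
      unfolding frequently_cofinite[symmetric] cofinite_eq_sequentially .
    then obtain r :: "nat \<Rightarrow> nat" where r: "strict_mono r" "\<forall>n. r n \<in> {n. \<not> R \<le> dist q (w n)}"
      using infinite_enumerate by blast
    have "\<forall>n. w (r n) \<in> cball q R" using r(2) by (auto simp: not_le intro: less_imp_le)
    moreover have "seq_compact (cball q R)" by (simp add: compact_imp_seq_compact)
    ultimately obtain y s where y: "strict_mono s" "((\<lambda>n. w (r n)) \<circ> s) \<longlonglongrightarrow> y"
      using seq_compactE[of "cball q R" "\<lambda>n. w (r n)"] by metis
    have "dist y z - dist y q = h z - h q" for z
    proof (rule LIMSEQ_unique)
      show "(\<lambda>n. dist (w (r (s n))) z - dist (w (r (s n))) q) \<longlonglongrightarrow> dist y z - dist y q"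
        using y(2) by (intro tendsto_intros) (simp_all add: o_def)
      show "(\<lambda>n. dist (w (r (s n))) z - dist (w (r (s n))) q) \<longlonglongrightarrow> h z - h q"
        using LIMSEQ_subseq_LIMSEQ[OF lim[of z] strict_mono_o[OF r(1) y(1)]] by (simp add: o_def)
    qed
    then have "class_mod_const (dist y) = class_mod_const h" by (rule class_mod_const_eqI)
    then show False using assms by (auto simp: horo_boundary_def)
  qed
  with w show thesis using that by blast
qed

text \<open>On a geodesic from \<open>q\<close> towards \<open>w n\<close> the function
  \<open>dist (w n)\<close> falls with slope 1, and the horofunction is uniformly close to it on a
  large ball.\<close>

lemma horo_boundary_descends:
  fixes h :: "'a::heine_borel \<Rightarrow> real"
  assumes geo: "geodesic_space TYPE('a)" and h: "class_mod_const h \<in> horo_boundary"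
    and R: "R \<ge> 0" and e: "e > 0"
  obtains z where "dist q z = R" "h z - h q \<le> - R + e"
proof -
  obtain w where w: "filterlim (\<lambda>n. dist q (w n)) at_top sequentially"
    "\<forall>n. \<forall>z\<in>cball q (real n). \<bar>(dist (w n) z - dist (w n) q) - (h z - h q)\<bar> < inverse (real (Suc n))"
    using horo_boundary_escaping[OF h] .
  have "\<forall>\<^sub>F n in sequentially. R \<le> dist q (w n)" using w(1) by (simp add: filterlim_at_top)
  moreover have "\<forall>\<^sub>F n in sequentially. inverse (real (Suc n)) < e"
    using order_tendstoD(2)[OF LIMSEQ_inverse_real_of_nat e] .
  moreover have "\<forall>\<^sub>F n in sequentially. R \<le> real n"
    using filterlim_real_sequentially by (simp add: filterlim_at_top)
  ultimately have "\<forall>\<^sub>F n in sequentially. R \<le> dist q (w n) \<and> inverse (real (Suc n)) < e \<and> R \<le> real n"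
    by eventually_elim simp
  then obtain n where n: "R \<le> dist q (w n)" "inverse (real (Suc n)) < e" "R \<le> real n"
    using eventually_happens[of _ sequentially] by fastforce
  obtain z where z: "dist q z = R" "dist z (w n) = dist q (w n) - R"
    using geodesic_space_point[OF geo R n(1)] .
  have "\<bar>(dist (w n) z - dist (w n) q) - (h z - h q)\<bar> < inverse (real (Suc n))"
    using w(2) z(1) n(3) by simp
  then have "h z - h q \<le> - R + e"
    using z(2) n(2) by (simp add: dist_commute abs_if split: if_splits)
  with z(1) show thesis by (rule that)
qed

section \<open>Busemann functions as horofunctions\<close>

lemma busemann_continuous: 
  fixes \<gamma> :: "real \<Rightarrow> 'a::metric_space"
  assumes r: "geodesic_ray \<gamma>"
  shows "continuous_on UNIV (busemann \<gamma>)"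
proof -
  have "1-lipschitz_on UNIV (busemann \<gamma>)"
  proof (rule lipschitz_onI)
    fix x y :: 'a
    show "dist (busemann \<gamma> x) (busemann \<gamma> y) \<le> 1 * dist x y"
      using busemann_diff_le[OF r, of x y] busemann_diff_le[OF r, of y x] by (simp add: dist_real_def dist_commute abs_le_iff)
  qed simp
  then show ?thesis by (rule lipschitz_on_continuous_on)
qed

text \<open>All functions involved are 1-Lipschitz, so pointwise convergence on a finite net of
  \<open>K\<close> gives uniform convergence on \<open>K\<close>.\<close>

lemma busemann_uniform_limit:
  assumes r: "geodesic_ray \<gamma>" and K: "compact K" and e: "e > 0"
  shows "\<forall>\<^sub>F t in at_top. \<forall>z\<in>K. \<bar>dist (\<gamma> t) z + - t - busemann \<gamma> z\<bar> < e"
proof -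
  have "e / 3 > 0" using e by simp
  then obtain F where F: "finite F" "K \<subseteq> (\<Union>y\<in>F. ball y (e / 3))"
    using seq_compact_imp_totally_bounded[OF compact_imp_seq_compact[OF K]] by blast
  have "\<forall>\<^sub>F t in at_top. \<forall>y\<in>F. \<bar>dist (\<gamma> t) y + - t - busemann \<gamma> y\<bar> < e / 3"
  proof (rule eventually_ball_finite[OF F(1)], rule ballI)
    fix y
    show "\<forall>\<^sub>F t in at_top. \<bar>dist (\<gamma> t) y + - t - busemann \<gamma> y\<bar> < e / 3"
      using tendstoD[OF busemann_tendsto[OF r, of y] \<open>e / 3 > 0\<close>] by (simp add: dist_real_def)
  qed
  then show ?thesis
  proof eventually_elim
    case (elim t)
    show ?case
    proof
      fix z assume "z \<in> K"
      then obtain y where y: "y \<in> F" "dist y z < e / 3" using F(2) by auto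
      have "\<bar>dist (\<gamma> t) y + - t - busemann \<gamma> y\<bar> < e / 3" using elim y(1) by blast
      then show "\<bar>dist (\<gamma> t) z + - t - busemann \<gamma> z\<bar> < e"
        using y(2) busemann_diff_le[OF r, of y z] busemann_diff_le[OF r, of z y]
          dist_triangle[of "\<gamma> t" z y] dist_triangle[of "\<gamma> t" y z] unfolding dist_commute[of z y] by linarith
    qed
  qed
qed

lemma busemann_in_horo_boundary:
  assumes r: "geodesic_ray \<gamma>"
  shows "class_mod_const (busemann \<gamma>) \<in> horo_boundary"
proof -
  have "class_mod_const (busemann \<gamma>) \<in> horo_compactification"
  proof (rule horo_compactificationI[OF busemann_continuous[OF r]])
    fix K :: "'a set" and e :: real assume "compact K" "e > 0"
    then have "\<forall>\<^sub>F t in at_top. \<forall>z\<in>K. \<bar>dist (\<gamma> t) z + - t - busemann \<gamma> z\<bar> < e"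
      by (rule busemann_uniform_limit[OF r])
    then obtain t where "\<forall>z\<in>K. \<bar>dist (\<gamma> t) z + - t - busemann \<gamma> z\<bar> < e"
      using eventually_happens[of _ at_top] by fastforce
    then show "\<exists>x c. \<forall>z\<in>K. \<bar>dist x z + c - busemann \<gamma> z\<bar> < e" by blast
  qed
  moreover have "class_mod_const (busemann \<gamma>) \<noteq> class_mod_const (dist x)" for x
  proof
    assume "class_mod_const (busemann \<gamma>) = class_mod_const (dist x)"
    then obtain c where c: "\<forall>y. busemann \<gamma> y = dist x y + c" unfolding class_mod_const_eq_iff by blast
    \<comment> \<open>A Busemann function is unbounded below along its ray, whereas
      \<open>dist x\<close> plus a constant is bounded below.\<close>
    have "- (\<bar>c\<bar> + 1) = dist x (\<gamma> (\<bar>c\<bar> + 1)) + c"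
      using c busemann_on_ray[OF r, of "\<bar>c\<bar> + 1"] by simp
    then show False using zero_le_dist[of x "\<gamma> (\<bar>c\<bar> + 1)"] by linarith
  qed
  ultimately show ?thesis by (auto simp: horo_boundary_def)
qed

section \<open>The map to the Gromov compactification\<close>

context proper_hyperbolic
begin

text \<open>The candidate relation between a horofunction class and a ray towards its image.
  Horofunctions over one boundary point may differ by more than a constant, hence a bound in place
  of equality.\<close>

definition fellow_ray :: "('a \<Rightarrow> real) set \<Rightarrow> (real \<Rightarrow> 'a) \<Rightarrow> bool" where
  "fellow_ray a \<gamma> \<longleftrightarrow> geodesic_ray \<gamma> \<and> (\<exists>h. a = class_mod_const h \<and>
     (\<forall>z. \<bar>(h z - h base) - (busemann \<gamma> z - busemann \<gamma> base)\<bar> \<le> 2 * \<Delta>))"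

lemma fellow_rayD:
  assumes "fellow_ray (class_mod_const h) \<gamma>"
  shows "geodesic_ray \<gamma>" "(dist z base - (h z - h base)) / 2 - \<Delta> \<le> rp z \<gamma>"
proof -
  obtain k where k: "geodesic_ray \<gamma>" "class_mod_const h = class_mod_const k"
     "\<forall>z. \<bar>(k z - k base) - (busemann \<gamma> z - busemann \<gamma> base)\<bar> \<le> 2 * \<Delta>"
    using assms unfolding fellow_ray_def by blast
  show "geodesic_ray \<gamma>" by (rule k(1))
  show "(dist z base - (h z - h base)) / 2 - \<Delta> \<le> rp z \<gamma>"
    using k(3)[rule_format, of z] unfolding class_mod_const_eqD[OF k(2), of z base] ray_product_def
    by (simp add: abs_le_iff field_simps)
qed

text \<open>Points realising the horofunction escape and subconverge to a ray. Their products with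
  \<open>z\<close> tend to \<open>(dist z base - (h z - h base)) / 2\<close>, which is to be
  compared with the product of \<open>z\<close> and the end of the ray.\<close>

lemma fellow_ray_exists:
  assumes "class_mod_const h \<in> horo_boundary"
  shows "\<exists>\<gamma>. fellow_ray (class_mod_const h) \<gamma>"
proof -
  obtain w where w: "filterlim (\<lambda>n. dist base (w n)) at_top sequentially"
    "\<forall>n. \<forall>z\<in>cball base (real n). \<bar>(dist (w n) z - dist (w n) base) - (h z - h base)\<bar> < inverse (real (Suc n))"
    using horo_boundary_escaping[OF assms] .
  obtain r \<gamma> where r: "strict_mono r"
    and g: "geodesic_ray \<gamma>" "\<gamma> 0 = base" "\<forall>t\<ge>0. (\<lambda>n. gp (w (r n)) (\<gamma> t)) \<longlonglongrightarrow> t"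
    using geodesic_ray_limit[OF geodesic w(1)] .
  have "\<bar>(h z - h base) - (busemann \<gamma> z - busemann \<gamma> base)\<bar> \<le> 2 * \<Delta>" for z
  proof -
    have "(\<lambda>n. dist (w n) z - dist (w n) base) \<longlonglongrightarrow> h z - h base"
    proof (rule LIM_zero_cancel, rule Lim_null_comparison[OF _ LIMSEQ_inverse_real_of_nat])
      show "\<forall>\<^sub>F n in sequentially. norm ((dist (w n) z - dist (w n) base) - (h z - h base)) \<le> inverse (real (Suc n))"
      proof (rule eventually_sequentiallyI)
        fix n assume "nat \<lceil>dist base z\<rceil> \<le> n"
        then have "z \<in> cball base (real n)" by (simp add: nat_ceiling_le_eq)
        then show "norm ((dist (w n) z - dist (w n) base) - (h z - h base)) \<le> inverse (real (Suc n))"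
          using w(2) by (simp add: less_imp_le)
      qed
    qed
    then have "(\<lambda>n. (dist z base - (dist (w n) z - dist (w n) base)) / 2) \<longlonglongrightarrow> (dist z base - (h z - h base)) / 2"
      by (intro tendsto_divide tendsto_diff[OF tendsto_const] tendsto_const) simp_all
    then have "(\<lambda>n. gp z (w n)) \<longlonglongrightarrow> (dist z base - (h z - h base)) / 2"
      by (simp add: gromov_product_def dist_commute algebra_simps)
    from LIMSEQ_subseq_LIMSEQ[OF this r]
    have lim: "(\<lambda>n. gp z (w (r n))) \<longlonglongrightarrow> (dist z base - (h z - h base)) / 2"
      by (simp add: o_def)
    \<comment> \<open>For such \<open>t\<close> the product of \<open>w (r n)\<close> and
      \<open>\<gamma> t\<close> eventually exceeds \<open>dist z base\<close>, so it never realises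
      the minimum in the four-point inequality.\<close>
    have close: "\<bar>(dist z base - (h z - h base)) / 2 - gp z (\<gamma> t)\<bar> \<le> \<Delta>" if t: "t \<ge> dist z base + 1" for t
    proof (rule tendsto_upperbound[OF _ _ sequentially_bot])
      show "(\<lambda>n. \<bar>gp z (w (r n)) - gp z (\<gamma> t)\<bar>) \<longlonglongrightarrow> \<bar>(dist z base - (h z - h base)) / 2 - gp z (\<gamma> t)\<bar>"
        by (intro tendsto_intros lim)
      have t0: "t \<ge> 0" using t zero_le_dist[of z base] by linarith
      then have "\<forall>\<^sub>F n in sequentially. dist z base < gp (w (r n)) (\<gamma> t)"
        using order_tendstoD(1)[OF g(3)[rule_format, OF t0], of "dist z base"] t by simp
      then show "\<forall>\<^sub>F n in sequentially. \<bar>gp z (w (r n)) - gp z (\<gamma> t)\<bar> \<le> \<Delta>"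
      proof eventually_elim
        case (elim n)
        have "gp z (w (r n)) - \<Delta> \<le> gp z (\<gamma> t)"
          by (rule four_pointD[of _ _ _ "w (r n)"]) (use elim gromov_product_le_dist(1)[of base z "w (r n)"] in auto)
        moreover have "gp z (\<gamma> t) - \<Delta> \<le> gp z (w (r n))"
          by (rule four_pointD[of _ _ _ "\<gamma> t"])
            (use elim gromov_product_le_dist(1)[of base z "\<gamma> t"] in \<open>auto simp: gromov_product_commute\<close>)
        ultimately show ?case by (simp add: abs_le_iff)
      qed
    qed
    have "\<bar>(dist z base - (h z - h base)) / 2 - rp z \<gamma>\<bar> \<le> \<Delta>"
    proof (rule tendsto_upperbound[OF _ _ trivial_limit_at_top_linorder])
      show "((\<lambda>t. \<bar>(dist z base - (h z - h base)) / 2 - gp z (\<gamma> t)\<bar>) \<longlongrightarrow> \<bar>(dist z base - (h z - h base)) / 2 - rp z \<gamma>\<bar>) at_top"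
        by (intro tendsto_intros ray_product_tendsto g(1))
      show "\<forall>\<^sub>F t in at_top. \<bar>(dist z base - (h z - h base)) / 2 - gp z (\<gamma> t)\<bar> \<le> \<Delta>"
        using eventually_ge_at_top[of "dist z base + 1"] by eventually_elim (rule close)
    qed
    then show ?thesis by (simp add: ray_product_def abs_le_iff field_simps)
  qed
  then show ?thesis using g(1) unfolding fellow_ray_def by blast
qed

lemma gromov_open_Inl:
  assumes "open S"
  shows "gromov_open (Inl ` S :: 'a gromov_point set)"
proof -
  have "{x. (Inl x :: 'a gromov_point) \<in> Inl ` S} = S" by auto
  then have "open {x. (Inl x :: 'a gromov_point) \<in> Inl ` S}" using assms by simp
  then show ?thesis unfolding gromov_open_def by (auto simp: gromov_points_def)
qed

text \<open>This existence result gives the choice in \<open>horo_to_gromov\<close> its properties.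
  A boundary class is sent to the end of an arbitrary fellow ray; the continuity estimates hold for
  every such ray, so the choice is harmless.\<close>

lemma horo_to_gromov_exists:
  "\<exists>\<Phi>. continuous_map (subtopology cts_mod_const_topology horo_compactification) gromov_topology \<Phi> \<and>
     (\<forall>x::'a. \<Phi> (class_mod_const (dist x)) = Inl x)"
proof -
  define emb where "emb x = class_mod_const (dist x)" for x :: 'a
  define \<Phi> where "\<Phi> a = (if a \<in> range emb then Inl (inv emb a) else Inr (ray_class (SOME \<gamma>. fellow_ray a \<gamma>)))" for a
  have inj: "inj emb" by (rule injI) (auto simp: emb_def dest: class_dist_inj)
  have \<Phi>_emb: "\<Phi> (emb x) = Inl x" for x
    by (simp add: \<Phi>_def inv_f_f[OF inj])
  have \<Phi>_bdry: "\<exists>\<gamma>. \<Phi> a = Inr (ray_class \<gamma>) \<and> fellow_ray a \<gamma>" if a: "a \<in> horo_boundary" for a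
  proof -
    have n: "a \<notin> range emb" using a by (auto simp: horo_boundary_def emb_def)
    obtain h where "a = class_mod_const h"
      using a horo_compactificationE[of a] by (auto simp: horo_boundary_def)
    then have "\<exists>\<gamma>. fellow_ray a \<gamma>" using fellow_ray_exists a by blast
    from someI_ex[OF this] show ?thesis using n by (auto simp: \<Phi>_def)
  qed
  have cases: "(\<exists>x. a = emb x) \<or> a \<in> horo_boundary" if "a \<in> horo_compactification" for a
    using that by (auto simp: horo_boundary_def emb_def)
  have points: "\<Phi> a \<in> gromov_points" if "a \<in> horo_compactification" for a
    using cases[OF that]
  proof
    assume "\<exists>x. a = emb x"
    then show ?thesis using \<Phi>_emb by (auto simp: gromov_points_def)
  next
    assume "a \<in> horo_boundary"
    then obtain \<gamma> where "\<Phi> a = Inr (ray_class \<gamma>)" "geodesic_ray \<gamma>"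
      using \<Phi>_bdry unfolding fellow_ray_def by blast
    then show ?thesis using ray_class_in_boundary by (auto simp: gromov_points_def)
  qed
  have nbhd: "\<exists>W. openin cts_mod_const_topology W \<and> a \<in> W \<and> (\<forall>b\<in>W \<inter> horo_compactification. \<Phi> b \<in> U)"
    if U: "gromov_open U" and a: "a \<in> horo_compactification" "\<Phi> a \<in> U" for U a
    using cases[OF a(1)]
  proof
    assume "\<exists>x. a = emb x"
    then obtain x where x: "a = emb x" by blast
    have "open {y. Inl y \<in> U}" "x \<in> {y. Inl y \<in> U}"
      using U a(2) \<Phi>_emb unfolding x gromov_open_def by auto
    then obtain e where e: "e > 0" "ball x e \<subseteq> {y. Inl y \<in> U}" unfolding open_contains_ball by blast
    define d where "d = min (e / 2) (1 / 2)"
    have d: "0 < d" "d < e" "d \<le> 1 / 2" using e(1) by (auto simp: d_def)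
    define W where "W = horo_nbhd (cball x 1) x (dist x) d"
    have cd: "continuous_on UNIV (dist y)" for y :: 'a by (intro continuous_intros)
    have "\<Phi> b \<in> U" if b: "b \<in> W" "b \<in> horo_compactification" for b
      using cases[OF b(2)]
    proof
      assume "\<exists>y. b = emb y"
      then obtain y where y: "b = emb y" by blast
      have in_W: "\<forall>z\<in>cball x 1. \<bar>(dist y z - dist y x) - (dist x z - dist x x)\<bar> < d"
        using b(1) unfolding y emb_def W_def class_in_horo_nbhd_iff[OF cd] .
      \<comment> \<open>Moving from \<open>x\<close> towards \<open>y\<close> by \<open>t\<close>
        raises \<open>dist x\<close> and lowers \<open>dist y\<close> by \<open>t\<close>, so
        \<open>2 * t < d\<close>. As \<open>d\<close> is at most 1/2, the truncation at 1 is
        inactive and \<open>t\<close> is the full distance.\<close>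
      define t where "t = min (dist x y) 1"
      obtain z where z: "dist x z = t" "dist z y = dist x y - t"
        using geodesic_space_point[OF geodesic, of t x y] unfolding t_def by auto
      have "z \<in> cball x 1" using z(1) by (simp add: t_def)
      then have "\<bar>(dist y z - dist y x) - (dist x z - dist x x)\<bar> < d" using in_W by blast
      then have "2 * t < d" using z by (simp add: dist_commute abs_less_iff)
      then have "dist x y < e" using d(2,3) zero_le_dist[of x y] unfolding t_def by linarith
      then show ?thesis using e(2) \<Phi>_emb y by auto
    next
      assume bb: "b \<in> horo_boundary"
      obtain h where h: "continuous_on UNIV h" "b = class_mod_const h"
        using horo_compactificationE[OF b(2)] by metis
      \<comment> \<open>A horofunction falls by at least 1/2 at some \<open>z\<close> where
        \<open>dist x\<close> has grown by 1, so \<open>W\<close> contains no boundary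
        class.\<close>
      obtain z where z: "dist x z = 1" "h z - h x \<le> - 1 + 1 / 2"
        using horo_boundary_descends[OF geodesic bb[unfolded h(2)], of 1 "1/2"] by auto
      have in_W: "\<forall>z\<in>cball x 1. \<bar>(h z - h x) - (dist x z - dist x x)\<bar> < d"
        using b(1) unfolding h(2) W_def class_in_horo_nbhd_iff[OF h(1)] .
      have "z \<in> cball x 1" using z(1) by simp
      with in_W have "\<bar>(h z - h x) - (dist x z - dist x x)\<bar> < d" by blast
      then have "\<bar>(h z - h x) - 1\<bar> < d" using z(1) by simp
      then show ?thesis using z(2) d(3) by linarith
    qed
    moreover have "a \<in> W" unfolding x emb_def W_def class_in_horo_nbhd_iff[OF cd] using d(1) by simp
    moreover have "openin cts_mod_const_topology W" unfolding W_def by (intro openin_horo_nbhd cd) simp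
    ultimately show ?thesis by blast
  next
    assume ab: "a \<in> horo_boundary"
    obtain \<gamma> where \<gamma>: "\<Phi> a = Inr (ray_class \<gamma>)" "fellow_ray a \<gamma>" using \<Phi>_bdry[OF ab] by blast
    obtain h where h: "continuous_on UNIV h" "a = class_mod_const h"
      using horo_compactificationE[OF a(1)] by metis
    note fel = fellow_rayD[OF \<gamma>(2)[unfolded h(2)]]
    obtain r where r: "{\<xi> \<in> gromov_points. extended_gromov_product base \<xi> (Inr (ray_class \<gamma>)) > ereal r} \<subseteq> U"
      using U a(2) unfolding \<gamma>(1) gromov_open_def by blast
    have \<gamma>_rep: "\<gamma> \<in> representing_paths (Inr (ray_class \<gamma>))" using self_in_ray_class[OF fel(1)] by simp
    \<comment> \<open>The estimates below retain \<open>R - 1 - 2 * \<Delta>\<close>: 1 covers the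
      tolerances of the descent and of \<open>W\<close>, one \<open>\<Delta>\<close> the fellow ray,
      the other the four-point inequality.\<close>
    define R where "R = \<bar>r\<bar> + 2 * \<Delta> + 4"
    have R0: "R \<ge> 0" using \<Delta>_nonneg by (simp add: R_def)
    obtain z where z: "dist base z = R" "h z - h base \<le> - R + 1"
      using horo_boundary_descends[OF geodesic ab[unfolded h(2)] R0, of 1] by auto
    \<comment> \<open>One test point is enough: \<open>z\<close> has a large product with
      \<open>\<gamma>\<close> and with the image of every class in \<open>W\<close>, and the
      four-point inequality joins the two.\<close>
    define W where "W = horo_nbhd {z} base h 1"
    have rpz: "R - 1 / 2 - \<Delta> \<le> rp z \<gamma>" using fel(2)[of z] z by (simp add: dist_commute field_simps)
    obtain N where N: "\<forall>t\<ge>N. R - 1 - \<Delta> < gp z (\<gamma> t)"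
      using eventually_gp_gt[OF fel(1), of "R - 1 - \<Delta>" z] rpz by auto
    have "\<Phi> b \<in> U" if b: "b \<in> W" "b \<in> horo_compactification" for b
    proof -
      have "\<exists>\<beta>\<in>representing_paths (\<Phi> b). \<exists>N. \<forall>s\<ge>N. R - 1 - \<Delta> \<le> gp (\<beta> s) z"
        using cases[OF b(2)]
      proof
        assume "\<exists>y. b = emb y"
        then obtain y where y: "b = emb y" by blast
        have "\<bar>(dist y z - dist y base) - (h z - h base)\<bar> < 1"
          using b(1) unfolding y emb_def W_def by (subst (asm) class_in_horo_nbhd_iff) (auto intro: continuous_intros)
        then have "R - 1 \<le> gp y z" using z by (simp add: gromov_product_def dist_commute abs_less_iff)
        then show ?thesis using y \<Phi>_emb[of y] \<Delta>_nonneg by auto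
      next
        assume bb: "b \<in> horo_boundary"
        obtain \<beta> where \<beta>: "\<Phi> b = Inr (ray_class \<beta>)" "fellow_ray b \<beta>" using \<Phi>_bdry[OF bb] by blast
        obtain k where k: "continuous_on UNIV k" "b = class_mod_const k"
          using horo_compactificationE[OF b(2)] by metis
        note felb = fellow_rayD[OF \<beta>(2)[unfolded k(2)]]
        have "\<bar>(k z - k base) - (h z - h base)\<bar> < 1"
          using b(1) unfolding k(2) W_def class_in_horo_nbhd_iff[OF k(1)] by simp
        then have "k z - k base < - R + 2" using z(2) by linarith
        then have "R - 1 - \<Delta> < rp z \<beta>" using felb(2)[of z] z(1) by (simp add: dist_commute field_simps)
        then obtain M where "\<forall>t\<ge>M. R - 1 - \<Delta> < gp z (\<beta> t)"
          using eventually_gp_gt[OF felb(1)] by blast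
        then have "\<forall>t\<ge>M. R - 1 - \<Delta> \<le> gp (\<beta> t) z" by (simp add: gromov_product_commute less_imp_le)
        moreover have "\<beta> \<in> representing_paths (\<Phi> b)" using self_in_ray_class[OF felb(1)] \<beta>(1) by simp
        ultimately show ?thesis by blast
      qed
      then obtain \<beta> M where \<beta>: "\<beta> \<in> representing_paths (\<Phi> b)" "\<forall>s\<ge>M. R - 1 - \<Delta> \<le> gp (\<beta> s) z" by blast
      have "ereal (R - 1 - \<Delta> - \<Delta>) \<le> extended_gromov_product base (\<Phi> b) (Inr (ray_class \<gamma>))"
      proof (rule extended_gromov_product_ge[OF \<beta>(1) \<gamma>_rep], intro allI impI)
        fix s t assume st: "max M N \<le> s" "max M N \<le> t"
        show "R - 1 - \<Delta> - \<Delta> \<le> gp (\<beta> s) (\<gamma> t)"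
          by (rule four_pointD[of _ _ _ z]) (use \<beta>(2) N st in \<open>auto intro: less_imp_le\<close>)
      qed
      moreover have "ereal r < ereal (R - 1 - \<Delta> - \<Delta>)" by (simp add: R_def)
      ultimately have "ereal r < extended_gromov_product base (\<Phi> b) (Inr (ray_class \<gamma>))" by (rule less_le_trans[rotated])
      then show ?thesis using r points[OF b(2)] by blast
    qed
    moreover have "a \<in> W" unfolding h(2) W_def class_in_horo_nbhd_iff[OF h(1)] by simp
    moreover have "openin cts_mod_const_topology W" unfolding W_def by (intro openin_horo_nbhd h(1)) simp
    ultimately show ?thesis by blast
  qed
  let ?X = "subtopology cts_mod_const_topology (horo_compactification :: ('a \<Rightarrow> real) set set)"
  have top: "topspace ?X = horo_compactification"
    unfolding topspace_subtopology horo_compactification_def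
    by (rule Int_absorb1[OF closure_of_subset_topspace])
  have "continuous_map ?X gromov_topology \<Phi>"
    unfolding continuous_map_def top
  proof (intro conjI allI impI)
    show "\<Phi> \<in> horo_compactification \<rightarrow> topspace gromov_topology"
      using points by (auto simp: topspace_gromov_topology)
    fix U :: "'a gromov_point set" assume "openin gromov_topology U"
    then have U: "gromov_open U" by (simp add: openin_gromov_topology)
    show "openin ?X {a \<in> horo_compactification. \<Phi> a \<in> U}"
    proof (subst openin_subopen, rule ballI)
      fix a assume a: "a \<in> {a \<in> horo_compactification. \<Phi> a \<in> U}"
      then obtain W where W: "openin cts_mod_const_topology W" "a \<in> W" "\<forall>b\<in>W \<inter> horo_compactification. \<Phi> b \<in> U"
        using nbhd[OF U] by blast
      show "\<exists>T. openin ?X T \<and> a \<in> T \<and> T \<subseteq> {a \<in> horo_compactification. \<Phi> a \<in> U}"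
        using W a openin_subtopology_Int[OF W(1), of horo_compactification]
        by (intro exI[of _ "W \<inter> horo_compactification"]) auto
    qed
  qed
  then show ?thesis using \<Phi>_emb unfolding emb_def by blast
qed

lemma geodesic_ray_converges:
  fixes \<gamma> :: "real \<Rightarrow> 'a"
  assumes "geodesic_ray \<gamma>"
  shows "converges_to_boundary (\<lambda>n. \<gamma> (real n)) (ray_class \<gamma>)"
  unfolding converges_to_boundary_iff[OF ray_class_in_boundary[OF assms] self_in_ray_class[OF assms]]
proof
  fix M
  have "\<forall>\<^sub>F n in sequentially. M + dist (\<gamma> 0) base < real n"
    using filterlim_real_sequentially by (simp add: filterlim_at_top_dense)
  then show "\<forall>\<^sub>F n in sequentially. M < rp (\<gamma> (real n)) \<gamma>"
  proof eventually_elim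
    case (elim n)
    then show ?case using ray_product_on_ray[OF assms, of "real n" base] by simp
  qed
qed

text \<open>The points \<open>\<gamma> n\<close> converge to the Busemann class among horofunctions
  and to the class of \<open>\<gamma>\<close> in the Gromov topology; continuity identifies the two
  limits.\<close>

lemma horo_to_gromov_busemann:
  fixes \<gamma> :: "real \<Rightarrow> 'a"
  assumes r: "geodesic_ray \<gamma>"
  shows "horo_to_gromov (class_mod_const (busemann \<gamma>)) = Inr (ray_class \<gamma>)"
proof -
  let ?X = "subtopology cts_mod_const_topology (horo_compactification :: ('a \<Rightarrow> real) set set)"
  let ?a = "class_mod_const (busemann \<gamma>)"
  have \<Phi>: "continuous_map ?X gromov_topology horo_to_gromov"
    "horo_to_gromov (class_mod_const (dist x)) = Inl x" for x :: 'a
    using someI_ex[OF horo_to_gromov_exists] unfolding horo_to_gromov_def by blast+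
  have "limitin cts_mod_const_topology (\<lambda>n. class_mod_const (dist (\<gamma> (real n)))) ?a sequentially"
    unfolding limitin_def
  proof (intro conjI allI impI)
    show "?a \<in> topspace cts_mod_const_topology"
      by (rule class_in_topspace[OF busemann_continuous[OF r]])
    fix T assume T: "openin cts_mod_const_topology T \<and> ?a \<in> T"
    then obtain K \<epsilon> where K: "compact K" "\<epsilon> > 0"
      "{g. continuous_on UNIV g \<and> (\<forall>y\<in>K. dist (g y) (busemann \<gamma> y) < \<epsilon>)} \<subseteq> {h. continuous_on UNIV h \<and> class_mod_const h \<in> T}"
      using compact_convergence_openE[of "{h. continuous_on UNIV h \<and> class_mod_const h \<in> T}" "busemann \<gamma>"]
        busemann_continuous[OF r]
      unfolding openin_cts_mod_const_topology by blast
    have "\<forall>\<^sub>F n in sequentially. \<forall>z\<in>K. \<bar>dist (\<gamma> (real n)) z + - real n - busemann \<gamma> z\<bar> < \<epsilon>"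
      using eventually_compose_filterlim[OF busemann_uniform_limit[OF r K(1,2)] filterlim_real_sequentially] .
    then show "\<forall>\<^sub>F n in sequentially. class_mod_const (dist (\<gamma> (real n))) \<in> T"
    proof eventually_elim
      case (elim n)
      have "continuous_on UNIV (\<lambda>z. dist (\<gamma> (real n)) z + - real n)" by (intro continuous_intros)
      then have "class_mod_const (\<lambda>z. dist (\<gamma> (real n)) z + - real n) \<in> T"
        using K(3) elim unfolding dist_real_def by blast
      moreover have "class_mod_const (\<lambda>z. dist (\<gamma> (real n)) z + - real n) = class_mod_const (dist (\<gamma> (real n)))"
        unfolding class_mod_const_eq_iff by blast
      ultimately show ?case by simp
    qed
  qed
  then have "limitin ?X (\<lambda>n. class_mod_const (dist (\<gamma> (real n)))) ?a sequentially"
    using busemann_in_horo_boundary[OF r] class_dist_in_horo_compactification[of "\<gamma> (real _)"]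
    by (simp add: limitin_subtopology horo_boundary_def)
  from continuous_map_limit[OF \<Phi>(1) this]
  have lim: "limitin gromov_topology (\<lambda>n. Inl (\<gamma> (real n))) (horo_to_gromov ?a) sequentially"
    by (simp add: o_def \<Phi>(2))
  then have "horo_to_gromov ?a \<in> gromov_points"
    by (simp add: limitin_def topspace_gromov_topology)
  then consider (1) x where "horo_to_gromov ?a = Inl x" | (2) \<eta> where "horo_to_gromov ?a = Inr \<eta>" "\<eta> \<in> gromov_boundary"
    unfolding gromov_points_def by blast
  then show ?thesis
  proof cases
    case 1
    have "\<forall>\<^sub>F n in sequentially. (Inl (\<gamma> (real n)) :: 'a gromov_point) \<in> Inl ` ball x 1"
      using lim gromov_open_Inl[of "ball x 1"] unfolding 1 limitin_def openin_gromov_topology by simp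
    then obtain N where N: "\<forall>n\<ge>N. \<gamma> (real n) \<in> ball x 1"
      unfolding eventually_sequentially by blast
    \<comment> \<open>A limit in the space would trap the tail of the ray in a ball of radius 1,
      whose points are less than 2 apart.\<close>
    have "dist (\<gamma> (real N)) (\<gamma> (real (N + 2))) = 2" by (subst geodesic_rayD[OF r]) auto
    moreover have "\<gamma> (real N) \<in> ball x 1" "\<gamma> (real (N + 2)) \<in> ball x 1" using N[rule_format, of N] N[rule_format, of "N + 2"] by simp_all
    ultimately have False
      using dist_triangle3[of "\<gamma> (real N)" "\<gamma> (real (N + 2))" x] by simp
    then show ?thesis ..
  next
    case 2
    then show ?thesis
      using converges_to_boundary_unique[OF 2(2) ray_class_in_boundary[OF r]] lim geodesic_ray_converges[OF r] by auto
  qed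
qed

end

section \<open>Forward orbits\<close>

lemma non_expanding_funpow: "non_expanding f \<Longrightarrow> dist ((f ^^ n) x) ((f ^^ n) y) \<le> dist x y"
proof (induction n)
  case (Suc n)
  then show ?case
    unfolding non_expanding_def by simp (meson order_trans)
qed simp

lemma filterlim_dist_iff:
  "filterlim (\<lambda>n. dist q (w n)) at_top sequentially \<longleftrightarrow> (\<forall>R. finite {n. dist q (w n) \<le> R})"
proof
  assume L: "filterlim (\<lambda>n. dist q (w n)) at_top sequentially"
  show "\<forall>R. finite {n. dist q (w n) \<le> R}"
  proof
    fix R
    have "\<forall>\<^sub>F n in cofinite. \<not> dist q (w n) \<le> R"
      using L unfolding filterlim_at_top_dense cofinite_eq_sequentially by (simp add: not_le)
    then show "finite {n. dist q (w n) \<le> R}"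
      by (simp add: eventually_cofinite)
  qed
next
  assume R: "\<forall>R. finite {n. dist q (w n) \<le> R}"
  have "\<forall>\<^sub>F n in cofinite. Z \<le> dist q (w n)" for Z
    unfolding eventually_cofinite by (rule finite_subset[OF _ R[rule_format, of Z]]) auto
  then show "filterlim (\<lambda>n. dist q (w n)) at_top sequentially"
    unfolding filterlim_at_top cofinite_eq_sequentially by blast
qed

lemma bounded_infinite_subsequence:
  fixes w :: "nat \<Rightarrow> 'a::heine_borel"
  assumes "infinite {n. dist q (w n) \<le> R}"
  obtains r z where "strict_mono r" "(\<lambda>n. w (r n)) \<longlonglongrightarrow> z"
proof -
  obtain r :: "nat \<Rightarrow> nat" where r: "strict_mono r" "\<forall>n. r n \<in> {n. dist q (w n) \<le> R}"
    using infinite_enumerate[OF assms] by blast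
  have 1: "seq_compact (cball q R)" by (simp add: compact_imp_seq_compact)
  have 2: "\<forall>n. w (r n) \<in> cball q R" using r(2) by simp
  obtain z s where s: "z \<in> cball q R" "strict_mono s" "((\<lambda>n. w (r n)) \<circ> s) \<longlonglongrightarrow> z"
    using seq_compactE[OF 1 2] .
  show thesis
    using that[OF strict_mono_o[OF r(1) s(2)], of z] s(3) by (simp add: o_def)
qed

text \<open>Calka's theorem.  A limit point \<open>z\<close> of an orbit is recurrent, and by compactness the orbit of \<open>z\<close>
  returns to the ball of radius 2 about \<open>z\<close> with bounded gaps.\<close>

lemma elliptic_if_recurrent:
  fixes f :: "'a::heine_borel \<Rightarrow> 'a"
  assumes f: "non_expanding f" and inf: "infinite {n. dist q ((f ^^ n) x) \<le> R}"
  shows "elliptic f"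
proof -
  obtain k z where k: "strict_mono k" "(\<lambda>n. (f ^^ k n) x) \<longlonglongrightarrow> z"
    using bounded_infinite_subsequence[OF inf] .
  \<comment> \<open>Two late visits of the orbit of \<open>x\<close> near \<open>z\<close>, at times
    \<open>k N\<close> and \<open>k j\<close>, yield the return time \<open>k j - k N\<close> of
    \<open>z\<close>.\<close>
  have "\<exists>n>m. dist ((f ^^ n) z) z < 1" for m
  proof -
    obtain N where N: "\<forall>i\<ge>N. dist ((f ^^ k i) x) z < 1 / 2"
      using metric_LIMSEQ_D[OF k(2), of "1/2"] by auto
    define j where "j = N + m + k N + 1"
    have j: "k N + m < k j" "N \<le> j"
      using seq_suble[OF k(1), of j] by (simp_all add: j_def)
    define n where "n = k j - k N"
    have n: "m < n" "k j = n + k N" using j(1) by (simp_all add: n_def)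
    have "dist ((f ^^ n) z) z \<le> dist ((f ^^ n) z) ((f ^^ n) ((f ^^ k N) x)) + dist ((f ^^ k j) x) z"
      unfolding n(2) funpow_add o_apply by (rule dist_triangle)
    also have "\<dots> \<le> dist z ((f ^^ k N) x) + dist ((f ^^ k j) x) z"
      using non_expanding_funpow[OF f] by simp
    also have "\<dots> < 1" using N[rule_format, of N] N[rule_format, of j] j(2) by (simp add: dist_commute)
    finally show ?thesis using n(1) by blast
  qed
  then obtain \<nu> where \<nu>: "\<And>m. m < \<nu> m" "\<And>m. dist ((f ^^ \<nu> m) z) z < 1"
    by metis
  obtain C where C: "finite C" "cball z 2 \<subseteq> (\<Union>c\<in>C. ball c (1 / 2))"
    using seq_compact_imp_totally_bounded[OF compact_imp_seq_compact[OF compact_cball], of z 2] by (metis half_gt_zero_iff zero_less_one)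
  \<comment> \<open>One visiting time per ball, meaningful only for balls that the orbit of
    \<open>z\<close> meets. From any orbit point in such a ball, the steps that lead
    \<open>z\<close> from time \<open>g c\<close> to the return time \<open>\<nu> (g c)\<close> also
    lead back near \<open>z\<close>; finitely many balls bound their number.\<close>
  define g where "g c = (SOME m. (f ^^ m) z \<in> ball c (1 / 2))" for c
  obtain N where N: "\<forall>c\<in>C. \<nu> (g c) \<le> N"
    using finite_nat_set_iff_bounded_le[of "(\<lambda>c. \<nu> (g c)) ` C"] C(1) by auto
  have return: "\<exists>d. 1 \<le> d \<and> d \<le> N \<and> dist ((f ^^ (d + s)) z) z \<le> 2" if s: "dist ((f ^^ s) z) z \<le> 2" for s
  proof -
    have "(f ^^ s) z \<in> cball z 2" using s by (simp add: dist_commute)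
    then obtain c where c: "c \<in> C" "(f ^^ s) z \<in> ball c (1 / 2)" using C(2) by blast
    have gc: "(f ^^ g c) z \<in> ball c (1 / 2)" unfolding g_def using c(2) by (rule someI)
    have close: "dist ((f ^^ s) z) ((f ^^ g c) z) \<le> 1"
      using c(2) gc dist_triangle3[of "(f ^^ s) z" "(f ^^ g c) z" c] by simp
    define d where "d = \<nu> (g c) - g c"
    have d: "\<nu> (g c) = d + g c" "1 \<le> d" "d \<le> N"
      using \<nu>(1)[of "g c"] N[rule_format, OF c(1)] unfolding d_def by linarith+
    have "dist ((f ^^ (d + s)) z) z \<le> dist ((f ^^ d) ((f ^^ s) z)) ((f ^^ d) ((f ^^ g c) z)) + dist ((f ^^ \<nu> (g c)) z) z"
      unfolding d(1) funpow_add o_apply by (rule dist_triangle)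
    also have "\<dots> \<le> 1 + 1"
      using non_expanding_funpow[OF f, of d "(f ^^ s) z" "(f ^^ g c) z"] close \<nu>(2)[of "g c"] by linarith
    finally show ?thesis using d(2,3) by auto
  qed
  \<comment> \<open>Once the gap since the last known visit would exceed \<open>N\<close>,
    \<open>return\<close> supplies a later one.\<close>
  have visit: "\<exists>s\<le>t. t - s \<le> N \<and> dist ((f ^^ s) z) z \<le> 2" for t
  proof (induction t)
    case (Suc t)
    then obtain s where s: "s \<le> t" "t - s \<le> N" "dist ((f ^^ s) z) z \<le> 2" by blast
    show ?case
    proof (cases "Suc t - s \<le> N")
      case True
      then show ?thesis using s by (intro exI[of _ s]) simp
    next
      case False
      obtain d where d: "1 \<le> d" "d \<le> N" "dist ((f ^^ (d + s)) z) z \<le> 2" using return[OF s(3)] by blast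
      then show ?thesis using False s by (intro exI[of _ "d + s"]) auto
    qed
  qed auto
  define B where "B = Max ((\<lambda>u. dist ((f ^^ u) z) z) ` {..N})"
  have "dist z ((f ^^ t) z) \<le> 2 + B" for t
  proof -
    obtain s where s: "s \<le> t" "t - s \<le> N" "dist ((f ^^ s) z) z \<le> 2" using visit by blast
    have "(f ^^ t) z = (f ^^ (t - s)) ((f ^^ s) z)"
      using s(1) by (metis comp_apply funpow_add le_add_diff_inverse2)
    then have "dist ((f ^^ t) z) z \<le> dist ((f ^^ (t - s)) ((f ^^ s) z)) ((f ^^ (t - s)) z) + dist ((f ^^ (t - s)) z) z"
      by (simp add: dist_triangle)
    moreover have "dist ((f ^^ (t - s)) z) z \<le> B"
      unfolding B_def using s(2) by (intro Max_ge) auto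
    ultimately show ?thesis
      using non_expanding_funpow[OF f, of "t - s" "(f ^^ s) z" z] s(3) by (simp add: dist_commute)
  qed
  then have "bounded (range (\<lambda>n. (f ^^ n) z))"
    unfolding bounded_def by blast
  then show ?thesis unfolding elliptic_def by blast
qed

lemma non_elliptic_escapes:
  fixes f :: "'a::heine_borel \<Rightarrow> 'a"
  assumes "non_expanding f" "\<not> elliptic f"
  shows "filterlim (\<lambda>n. dist q ((f ^^ n) x)) at_top sequentially"
  unfolding filterlim_dist_iff using elliptic_if_recurrent[OF assms(1)] assms(2) by blast

section \<open>Elliptic maps with compact limit retract\<close>

lemma elliptic_orbit_bounded:
  assumes f: "non_expanding f" and e: "elliptic f"
  obtains C where "\<forall>n. dist q ((f ^^ n) x) \<le> C"
proof -
  obtain y where "bounded (range (\<lambda>n. (f ^^ n) y))" using e unfolding elliptic_def by blast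
  then obtain B where B: "\<forall>n. dist q ((f ^^ n) y) \<le> B" using bounded_any_center[of _ q] by auto
  have "dist q ((f ^^ n) x) \<le> B + dist y x" for n
    using dist_triangle[of q "(f ^^ n) x" "(f ^^ n) y"] non_expanding_funpow[OF f, of n y x] B[rule_format, of n] by linarith
  then show thesis using that by blast
qed

lemma limit_retract_funpow:
  assumes f: "non_expanding f" and z: "z \<in> limit_retract f"
  shows "(f ^^ m) z \<in> limit_retract f"
proof (induction m)
  case (Suc m)
  then obtain x r where r: "strict_mono r" "(\<lambda>n. (f ^^ r n) x) \<longlonglongrightarrow> (f ^^ m) z"
    unfolding limit_retract_def by blast
  have "(\<lambda>n. f ((f ^^ r n) x)) \<longlonglongrightarrow> f ((f ^^ m) z)"
  proof (rule metric_LIMSEQ_I)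
    fix e :: real assume "e > 0"
    then obtain N where "\<forall>n\<ge>N. dist ((f ^^ r n) x) ((f ^^ m) z) < e" using metric_LIMSEQ_D[OF r(2)] by blast
    then show "\<exists>N. \<forall>n\<ge>N. dist (f ((f ^^ r n) x)) (f ((f ^^ m) z)) < e"
      using f unfolding non_expanding_def by (meson le_less_trans)
  qed
  then have "(\<lambda>n. (f ^^ r n) (f x)) \<longlonglongrightarrow> (f ^^ Suc m) z" by (simp add: funpow_swap1)
  then show ?case using r(1) unfolding limit_retract_def by blast
qed (use z in simp)

text \<open>Every orbit eventually stays within 1 of the limit retract, which \<open>f\<close> maps
  into itself. A finite net of radius 1 in the ball of radius \<open>B + 3\<close> makes the time
  uniform, and the passage to the net adds another 1; hence \<open>C = B + 2\<close>.\<close>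

lemma strongly_elliptic_absorbs:
  fixes f :: "'a::heine_borel \<Rightarrow> 'a"
  assumes f: "non_expanding f" and e: "elliptic f" and c: "compact (limit_retract f)"
  obtains C N where "C \<ge> 0" "N \<ge> 1" "\<forall>z. dist q z \<le> C + 1 \<longrightarrow> dist q ((f ^^ N) z) \<le> C"
proof -
  obtain B where B: "B \<ge> 0" "\<forall>k\<in>limit_retract f. dist q k \<le> B"
    using compact_imp_bounded[OF c] unfolding bounded_any_center[of _ q] by (metis abs_ge_self abs_ge_zero order_trans)
  have "\<exists>n. \<forall>m\<ge>n. dist q ((f ^^ m) z) \<le> B + 1" for z
  proof -
    obtain C where C: "\<forall>n. dist q ((f ^^ n) z) \<le> C" using elliptic_orbit_bounded[OF f e, of q z] .
    then have inf: "infinite {n. dist q ((f ^^ n) z) \<le> C}" by simp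
    obtain r k where r: "strict_mono r" "(\<lambda>n. (f ^^ r n) z) \<longlonglongrightarrow> k"
      using bounded_infinite_subsequence[OF inf] .
    then have k: "k \<in> limit_retract f" unfolding limit_retract_def by blast
    obtain i where i: "dist ((f ^^ r i) z) k < 1" using metric_LIMSEQ_D[OF r(2), of 1] by auto
    have "dist q ((f ^^ m) z) \<le> B + 1" if m: "m \<ge> r i" for m
    proof -
      have "(f ^^ m) z = (f ^^ (m - r i)) ((f ^^ r i) z)"
        using m by (metis comp_apply funpow_add le_add_diff_inverse2)
      then have "dist ((f ^^ m) z) ((f ^^ (m - r i)) k) \<le> 1"
        using non_expanding_funpow[OF f, of "m - r i" "(f ^^ r i) z" k] i by simp
      moreover have "dist q ((f ^^ (m - r i)) k) \<le> B" using B(2) limit_retract_funpow[OF f k] by blast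
      ultimately show ?thesis using dist_triangle2[of q "(f ^^ m) z" "(f ^^ (m - r i)) k"] by linarith
    qed
    then show ?thesis by blast
  qed
  then obtain \<nu> where \<nu>: "\<And>z m. \<nu> z \<le> m \<Longrightarrow> dist q ((f ^^ m) z) \<le> B + 1" by metis
  obtain F where F: "finite F" "cball q (B + 3) \<subseteq> (\<Union>c\<in>F. ball c 1)"
    using seq_compact_imp_totally_bounded[OF compact_imp_seq_compact[OF compact_cball], of q "B + 3"] by (metis zero_less_one)
  obtain N where N: "\<forall>c\<in>F. \<nu> c \<le> N"
    using finite_nat_set_iff_bounded_le[of "\<nu> ` F"] F(1) by auto
  have "dist q ((f ^^ Suc N) z) \<le> B + 2" if z: "dist q z \<le> B + 2 + 1" for z
  proof -
    obtain c where c: "c \<in> F" "dist c z < 1" using F(2) z by (force simp: subset_iff)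
    have "dist q ((f ^^ Suc N) c) \<le> B + 1" using N[rule_format, OF c(1)] by (intro \<nu>) simp
    then show ?thesis
      using non_expanding_funpow[OF f, of "Suc N" c z] c(2) dist_triangle[of q "(f ^^ Suc N) z" "(f ^^ Suc N) c"] by linarith
  qed
  then show thesis using B(1) by (intro that[of "B + 2" "Suc N"]) auto
qed

text \<open>Take the first index at which \<open>a\<close> exceeds its maximum over
  \<open>{..M}\<close>.\<close>

lemma exists_record:
  fixes a :: "nat \<Rightarrow> real"
  assumes "filterlim a at_top sequentially"
  obtains n where "M \<le> n" "\<forall>k\<le>n. a k \<le> a n"
proof -
  define C where "C = Max (a ` {..M})"
  have C: "a k \<le> C" if "k \<le> M" for k
    unfolding C_def using that by (intro Max_ge) auto
  have "\<exists>n. C < a n"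
    using assms eventually_happens[of _ sequentially] unfolding filterlim_at_top_dense by fastforce
  define n where "n = (LEAST n. C < a n)"
  have n: "C < a n" unfolding n_def using \<open>\<exists>n. C < a n\<close> by (rule LeastI_ex)
  have "a k \<le> C" if "k < n" for k
    using not_less_Least[of k "\<lambda>n. C < a n"] that unfolding n_def by simp
  then have "\<forall>k\<le>n. a k \<le> a n" using n by (metis le_less order.strict_implies_order order_le_less_trans order_refl)
  moreover have "M \<le> n" using C[of n] n by linarith
  ultimately show thesis using that by blast
qed

section \<open>The Denjoy-Wolff point\<close>

context proper_hyperbolic
begin

text \<open>Two orbit points are compared through a common later record time, which exists because
  the orbit escapes; so the orbit of \<open>base\<close> has large mutual products. Any other orbit
  stays at bounded distance from it.\<close>

lemma denjoy_wolff_exists: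
  fixes f :: "'a \<Rightarrow> 'a"
  assumes f: "non_expanding f" and ne: "\<not> elliptic f"
  obtains \<gamma> where "geodesic_ray \<gamma>" "\<gamma> 0 = base" "denjoy_wolff_point f (ray_class \<gamma>)"
proof -
  define y where "y n = (f ^^ n) base" for n
  have lim: "filterlim (\<lambda>n. dist base (y n)) at_top sequentially"
    unfolding y_def by (rule non_elliptic_escapes[OF f ne])
  text \<open>At a record time \<open>n\<close> of \<open>dist base (y n)\<close> one has
    \<open>dist (y m) (y n) \<le> dist base (y (n - m)) \<le> dist base (y n)\<close>.\<close>
  have rec: "dist base (y m) / 2 \<le> gp (y m) (y n)" if n: "\<forall>k\<le>n. dist base (y k) \<le> dist base (y n)" and m: "m \<le> n" for m n
  proof -
    have "y n = (f ^^ m) (y (n - m))"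
      unfolding y_def using m by (metis comp_apply funpow_add le_add_diff_inverse)
    then have "dist (y m) (y n) \<le> dist base (y (n - m))"
      using non_expanding_funpow[OF f, of m base "y (n - m)"] by (simp add: y_def)
    also have "\<dots> \<le> dist base (y n)" using n by simp
    finally show ?thesis by (simp add: gromov_product_def dist_commute)
  qed
  have "\<exists>N. \<forall>m\<ge>N. \<forall>n\<ge>N. M \<le> gp (y m) (y n)" for M
  proof -
    obtain N where N: "\<forall>n\<ge>N. 2 * (M + \<Delta>) \<le> dist base (y n)"
      using lim unfolding filterlim_at_top eventually_sequentially by blast
    have "M \<le> gp (y m) (y n)" if mn: "m \<ge> N" "n \<ge> N" for m n
    proof -
      obtain k where k: "max m n \<le> k" "\<forall>i\<le>k. dist base (y i) \<le> dist base (y k)"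
        using exists_record[OF lim] .
      have "M + \<Delta> \<le> gp (y m) (y k)" "M + \<Delta> \<le> gp (y n) (y k)"
        using rec[OF k(2), of m] rec[OF k(2), of n] k(1) N mn by force+
      then show ?thesis using four_pointD[of "M + \<Delta>" base "y m" "y k" "y n"] by (simp add: gromov_product_commute)
    qed
    then show ?thesis by blast
  qed
  then obtain \<gamma> where \<gamma>: "geodesic_ray \<gamma>" "\<gamma> 0 = base" "converges_to_boundary y (ray_class \<gamma>)"
    using gromov_sequence_converges[of y] by blast
  note conv = converges_to_boundary_iff[OF ray_class_in_boundary[OF \<gamma>(1)] self_in_ray_class[OF \<gamma>(1)]]
  have "converges_to_boundary (\<lambda>n. (f ^^ n) x) (ray_class \<gamma>)" for x
    unfolding conv
  proof
    fix M
    show "\<forall>\<^sub>F n in sequentially. M < rp ((f ^^ n) x) \<gamma>"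
      using \<gamma>(3)[unfolded conv, rule_format, of "M + dist base x"]
    proof eventually_elim
      case (elim n)
      then show ?case
        using ray_product_diff[OF \<gamma>(1), of base "y n" "(f ^^ n) x"] non_expanding_funpow[OF f, of n base x]
        by (simp add: y_def)
    qed
  qed
  then have "denjoy_wolff_point f (ray_class \<gamma>)"
    using ne ray_class_in_boundary[OF \<gamma>(1)] by (simp add: denjoy_wolff_point_def)
  with \<gamma>(1,2) show thesis by (rule that)
qed

section \<open>Broken geodesics\<close>

context
  fixes y :: "nat \<Rightarrow> 'a" and a L :: real
  assumes turn: "\<And>i. gromov_product (y (Suc i)) (y i) (y (Suc (Suc i))) \<le> a"
    and step: "\<And>i. L \<le> dist (y i) (y (Suc i))"
    and long: "2 * a + 4 * \<Delta> + 1 \<le> L"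
begin

text \<open>Local to global. The products at the two ends of a segment sum to its length, so a small
  one at \<open>y j\<close> forces a large one at \<open>y (Suc j)\<close>. If the product of
  \<open>y i\<close> and the next point exceeded \<open>a + \<Delta>\<close> there, the four-point
  inequality would violate the bound on the turn.\<close>

lemma broken_geodesic_last: "i < j \<Longrightarrow> gromov_product (y j) (y i) (y (Suc j)) \<le> a + \<Delta>"
proof (induction j)
  case (Suc j)
  show ?case
  proof (cases "i = j")
    case True
    then show ?thesis using turn[of i] \<Delta>_nonneg by simp
  next
    case False
    then have IH: "gromov_product (y j) (y i) (y (Suc j)) \<le> a + \<Delta>" using Suc by simp
    have "gromov_product (y (Suc j)) (y j) (y i) = dist (y j) (y (Suc j)) - gromov_product (y j) (y i) (y (Suc j))"
      by (simp add: gromov_product_def dist_commute field_simps)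
    then have "a + \<Delta> < gromov_product (y (Suc j)) (y j) (y i)"
      using IH step[of j] long \<Delta>_nonneg by linarith
    then show ?thesis
      using four_point[of "y (Suc j)" "y j" "y i" "y (Suc (Suc j))"] turn[of j] by linarith
  qed
qed simp

lemma broken_geodesic_progress: "real j \<le> dist (y 0) (y j)"
proof (induction j)
  case (Suc j)
  show ?case
  proof (cases "j = 0")
    case True
    have "0 \<le> a" using turn[of 0] gromov_product_nonneg[of "y (Suc 0)" "y 0" "y (Suc (Suc 0))"] by linarith
    then show ?thesis using True step[of 0] long \<Delta>_nonneg by simp
  next
    case False
    have "dist (y 0) (y (Suc j)) = dist (y 0) (y j) + dist (y j) (y (Suc j)) - 2 * gromov_product (y j) (y 0) (y (Suc j))"
      by (simp add: gromov_product_def dist_commute field_simps)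
    then show ?thesis
      using broken_geodesic_last[of 0 j] False Suc step[of j] long \<Delta>_nonneg by simp
  qed
qed simp

text \<open>The same argument from the far end, by induction on \<open>n - j\<close>, with the near
  side supplied by \<open>broken_geodesic_last\<close>. It loses a second \<open>\<Delta>\<close>,
  hence the margin \<open>4 * \<Delta>\<close> in \<open>L\<close>.\<close>

lemma broken_geodesic_gromov_product:
  "i < j \<Longrightarrow> j < n \<Longrightarrow> gromov_product (y j) (y i) (y n) \<le> a + 2 * \<Delta>"
proof (induction "n - j" arbitrary: i j rule: less_induct)
  case less
  show ?case
  proof (cases "n = Suc j")
    case True
    then show ?thesis using broken_geodesic_last[of i j] less \<Delta>_nonneg by simp
  next
    case False
    then have IH: "gromov_product (y (Suc j)) (y j) (y n) \<le> a + 2 * \<Delta>"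
      using less.prems by (intro less.hyps) auto
    have "gromov_product (y j) (y n) (y (Suc j)) = dist (y j) (y (Suc j)) - gromov_product (y (Suc j)) (y j) (y n)"
      by (simp add: gromov_product_def dist_commute field_simps)
    then have "a + 2 * \<Delta> < gromov_product (y j) (y n) (y (Suc j))"
      using IH step[of j] long by linarith
    then show ?thesis
      using four_point[of "y j" "y i" "y n" "y (Suc j)"] broken_geodesic_last[OF less.prems(1)] by linarith
  qed
qed

end

end

section \<open>Subadditive sequences\<close>

text \<open>Fekete's lemma. Taking \<open>b\<close> as an infimum gives the linear lower bound for
  every \<open>n\<close>.\<close>

lemma subadditive_rate:
  fixes u :: "nat \<Rightarrow> real"
  assumes sub: "\<And>m n. u (m + n) \<le> u m + u n" and pos: "\<And>n. 0 \<le> u n" and u0: "u 0 = 0"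
  obtains b where "(\<lambda>n. u n / real n) \<longlonglongrightarrow> b" "\<forall>n. b * real n \<le> u n" "0 \<le> b"
proof -
  define b where "b = (INF n\<in>{1..}. u n / real n)"
  have bdd: "bdd_below ((\<lambda>n. u n / real n) ` {1..})"
    using pos by (intro bdd_belowI2[of _ 0]) simp
  have lower: "b \<le> u n / real n" if "n \<ge> 1" for n
    unfolding b_def using that by (intro cINF_lower[OF bdd]) simp
  have b0: "0 \<le> b" unfolding b_def using pos by (intro cINF_greatest) auto
  have linear: "u n \<le> real n * u 1" for n
  proof (induction n)
    case (Suc n)
    then show ?case using sub[of n 1] by (simp add: algebra_simps)
  qed (simp add: u0)
  have mult: "u (q * m) \<le> real q * u m" for q m
  proof (induction q)
    case (Suc q)
    then show ?case using sub[of m "q * m"] by (simp add: algebra_simps)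
  qed (simp add: u0)
  have "(\<lambda>n. u n / real n) \<longlonglongrightarrow> b"
  proof (rule order_tendstoI)
    fix c assume c: "c < b"
    show "\<forall>\<^sub>F n in sequentially. c < u n / real n"
      using eventually_ge_at_top[of 1] by eventually_elim (use lower c in force)
  next
    fix c assume c: "b < c"
    define e where "e = (c - b) / 2"
    have e: "e > 0" "b + e < c" using c by (simp_all add: e_def field_simps)
    obtain m where m: "m \<ge> 1" "u m / real m < b + e"
      using cINF_less_iff[OF _ bdd, of "b + e"] e(1) unfolding b_def by auto
    have "(\<lambda>n. real m * u 1 / real n) \<longlonglongrightarrow> 0"
      by (rule lim_const_over_n)
    then have "\<forall>\<^sub>F n in sequentially. real m * u 1 / real n < c - (b + e)"
      using order_tendstoD(2)[of "\<lambda>n. real m * u 1 / real n" 0 sequentially "c - (b + e)"] e(2) by simp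
    then show "\<forall>\<^sub>F n in sequentially. u n / real n < c"
      using eventually_ge_at_top[of 1]
    proof eventually_elim
      case (elim n)
      have "u n \<le> u (n div m * m) + u (n mod m)" using sub[of "n div m * m" "n mod m"] by simp
      also have "\<dots> \<le> real (n div m) * u m + real (n mod m) * u 1"
        using mult[of "n div m" m] linear[of "n mod m"] by simp
      also have "\<dots> \<le> (real n / real m) * u m + real m * u 1"
      proof (rule add_mono; rule mult_right_mono)
        show "real (n div m) \<le> real n / real m" by (rule of_nat_div_le_of_nat)
        show "real (n mod m) \<le> real m" using m(1) by (simp add: less_imp_le)
      qed (use pos in simp_all)
      finally have "u n / real n \<le> ((real n / real m) * u m + real m * u 1) / real n"
        by (rule divide_right_mono) simp
      also have "\<dots> = u m / real m + real m * u 1 / real n"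
        using elim(2) m(1) by (simp add: field_simps)
      also have "\<dots> < c" using m(2) elim(1) by linarith
      finally show ?case .
    qed
  qed
  moreover have "b * real n \<le> u n" for n
    using lower[of n] u0 by (cases "n = 0") (auto simp: field_simps)
  ultimately show thesis using that b0 by blast
qed

section \<open>Backward orbits with bounded step\<close>

locale backward_orbit_bounded_step = proper_hyperbolic "x 0" \<Delta>
  for x :: "nat \<Rightarrow> 'a::heine_borel" and \<Delta> :: real +
  fixes f :: "'a \<Rightarrow> 'a" and S :: real
  assumes nonexp: "non_expanding f"
    and backward: "f (x (Suc n)) = x n"
    and step: "dist (x n) (x (Suc n)) \<le> S"
begin

abbreviation D :: "nat \<Rightarrow> real" where "D n \<equiv> dist (x 0) (x n)"
abbreviation \<sigma> :: "nat \<Rightarrow> real" where "\<sigma> m \<equiv> backward_step m x"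
abbreviation b :: real where "b \<equiv> backward_step_rate x"

lemma S_nonneg: "0 \<le> S"
  using step[of 0] zero_le_dist[of "x 0" "x (Suc 0)"] by linarith

lemma funpow_backward: "(f ^^ m) (x (n + m)) = x n"
  by (induction m) (simp_all add: funpow_swap1 backward)

lemma dist_mono: "dist (x n) (x m) \<le> dist (x (n + k)) (x (m + k))"
  using non_expanding_funpow[OF nonexp, of k "x (n + k)" "x (m + k)"] by (simp add: funpow_backward)

lemma dist_le_steps: "dist (x n) (x (n + m)) \<le> real m * S"
proof (induction m)
  case (Suc m)
  then show ?case
    using dist_triangle[of "x n" "x (n + Suc m)" "x (n + m)"] step[of "n + m"] by (simp add: algebra_simps)
qed simp

lemma dist_le_steps': "dist (x n) (x m) \<le> \<bar>real n - real m\<bar> * S"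
proof (cases "n \<le> m")
  case True
  then show ?thesis using dist_le_steps[of n "m - n"] by (simp add: of_nat_diff)
next
  case False
  then show ?thesis using dist_le_steps[of m "n - m"] by (simp add: of_nat_diff dist_commute)
qed

lemma backward_step_tendsto: "(\<lambda>n. dist (x n) (x (n + m))) \<longlonglongrightarrow> \<sigma> m"
proof -
  have "incseq (\<lambda>n. dist (x n) (x (n + m)))"
    by (rule incseq_SucI) (use dist_mono[of _ _ 1] in simp)
  then have "convergent (\<lambda>n. dist (x n) (x (n + m)))"
    using dist_le_steps[of _ m] by (intro Bseq_mono_convergent BseqI'[of _ "real m * S"]) (simp_all add: incseq_def)
  then show ?thesis unfolding backward_step_def by (simp add: convergent_LIMSEQ_iff)
qed

lemma dist_le_backward_step: "dist (x n) (x (n + m)) \<le> \<sigma> m"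
proof (rule incseq_le[OF _ backward_step_tendsto])
  show "incseq (\<lambda>n. dist (x n) (x (n + m)))"
    by (rule incseq_SucI) (use dist_mono[of _ _ 1] in simp)
qed

lemma D_le_backward_step: "D m \<le> \<sigma> m"
  using dist_le_backward_step[of 0 m] by simp

lemma backward_step_0: "\<sigma> 0 = 0"
  using LIMSEQ_unique[OF backward_step_tendsto[of 0]] by simp

lemma backward_step_nonneg: "0 \<le> \<sigma> m"
  by (rule order_trans[OF zero_le_dist dist_le_backward_step])

lemma backward_step_add: "\<sigma> (m + k) \<le> \<sigma> m + \<sigma> k"
proof (rule LIMSEQ_le_const2[OF backward_step_tendsto])
  have "dist (x n) (x (n + (m + k))) \<le> \<sigma> m + \<sigma> k" for n
    using dist_triangle[of "x n" "x (n + (m + k))" "x (n + m)"] dist_le_backward_step[of n m]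
      dist_le_backward_step[of "n + m" k] by (simp add: add.assoc)
  then show "\<exists>N. \<forall>n\<ge>N. dist (x n) (x (n + (m + k))) \<le> \<sigma> m + \<sigma> k" by blast
qed

lemma backward_step_rate:
  shows backward_step_rate_tendsto: "(\<lambda>n. \<sigma> n / real n) \<longlonglongrightarrow> b"
    and backward_step_rate_le: "b * real n \<le> \<sigma> n"
    and backward_step_rate_nonneg: "0 \<le> b"
proof -
  obtain c where c: "(\<lambda>n. \<sigma> n / real n) \<longlonglongrightarrow> c" "\<forall>n. c * real n \<le> \<sigma> n" "0 \<le> c"
    using subadditive_rate[of \<sigma>, OF backward_step_add backward_step_nonneg backward_step_0] .
  have "b = c" unfolding backward_step_rate_def using c(1) by (rule limI)
  with c show "(\<lambda>n. \<sigma> n / real n) \<longlonglongrightarrow> b" "b * real n \<le> \<sigma> n" "0 \<le> b" by simp_all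
qed

text \<open>As \<open>f ^^ n\<close> maps \<open>x (N + n)\<close> to \<open>x N\<close>, the orbit
  bounds the dilation. For the geodesic limit, \<open>f\<close> raises the Busemann function of a
  ray in \<open>\<eta>\<close> by a bounded amount, and in a geodesic region this function is at
  most a constant minus the distance to \<open>x 0\<close>.\<close>

lemma brfp_and_log_dilation:
  assumes \<eta>: "\<eta> \<in> gromov_boundary" and conv: "converges_to_boundary x \<eta>"
  shows log_dilation_le: "log_dilation (f ^^ n) \<eta> p \<le> ereal (\<sigma> n)"
    and brfp_limit: "brfp f \<eta>"
proof -
  have far: "\<exists>N. \<forall>m\<ge>N. M < rp (x m) \<gamma>" if "\<gamma> \<in> \<eta>" for \<gamma> M
    using conv unfolding converges_to_boundary_iff[OF \<eta> that] eventually_sequentially by blast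
  show le: "log_dilation (f ^^ n) \<eta> p \<le> ereal (\<sigma> n)" for n p
  proof (rule ccontr)
    assume "\<not> ?thesis"
    then have "ereal (\<sigma> n) < log_dilation (f ^^ n) \<eta> p" by simp
    from less_LiminfD[OF this[unfolded log_dilation_def]]
    have ev: "\<forall>\<^sub>F z in filtercomap Inl (nhdsin gromov_topology (Inr \<eta>)). \<sigma> n < dist z p - dist ((f ^^ n) z) p"
      by simp
    obtain \<gamma> where \<gamma>: "\<gamma> \<in> \<eta>" using gromov_boundary_nonempty[OF \<eta>] .
    obtain M where M: "\<forall>z. M < rp z \<gamma> \<longrightarrow> \<sigma> n < dist z p - dist ((f ^^ n) z) p"
      using ev unfolding eventually_near_boundary[OF \<eta> \<gamma>] by blast
    obtain N where N: "\<forall>m\<ge>N. M < rp (x m) \<gamma>" using far[OF \<gamma>] by blast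
    have "\<sigma> n < dist (x (N + n)) p - dist (x N) p"
      using M[rule_format, of "x (N + n)"] N by (simp add: funpow_backward)
    then show False
      using dist_triangle[of "x (N + n)" p "x N"] dist_le_backward_step[of N n] by (simp add: dist_commute)
  qed
  have "has_geodesic_limit f (Inr \<eta>) \<eta>"
    unfolding has_geodesic_limit_def
  proof (intro ballI allI impI, elim conjE)
    fix \<gamma> :: "real \<Rightarrow> 'a" and R :: real and z :: "nat \<Rightarrow> 'a"
    assume \<gamma>: "\<gamma> \<in> \<eta>" and R: "0 < R" and reg: "\<forall>n. z n \<in> geodesic_region \<gamma> R" and zc: "converges_to_boundary z \<eta>"
    note ray = gromov_boundary_ray(1)[OF \<eta> \<gamma>]
    \<comment> \<open>Read both Busemann values off far orbit points: \<open>f w\<close> is no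
      farther from \<open>x N\<close> than \<open>w\<close> is from \<open>x (Suc N)\<close>, and
      the distances of these two points to \<open>x 0\<close> differ by at most \<open>S\<close>.
      Each reading costs \<open>2 * \<Delta>\<close>.\<close>
    have push: "busemann \<gamma> (f w) \<le> busemann \<gamma> w + S + 4 * \<Delta>" for w
    proof -
      obtain N where N: "\<forall>m\<ge>N. max (dist (f w) (x 0)) (dist w (x 0)) < rp (x m) \<gamma>" using far[OF \<gamma>] by blast
      have "\<bar>(dist (f w) (x N) - D N) - (busemann \<gamma> (f w) - busemann \<gamma> (x 0))\<bar> \<le> 2 * \<Delta>"
        using N by (intro busemann_near_end[OF ray]) (simp add: less_imp_le)
      moreover have "\<bar>(dist w (x (Suc N)) - D (Suc N)) - (busemann \<gamma> w - busemann \<gamma> (x 0))\<bar> \<le> 2 * \<Delta>"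
        using N[rule_format, of "Suc N"] by (intro busemann_near_end[OF ray]) (simp add: less_imp_le)
      moreover have "dist (f w) (x N) \<le> dist w (x (Suc N))"
        using nonexp backward[of N] unfolding non_expanding_def by metis
      moreover have "D (Suc N) \<le> D N + S" using dist_triangle[of "x 0" "x (Suc N)" "x N"] step[of N] by linarith
      ultimately show ?thesis by linarith
    qed
    define K where "K = (2 * R + dist (\<gamma> 0) (x 0) + S + 4 * \<Delta> - busemann \<gamma> (x 0)) / 2"
    have est: "rp w \<gamma> / 2 - K \<le> rp (f w) \<gamma>" if w: "w \<in> geodesic_region \<gamma> R" for w
    proof -
      have "infdist w (\<gamma> ` {0..}) < R" using w by (simp add: geodesic_region_def)
      then obtain t where t: "t \<ge> 0" "dist w (\<gamma> t) < R"
        unfolding infdist_def by (auto simp: cINF_less_iff split: if_splits)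
      have "busemann \<gamma> w \<le> R - t" using busemann_le[OF ray t(1), of w] t(2) by (simp add: dist_commute)
      moreover have "dist w (x 0) \<le> R + (t + dist (\<gamma> 0) (x 0))"
        using dist_triangle[of w "x 0" "\<gamma> t"] dist_triangle[of "\<gamma> t" "x 0" "\<gamma> 0"] geodesic_rayD[OF ray t(1), of 0] t by simp
      ultimately have "busemann \<gamma> (f w) \<le> 2 * R + dist (\<gamma> 0) (x 0) + S + 4 * \<Delta> - rp w \<gamma>"
        using push[of w] ray_product_le_dist[OF ray, of "x 0" w] by linarith
      then show ?thesis
        using ray_product_ge_busemann[of \<gamma> "x 0" "f w"] unfolding K_def by (simp add: field_simps)
    qed
    show "limitin gromov_topology (\<lambda>n. Inl (f (z n))) (Inr \<eta>) sequentially"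
      unfolding converges_to_boundary_iff[OF \<eta> \<gamma>]
    proof
      fix M
      show "\<forall>\<^sub>F n in sequentially. M < rp (f (z n)) \<gamma>"
        using zc[unfolded converges_to_boundary_iff[OF \<eta> \<gamma>], rule_format, of "2 * (M + K)"]
      proof eventually_elim
        case (elim n)
        then show ?case using est[OF reg[rule_format, of n]] by (simp add: field_simps)
      qed
    qed
  qed
  moreover have "log_dilation f \<eta> p < \<infinity>" for p
    using le[of 1 p] by (auto intro: le_less_trans)
  ultimately show "brfp f \<eta>" using \<eta> by (simp add: brfp_def)
qed

text \<open>A sandwich after division by \<open>n\<close>. The parameter \<open>L\<close> is
  \<open>b * n\<close> for positive rate and \<open>- \<sigma> n\<close> for rate zero;
  \<open>C\<close> may depend on \<open>p\<close> but not on \<open>n\<close>.\<close>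

lemma stable_dilation_eq:
  assumes \<eta>: "\<eta> \<in> gromov_boundary" and conv: "converges_to_boundary x \<eta>"
    and L: "(\<lambda>n. L n / real n) \<longlonglongrightarrow> b"
    and lower: "\<And>p. \<exists>C. \<forall>n. ereal (L n - C) \<le> log_dilation (f ^^ n) \<eta> p"
  shows "stable_dilation f \<eta> = exp b"
proof -
  have lim: "(\<lambda>n. log_dilation (f ^^ n) \<eta> p / ereal (real n)) \<longlonglongrightarrow> ereal b" for p
  proof -
    obtain C where C: "\<forall>n. ereal (L n - C) \<le> log_dilation (f ^^ n) \<eta> p" using lower by blast
    have "(\<lambda>n. L n / real n - C / real n) \<longlonglongrightarrow> b - 0"
      by (intro tendsto_diff L lim_const_over_n)
    then have low: "(\<lambda>n. ereal ((L n - C) / real n)) \<longlonglongrightarrow> ereal b"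
      by (simp add: diff_divide_distrib)
    have upp: "(\<lambda>n. ereal (\<sigma> n / real n)) \<longlonglongrightarrow> ereal b"
      using backward_step_rate_tendsto by simp
    show ?thesis
    proof (rule tendsto_sandwich[OF _ _ low upp])
      show "\<forall>\<^sub>F n in sequentially. ereal ((L n - C) / real n) \<le> log_dilation (f ^^ n) \<eta> p / ereal (real n)"
        using eventually_ge_at_top[of 1]
      proof eventually_elim
        case (elim n)
        then show ?case
          using ereal_divide_right_mono[OF C[rule_format, of n], of "ereal (real n)"] by simp
      qed
      show "\<forall>\<^sub>F n in sequentially. log_dilation (f ^^ n) \<eta> p / ereal (real n) \<le> ereal (\<sigma> n / real n)"
        using eventually_ge_at_top[of 1]
      proof eventually_elim
        case (elim n)
        then show ?case
          using ereal_divide_right_mono[OF log_dilation_le[OF \<eta> conv, of n p], of "ereal (real n)"] by simp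
      qed
    qed
  qed
  have "(THE l. \<forall>p. (\<lambda>n. log_dilation (f ^^ n) \<eta> p / ereal (real n)) \<longlonglongrightarrow> ereal l) = b"
  proof (rule the_equality)
    fix l assume "\<forall>p. (\<lambda>n. log_dilation (f ^^ n) \<eta> p / ereal (real n)) \<longlonglongrightarrow> ereal l"
    then show "l = b" using LIMSEQ_unique[OF _ lim[of "x 0"]] by auto
  qed (use lim in blast)
  then show ?thesis by (simp add: stable_dilation_def)
qed

subsection \<open>Positive rate\<close>

text \<open>For large \<open>M\<close> the points \<open>x (N + j * M)\<close> form a broken geodesic: the segments have length about
  \<open>\<sigma> M\<close>, while the Gromov products at the breaks are about \<open>\<sigma> M - \<sigma> (2 * M) / 2\<close>, which is small
  compared with \<open>b * M\<close>.\<close>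

lemma positive_rate_broken_geodesic:
  assumes b: "b > 0"
  obtains N M a where "M \<ge> 1"
    "\<forall>i. gromov_product (x (N + Suc i * M)) (x (N + i * M)) (x (N + Suc (Suc i) * M)) \<le> a"
    "\<forall>i. 2 * a + 4 * \<Delta> + 1 \<le> dist (x (N + i * M)) (x (N + Suc i * M))"
proof -
  have "\<forall>\<^sub>F m in sequentially. \<sigma> m / real m < b + b / 8"
    using order_tendstoD(2)[OF backward_step_rate_tendsto, of "b + b / 8"] b by simp
  \<comment> \<open>From \<open>\<sigma> M < 9/8 * b * M\<close> and
    \<open>\<sigma> (2 * M) \<ge> 2 * b * M\<close> one gets
    \<open>2 * a \<le> b * M / 4 + 1\<close>. The goal
    \<open>2 * a + 4 * \<Delta> + 1 \<le> b * M - 1\<close> then amounts to this bound on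
    \<open>M\<close>.\<close>
  moreover have "\<forall>\<^sub>F m in sequentially. (4 * \<Delta> + 3) * 4 / (3 * b) \<le> real m"
    using filterlim_real_sequentially by (simp add: filterlim_at_top)
  ultimately have "\<forall>\<^sub>F m in sequentially. \<sigma> m / real m < b + b / 8 \<and> (4 * \<Delta> + 3) * 4 / (3 * b) \<le> real m \<and> 1 \<le> m"
    using eventually_ge_at_top[of 1] by eventually_elim simp
  then obtain M where M: "\<sigma> M / real M < b + b / 8" "(4 * \<Delta> + 3) * 4 / (3 * b) \<le> real M" "1 \<le> M"
    using eventually_happens[of _ sequentially] by fastforce
  have M1: "\<sigma> M < b * real M + b * real M / 8" using M(1,3) by (simp add: field_simps)
  have M2: "16 * \<Delta> + 12 \<le> 3 * (b * real M)" using M(2) b by (simp add: field_simps)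
  have "\<forall>\<^sub>F n in sequentially. \<sigma> M - 1 < dist (x n) (x (n + M)) \<and> \<sigma> (2 * M) - 1 < dist (x n) (x (n + 2 * M))"
    by (intro eventually_conj order_tendstoD(1)[OF backward_step_tendsto]) simp_all
  then obtain N where N: "\<forall>n\<ge>N. \<sigma> M - 1 < dist (x n) (x (n + M)) \<and> \<sigma> (2 * M) - 1 < dist (x n) (x (n + 2 * M))"
    unfolding eventually_sequentially by blast
  \<comment> \<open>The two short distances are at most \<open>\<sigma> M\<close> and the long one
    exceeds \<open>\<sigma> (2 * M) - 1\<close>; \<open>a\<close> is half the excess.\<close>
  define a where "a = (2 * \<sigma> M - \<sigma> (2 * M) + 1) / 2"
  have a: "8 * a \<le> b * real M + 4"
    using M1 backward_step_rate_le[of "2 * M"] by (simp add: a_def)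
  have "gromov_product (x (N + Suc i * M)) (x (N + i * M)) (x (N + Suc (Suc i) * M)) \<le> a \<and>
      2 * a + 4 * \<Delta> + 1 \<le> dist (x (N + i * M)) (x (N + Suc i * M))" for i
  proof
    have i: "x (N + Suc i * M) = x (N + i * M + M)" "x (N + Suc (Suc i) * M) = x (N + i * M + 2 * M)"
      "x (N + Suc (Suc i) * M) = x (N + i * M + M + M)"
      by (simp_all add: algebra_simps mult_2_right)
    have d: "dist (x (N + i * M)) (x (N + i * M + M)) \<le> \<sigma> M"
      "dist (x (N + i * M + M)) (x (N + i * M + M + M)) \<le> \<sigma> M"
      by (rule dist_le_backward_step)+
    have "\<sigma> (2 * M) - 1 < dist (x (N + i * M)) (x (N + i * M + 2 * M))" using N by simp
    then show "gromov_product (x (N + Suc i * M)) (x (N + i * M)) (x (N + Suc (Suc i) * M)) \<le> a"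
      using d i unfolding a_def gromov_product_def by (simp add: dist_commute)
    have "\<sigma> M - 1 < dist (x (N + i * M)) (x (N + Suc i * M))" using N unfolding i(1) by simp
    moreover have "b * real M \<le> \<sigma> M" by (rule backward_step_rate_le)
    ultimately show "2 * a + 4 * \<Delta> + 1 \<le> dist (x (N + i * M)) (x (N + Suc i * M))"
      using a M2 by linarith
  qed
  then show thesis using M(3) that by blast
qed

text \<open>Beyond \<open>N\<close> every index is less than \<open>M\<close> past a break, so the
  bounds at the breaks pass to the whole orbit at the cost of multiples of
  \<open>M * S\<close>.\<close>

lemma positive_rate_estimates:
  assumes b: "b > 0"
  obtains \<alpha> \<beta> C where "\<alpha> > 0" "\<beta> \<ge> 0" "\<forall>n. \<alpha> * real n - \<beta> \<le> D n"
    "\<forall>k m. k \<le> m \<longrightarrow> gromov_product (x k) (x 0) (x m) \<le> C"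
proof -
  obtain N M a where M: "M \<ge> 1"
    and turn: "\<forall>i. gromov_product (x (N + Suc i * M)) (x (N + i * M)) (x (N + Suc (Suc i) * M)) \<le> a"
    and long: "\<forall>i. 2 * a + 4 * \<Delta> + 1 \<le> dist (x (N + i * M)) (x (N + Suc i * M))"
    using positive_rate_broken_geodesic[OF b] .
  define y where "y j = x (N + j * M)" for j
  have y: "gromov_product (y (Suc i)) (y i) (y (Suc (Suc i))) \<le> a" "2 * a + 4 * \<Delta> + 1 \<le> dist (y i) (y (Suc i))" for i
    using turn long by (simp_all only: y_def)
  note progress = broken_geodesic_progress[of y a, OF y order_refl]
    and product = broken_geodesic_gromov_product[of y a, OF y order_refl]
  define j where "j n = (n - N) div M" for n
  have near: "dist (x n) (y (j n)) \<le> real M * S" if "n \<ge> N" for n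
  proof -
    have "n = N + j n * M + (n - N) mod M" using that by (simp add: j_def)
    then have "dist (y (j n)) (x n) \<le> real ((n - N) mod M) * S"
      using dist_le_steps[of "N + j n * M" "(n - N) mod M"] by (simp add: y_def)
    also have "\<dots> \<le> real M * S"
      using M S_nonneg by (intro mult_right_mono) (simp_all add: less_imp_le)
    finally show ?thesis by (simp add: dist_commute)
  qed
  define \<beta> where "\<beta> = real N + 1 + D N + real M * S"
  have MS: "0 \<le> real M * S" using S_nonneg by simp
  have lower: "1 / real M * real n - \<beta> \<le> D n" for n
  proof (cases "n \<ge> N")
    case True
    have "real (n - N) \<le> real (j n + 1) * real M"
    proof -
      have "n - N < (j n + 1) * M"
        using dividend_less_div_times[of M "n - N"] M by (simp add: j_def)
      then show ?thesis by (metis less_imp_le of_nat_le_iff of_nat_mult)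
    qed
    then have "real n \<le> (real (j n) + 1) * real M + real N" using True by (simp add: of_nat_diff algebra_simps)
    also have "\<dots> \<le> (real (j n) + 1) * real M + real N * real M"
      using mult_left_mono[of 1 "real M" "real N"] M by simp
    finally have "real n / real M \<le> real (j n) + 1 + real N" using M by (simp add: field_simps)
    moreover have "real (j n) \<le> dist (y 0) (y (j n))" by (rule progress)
    moreover have "dist (y 0) (y (j n)) \<le> D N + D n + real M * S"
      using near[OF True] dist_triangle[of "y 0" "y (j n)" "x n"] dist_triangle3[of "y 0" "x n" "x 0"]
      by (simp add: y_def)
    ultimately show ?thesis by (simp add: \<beta>_def)
  next
    case False
    then have "real n / real M \<le> real N / 1" using M by (intro frac_le) auto
    moreover have "1 / real M * real n = real n / real M" by simp
    ultimately show ?thesis using zero_le_dist[of "x 0" "x n"] zero_le_dist[of "x 0" "x N"] MS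
      unfolding \<beta>_def by linarith
  qed
  define C where "C = \<bar>a\<bar> + 2 * \<Delta> + D N + 2 * (real M * S) + real (N + M) * S"
  have upper: "gromov_product (x k) (x 0) (x m) \<le> C" if km: "k \<le> m" for k m
  proof -
    have NS: "0 \<le> real (N + M) * S" using S_nonneg by simp
    \<comment> \<open>The bound at the breaks requires \<open>0 < j k\<close> and
      \<open>j k < j m\<close>. For early \<open>k\<close> the product is at most
      \<open>D k\<close>; behind a common break it is at most the distance of the two
      points.\<close>
    consider (1) "k < N + M" | (2) "k \<ge> N + M" "j m = j k" | (3) "k \<ge> N + M" "j k < j m"
      using div_le_mono[of "k - N" "m - N" M] km unfolding j_def by (metis diff_le_mono le_neq_implies_less not_less)
    then show ?thesis
    proof cases
      case 1
      have "gromov_product (x k) (x 0) (x m) \<le> dist (x 0) (x k)" by (rule gromov_product_le_dist)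
      also have "\<dots> \<le> real k * S" using dist_le_steps[of 0 k] by simp
      also have "\<dots> \<le> real (N + M) * S" using 1 S_nonneg by (intro mult_right_mono) simp_all
      finally show ?thesis using MS \<Delta>_nonneg zero_le_dist[of "x 0" "x N"] unfolding C_def by linarith
    next
      case 2
      have "gromov_product (x k) (x 0) (x m) \<le> dist (x m) (x k)" by (rule gromov_product_le_dist)
      also have "\<dots> \<le> dist (x m) (y (j m)) + dist (x k) (y (j k))"
        unfolding 2(2) by (rule dist_triangle2)
      also have "\<dots> \<le> 2 * (real M * S)" using near[of m] near[of k] 2(1) km by simp
      finally show ?thesis using NS \<Delta>_nonneg zero_le_dist[of "x 0" "x N"] unfolding C_def by linarith
    next
      case 3
      have "0 < j k" using 3(1) M unfolding j_def by (simp add: div_greater_zero_iff)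
      have "gromov_product (x k) (x 0) (x m) \<le> gromov_product (y (j k)) (x 0) (x m) + dist (x k) (y (j k))"
        using gromov_product_base_diff[of "x k" "x 0" "x m" "y (j k)"] by simp
      moreover have "gromov_product (y (j k)) (x 0) (x m) \<le> gromov_product (y (j k)) (y 0) (x m) + D N"
        using gromov_product_diff[of "y (j k)" "x 0" "x m" "y 0"] by (simp add: y_def)
      moreover have "gromov_product (y (j k)) (y 0) (x m) \<le> gromov_product (y (j k)) (y 0) (y (j m)) + dist (x m) (y (j m))"
        using gromov_product_diff'[of "y (j k)" "y 0" "x m" "y (j m)"] by simp
      moreover have "gromov_product (y (j k)) (y 0) (y (j m)) \<le> a + 2 * \<Delta>"
        by (rule product[OF \<open>0 < j k\<close> 3(2)])
      ultimately show ?thesis using near[of m] near[of k] 3(1) km NS unfolding C_def by linarith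
    qed
  qed
  show thesis
    by (rule that[of "1 / real M" \<beta> C]) (use M MS lower upper in \<open>auto simp: \<beta>_def\<close>)
qed

text \<open>The product of \<open>x k\<close> and \<open>x m\<close> at \<open>x 0\<close> is
  \<open>D k\<close> minus that of \<open>x 0\<close> and \<open>x m\<close> at \<open>x k\<close>.
  The bound \<open>C\<close> on the latter gives convergence and places every \<open>x k\<close>
  near a ray.\<close>

lemma positive_rate:
  assumes b: "b > 0"
  obtains \<eta> where "\<eta> \<in> gromov_boundary" "converges_to_boundary x \<eta>" "stable_dilation f \<eta> = exp b"
    "discrete_quasi_geodesic_ray x" "\<exists>\<gamma>\<in>\<eta>. \<exists>R>0. \<forall>n. x n \<in> geodesic_region \<gamma> R"
proof -
  obtain \<alpha> \<beta> C where \<alpha>: "\<alpha> > 0" "\<beta> \<ge> 0" "\<forall>n. \<alpha> * real n - \<beta> \<le> D n"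
    and C: "\<forall>k m. k \<le> m \<longrightarrow> gromov_product (x k) (x 0) (x m) \<le> C"
    using positive_rate_estimates[OF b] .
  have gp_ge: "D k - C \<le> gp (x k) (x m)" if "k \<le> m" for k m
  proof -
    have "gp (x k) (x m) = D k - gromov_product (x k) (x 0) (x m)"
      by (simp add: gromov_product_def dist_commute field_simps)
    then show ?thesis using C[rule_format, OF that] by linarith
  qed
  have far: "\<exists>N. \<forall>n\<ge>N. M \<le> D n" for M
  proof -
    obtain N where N: "real N > (M + \<beta>) / \<alpha>" using reals_Archimedean2 by blast
    have "M \<le> D n" if "n \<ge> N" for n
    proof -
      have "(M + \<beta>) / \<alpha> < real n" using N that by simp
      then have "M + \<beta> < \<alpha> * real n" using \<alpha>(1) by (simp add: field_simps)
      then show ?thesis using \<alpha>(3)[rule_format, of n] by linarith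
    qed
    then show ?thesis by blast
  qed
  have gfar: "\<exists>N. \<forall>m\<ge>N. \<forall>n\<ge>N. M \<le> gp (x m) (x n)" for M
  proof -
    obtain N where N: "\<forall>n\<ge>N. M + C \<le> D n" using far by blast
    have "M \<le> gp (x m) (x n)" if "m \<ge> N" "n \<ge> N" for m n
    proof (cases "m \<le> n")
      case True
      then show ?thesis using gp_ge[of m n] N that by force
    next
      case False
      then show ?thesis using gp_ge[of n m] N that by (force simp: gromov_product_commute)
    qed
    then show ?thesis by blast
  qed
  obtain \<gamma> where \<gamma>: "geodesic_ray \<gamma>" "\<gamma> 0 = x 0" "converges_to_boundary x (ray_class \<gamma>)"
    using gromov_sequence_converges[OF gfar] .
  define \<eta> where "\<eta> = ray_class \<gamma>"
  have \<eta>: "\<eta> \<in> gromov_boundary" "\<gamma> \<in> \<eta>"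
    unfolding \<eta>_def by (rule ray_class_in_boundary[OF \<gamma>(1)], rule self_in_ray_class[OF \<gamma>(1)])
  have conv: "converges_to_boundary x \<eta>" using \<gamma>(3) by (simp add: \<eta>_def)
  have rp_far: "\<exists>N. \<forall>m\<ge>N. M < rp (x m) \<gamma>" for M
    using conv unfolding converges_to_boundary_iff[OF \<eta>] eventually_sequentially by blast
  have C0: "0 \<le> C" using C[rule_format, of 0 0] by simp
  \<comment> \<open>Both points are at distance \<open>D k\<close> from \<open>x 0\<close>, and
    their product is at least \<open>D k - C - 2 * \<Delta>\<close>.\<close>
  have near: "dist (x k) (\<gamma> (D k)) \<le> 2 * C + 4 * \<Delta>" for k
  proof -
    obtain N where N: "\<forall>m\<ge>N. D k - C < rp (x m) \<gamma>" using rp_far by blast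
    have "D k - C \<le> gp (x k) (x (max k N))" by (rule gp_ge) simp
    then have "D k - C - \<Delta> \<le> rp (x k) \<gamma>"
      using ray_product_four_point[OF \<gamma>(1)] N by (meson less_imp_le max.cobounded2)
    moreover have "D k - C - \<Delta> \<le> rp (\<gamma> (D k)) \<gamma>"
      using ray_product_on_ray_base[OF \<gamma>(1) zero_le_dist \<gamma>(2), of "x 0" "x k"] C0 \<Delta>_nonneg by simp
    ultimately have "D k - C - \<Delta> - \<Delta> \<le> gp (x k) (\<gamma> (D k))"
      by (rule ray_product_four_point'[OF \<gamma>(1)])
    moreover have "dist (\<gamma> (D k)) (x 0) = D k"
      using geodesic_rayD[OF \<gamma>(1), of "D k" 0] \<gamma>(2) by simp
    ultimately show ?thesis by (simp add: gromov_product_def dist_commute)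
  qed
  have region: "x n \<in> geodesic_region \<gamma> (2 * C + 4 * \<Delta> + 1)" for n
  proof -
    have "infdist (x n) (\<gamma> ` {0..}) \<le> dist (x n) (\<gamma> (D n))" by (rule infdist_le) simp
    then show ?thesis using near[of n] by (simp add: geodesic_region_def)
  qed
  have quasi: "discrete_quasi_geodesic_ray x"
    unfolding discrete_quasi_geodesic_ray_def
  proof (intro exI conjI allI)
    let ?A = "max 1 (max S (1 / \<alpha>))"
    have A: "inverse ?A \<le> \<alpha>"
    proof -
      have "inverse ?A \<le> inverse (1 / \<alpha>)" using \<alpha>(1) by (intro le_imp_inverse_le) simp_all
      then show ?thesis using \<alpha>(1) by simp
    qed
    show "1 \<le> ?A" "0 \<le> \<beta>" using \<alpha>(2) by simp_all
    fix n m
    \<comment> \<open>Distances can only shrink when both indices are shifted down, so the growth of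
      \<open>D\<close> at the difference of indices suffices.\<close>
    have "\<alpha> * \<bar>real n - real m\<bar> - \<beta> \<le> dist (x n) (x m)"
    proof (cases "n \<le> m")
      case True
      then show ?thesis
        using \<alpha>(3)[rule_format, of "m - n"] dist_mono[of 0 "m - n" n] by (simp add: of_nat_diff)
    next
      case False
      then show ?thesis
        using \<alpha>(3)[rule_format, of "n - m"] dist_mono[of 0 "n - m" m] by (simp add: of_nat_diff dist_commute)
    qed
    moreover have "inverse ?A * \<bar>real n - real m\<bar> \<le> \<alpha> * \<bar>real n - real m\<bar>"
      using A by (rule mult_right_mono) simp
    ultimately show "inverse ?A * \<bar>real n - real m\<bar> - \<beta> \<le> dist (x n) (x m)" by linarith
    have "\<bar>real n - real m\<bar> * S \<le> \<bar>real n - real m\<bar> * ?A" by (rule mult_left_mono) simp_all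
    then show "dist (x n) (x m) \<le> ?A * \<bar>real n - real m\<bar> + \<beta>"
      using dist_le_steps'[of n m] \<alpha>(2) by (simp add: mult.commute)
  qed
  have "stable_dilation f \<eta> = exp b"
  proof (rule stable_dilation_eq[OF \<eta>(1) conv, of "\<lambda>n. b * real n"])
    show "(\<lambda>n. b * real n / real n) \<longlonglongrightarrow> b"
      by (rule tendsto_eventually) (use eventually_ge_at_top[of 1] in eventually_elim, simp)
    fix p
    \<comment> \<open>Here 1 is the deficit in the choice of \<open>k\<close>; \<open>2 * C\<close>
      is lost between \<open>D k\<close> and \<open>D m\<close>, and
      \<open>2 * C + 4 * \<Delta>\<close> between \<open>z\<close> and \<open>x m\<close>; the last
      term moves \<open>p\<close> to \<open>x 0\<close>.\<close>
    define E where "E = 1 + 4 * C + 4 * \<Delta> + 2 * dist p (x 0)"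
    have "ereal (b * real n - E) \<le> log_dilation (f ^^ n) \<eta> p" for n
      unfolding log_dilation_def
    proof (rule Liminf_bounded)
      obtain k where k: "\<sigma> n - 1 < dist (x k) (x (k + n))"
        using order_tendstoD(1)[OF backward_step_tendsto[of n], of "\<sigma> n - 1"] eventually_happens[of _ sequentially] by fastforce
      define m where "m = k + n"
      have Dm: "D k + (b * real n - 1) - 2 * C \<le> D m"
        using C[rule_format, of k m] k backward_step_rate_le[of n]
        by (simp add: m_def gromov_product_def dist_commute)
      show "\<forall>\<^sub>F z in filtercomap Inl (nhdsin gromov_topology (Inr \<eta>)). ereal (b * real n - E) \<le> ereal (dist z p - dist ((f ^^ n) z) p)"
        unfolding eventually_near_boundary[OF \<eta>]
      proof (intro exI allI impI)
        \<comment> \<open>Geodesics from \<open>x 0\<close> to such a point pass near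
          \<open>x m\<close>, which \<open>f ^^ n\<close> maps to \<open>x k\<close>; so the
          distance to \<open>x 0\<close> drops by \<open>D m - D k\<close> up to a constant.\<close>
        fix z assume z: "D m < rp z \<gamma>"
        obtain N where N: "\<forall>l\<ge>N. D m - C < rp (x l) \<gamma>" using rp_far by blast
        have "D m - C \<le> rp (x (max m N)) \<gamma>" using N[rule_format, of "max m N"] by simp
        then have "D m - C - \<Delta> \<le> rp (x m) \<gamma>"
          using ray_product_four_point[OF \<gamma>(1) gp_ge[of m "max m N"]] by simp
        then have "D m - C - \<Delta> - \<Delta> \<le> gp z (x m)"
          using z C0 \<Delta>_nonneg by (intro ray_product_four_point'[OF \<gamma>(1)]) auto
        then have 1: "dist z (x m) \<le> dist z (x 0) - D m + 2 * C + 4 * \<Delta>"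
          by (simp add: gromov_product_def dist_commute)
        have "dist ((f ^^ n) z) (x k) \<le> dist z (x m)"
          using non_expanding_funpow[OF nonexp, of n z "x m"] by (simp add: m_def funpow_backward)
        then have "dist ((f ^^ n) z) (x 0) \<le> dist z (x m) + D k"
          using dist_triangle2[of "(f ^^ n) z" "x 0" "x k"] by linarith
        then show "ereal (b * real n - E) \<le> ereal (dist z p - dist ((f ^^ n) z) p)"
          using 1 Dm dist_triangle[of "(f ^^ n) z" p "x 0"] dist_triangle[of z "x 0" p] \<Delta>_nonneg
          by (simp add: E_def dist_commute)
      qed
    qed
    then show "\<exists>C. \<forall>n. ereal (b * real n - C) \<le> log_dilation (f ^^ n) \<eta> p" by blast
  qed
  moreover have "\<exists>\<gamma>\<in>\<eta>. \<exists>R>0. \<forall>n. x n \<in> geodesic_region \<gamma> R"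
    using region C0 \<Delta>_nonneg \<eta>(2) by (intro bexI[of _ \<gamma>] exI[of _ "2 * C + 4 * \<Delta> + 1"]) auto
  ultimately show thesis using \<eta>(1) conv quasi by (intro that[of \<eta>])
qed

subsection \<open>Rate zero\<close>

lemma zero_rate_sublinear:
  assumes b: "b = 0" and k: "k \<ge> 1"
  obtains i where "\<sigma> (i * k) < real i"
proof -
  have "\<forall>\<^sub>F n in sequentially. \<sigma> n / real n < 1 / real k"
    using order_tendstoD(2)[OF backward_step_rate_tendsto, of "1 / real k"] b k by simp
  then obtain N where N: "\<forall>n\<ge>N. \<sigma> n / real n < 1 / real k" unfolding eventually_sequentially by blast
  define i where "i = N + 1"
  have "N \<le> i * k" using k by (cases k) (auto simp: i_def)
  then have "\<sigma> (i * k) / real (i * k) < 1 / real k" using N by blast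
  moreover have "0 < real i" "0 < real k" using k by (simp_all add: i_def)
  ultimately have "\<sigma> (i * k) < real i"
    by (simp add: field_simps)
  then show thesis by (rule that)
qed

text \<open>The bound \<open>J\<close> depends on \<open>k\<close> alone. Were there no pause in a
  window of length \<open>i * k\<close>, then \<open>i\<close> jumps by \<open>k\<close> would raise
  \<open>D\<close> by at least \<open>i\<close>, more than \<open>\<sigma> (i * k)\<close>
  allows.\<close>

lemma zero_rate_pause:
  assumes b: "b = 0"
  obtains J where "\<forall>m. \<exists>j\<le>J. D (m + j + k) \<le> D (m + j) + 1"
proof (cases "k = 0")
  case False
  then obtain i where ik: "\<sigma> (i * k) < real i"
    using zero_rate_sublinear[OF b, of k] by auto
  have "\<exists>j\<le>i * k. D (m + j + k) \<le> D (m + j) + 1" for m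
  proof (rule ccontr)
    assume "\<not> ?thesis"
    then have incr: "D (m + j) + 1 < D (m + j + k)" if "j \<le> i * k" for j
      using that by (meson not_le)
    have "D m + real l \<le> D (m + l * k)" if "l \<le> i" for l
      using that
    proof (induction l)
      case (Suc l)
      have "l * k \<le> i * k" using Suc.prems by simp
      from incr[OF this] Suc show ?case by (simp add: algebra_simps)
    qed simp
    from this[of i] have "D m + real i \<le> D (m + i * k)" by simp
    moreover have "D (m + i * k) \<le> D m + \<sigma> (i * k)"
      using dist_triangle[of "x 0" "x (m + i * k)" "x m"] dist_le_backward_step[of m "i * k"] by linarith
    ultimately show False using ik by linarith
  qed
  then show thesis using that by blast
qed (use that[of 0] in simp)

text \<open>A geodesic from \<open>x 0\<close> to \<open>x (n + N)\<close> crosses the sphere of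
  radius \<open>C + 1\<close>; \<open>f ^^ N\<close> brings the crossing point within
  \<open>C\<close> and does not stretch the rest. Thus \<open>N\<close> steps backward add at least
  1 to \<open>D\<close>, a linear growth that rate zero forbids.\<close>

lemma zero_rate_not_elliptic:
  assumes b: "b = 0" and nc: "\<not> compact (closure (range x))" and nw: "\<not> weakly_elliptic f"
  shows "\<not> elliptic f"
proof
  assume e: "elliptic f"
  then have "compact (limit_retract f)" using nw by (simp add: weakly_elliptic_def)
  then obtain C N where CN: "C \<ge> 0" "N \<ge> 1" "\<forall>z. dist (x 0) z \<le> C + 1 \<longrightarrow> dist (x 0) ((f ^^ N) z) \<le> C"
    using strongly_elliptic_absorbs[OF nonexp e, of "x 0"] by metis
  have grow: "D n + 1 \<le> D (n + N)" if n: "D n > C" for n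
  proof -
    have "D (n + N) > C + 1"
      using CN(3)[rule_format, of "x (n + N)"] n by (force simp: funpow_backward)
    then obtain z where z: "dist (x 0) z = C + 1" "dist z (x (n + N)) = D (n + N) - (C + 1)"
      using geodesic_space_point[OF geodesic, of "C + 1" "x 0" "x (n + N)"] CN(1) by auto
    have "dist ((f ^^ N) z) (x n) \<le> dist z (x (n + N))"
      using non_expanding_funpow[OF nonexp, of N z "x (n + N)"] by (simp add: funpow_backward)
    then show ?thesis
      using CN(3)[rule_format, of z] z dist_triangle[of "x 0" "x n" "(f ^^ N) z"] by linarith
  qed
  have "\<not> bounded (range x)" using nc compact_closure by blast
  then obtain n where n: "D n > C"
    unfolding bounded_any_center[of _ "x 0"] by (force simp: not_le)
  have lin: "D n + real j \<le> D (n + j * N)" for j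
  proof (induction j)
    case (Suc j)
    then have "D (n + j * N) > C" using n by simp
    from grow[OF this] Suc show ?case by (simp add: algebra_simps)
  qed simp
  obtain i where "\<sigma> (i * N) < real i" using zero_rate_sublinear[OF b CN(2)] .
  moreover have "D (n + i * N) \<le> D n + \<sigma> (i * N)"
    using dist_triangle[of "x 0" "x (n + i * N)" "x n"] dist_le_backward_step[of n "i * N"] by linarith
  ultimately show False using lin[of i] by linarith
qed

text \<open>If \<open>x (r n)\<close> converged to \<open>y\<close>, then \<open>f ^^ r n\<close>,
  which maps \<open>x (r n)\<close> to \<open>x 0\<close>, would bring \<open>y\<close> within 1 of
  \<open>x 0\<close> infinitely often; Calka's theorem would make \<open>f\<close> elliptic.\<close>

lemma zero_rate_escapes:
  assumes ne: "\<not> elliptic f"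
  shows "filterlim D at_top sequentially"
  unfolding filterlim_dist_iff
proof (intro allI, rule ccontr)
  fix R assume inf: "infinite {n. D n \<le> R}"
  obtain r y where r: "strict_mono r" "(\<lambda>n. x (r n)) \<longlonglongrightarrow> y"
    using bounded_infinite_subsequence[OF inf] .
  obtain N where N: "\<forall>n\<ge>N. dist (x (r n)) y < 1" using metric_LIMSEQ_D[OF r(2), of 1] by auto
  have "dist (x 0) ((f ^^ r n) y) \<le> 1" if "n \<ge> N" for n
    using non_expanding_funpow[OF nonexp, of "r n" "x (r n)" y] funpow_backward[of "r n" 0] N that by fastforce
  then have "r ` {N..} \<subseteq> {n. dist (x 0) ((f ^^ n) y) \<le> 1}" by auto
  moreover have "infinite (r ` {N..})"
    using finite_imageD[of r "{N..}"] strict_mono_imp_inj_on[OF r(1)] infinite_Ici inj_on_subset by blast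
  ultimately have "infinite {n. dist (x 0) ((f ^^ n) y) \<le> 1}" by (rule infinite_super)
  then show False using elliptic_if_recurrent[OF nonexp] ne by blast
qed

lemma zero_rate:
  assumes b: "b = 0" and nc: "\<not> compact (closure (range x))" and nw: "\<not> weakly_elliptic f"
  obtains \<eta> where "\<eta> \<in> gromov_boundary" "converges_to_boundary x \<eta>" "stable_dilation f \<eta> = 1"
    "denjoy_wolff_point f \<eta>"
    "\<exists>a\<in>horo_boundary. horo_to_gromov a = Inr \<eta> \<and> (\<exists>c. \<forall>n. x n \<notin> {y. horofunction a p y \<le> c})"
proof -
  have ne: "\<not> elliptic f" by (rule zero_rate_not_elliptic[OF b nc nw])
  obtain \<gamma> where \<gamma>: "geodesic_ray \<gamma>" "\<gamma> 0 = x 0" "denjoy_wolff_point f (ray_class \<gamma>)"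
    using denjoy_wolff_exists[OF nonexp ne] .
  define \<eta> where "\<eta> = ray_class \<gamma>"
  have \<eta>: "\<eta> \<in> gromov_boundary" "\<gamma> \<in> \<eta>"
    unfolding \<eta>_def by (rule ray_class_in_boundary[OF \<gamma>(1)], rule self_in_ray_class[OF \<gamma>(1)])
  define y where "y k = (f ^^ k) (x 0)" for k
  have yconv: "\<forall>\<^sub>F k in sequentially. M < rp (y k) \<gamma>" for M
  proof -
    have "converges_to_boundary y \<eta>" using \<gamma>(3) unfolding denjoy_wolff_point_def y_def \<eta>_def by blast
    then show ?thesis unfolding converges_to_boundary_iff[OF \<eta>] by blast
  qed
  have "\<forall>\<^sub>F n in sequentially. M < rp (x n) \<gamma>" for M
  proof -
    \<comment> \<open>The chain from \<open>x n\<close> over \<open>x (n + j)\<close> and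
      \<open>y k\<close> to the end of \<open>\<gamma>\<close> uses the four-point inequality
      twice.\<close>
    define M' where "M' = M + 2 * \<Delta> + 1"
    have "\<forall>\<^sub>F k in sequentially. 2 * M' + 1 \<le> dist (x 0) (y k)"
      using non_elliptic_escapes[OF nonexp ne, of "x 0" "x 0"] unfolding y_def filterlim_at_top by blast
    then have "\<forall>\<^sub>F k in sequentially. 2 * M' + 1 \<le> dist (x 0) (y k) \<and> M' < rp (y k) \<gamma>"
      using yconv[of M'] by (rule eventually_conj)
    then obtain k where k: "2 * M' + 1 \<le> dist (x 0) (y k)" "M' < rp (y k) \<gamma>"
      using eventually_happens[of _ sequentially] by fastforce
    obtain J where J: "\<forall>m. \<exists>j\<le>J. D (m + j + k) \<le> D (m + j) + 1" using zero_rate_pause[OF b] .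
    have "\<forall>\<^sub>F n in sequentially. M' + real J * S \<le> D n"
      using zero_rate_escapes[OF ne] unfolding filterlim_at_top by blast
    then show ?thesis
    proof eventually_elim
      case (elim n)
      obtain j where j: "j \<le> J" "D (n + j + k) \<le> D (n + j) + 1" using J by blast
      \<comment> \<open>\<open>f ^^ k\<close> maps \<open>x 0\<close> to \<open>y k\<close> and
        \<open>x (n + j + k)\<close> to \<open>x (n + j)\<close>. With the pause, the product of
        \<open>x (n + j)\<close> and \<open>y k\<close> is at least
        \<open>(dist (x 0) (y k) - 1) / 2\<close>.\<close>
      have "dist (y k) (x (n + j)) \<le> D (n + j + k)"
        using non_expanding_funpow[OF nonexp, of k "x 0" "x (n + j + k)"] by (simp add: y_def funpow_backward)
      then have 1: "M' \<le> gp (x (n + j)) (y k)"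
        using j(2) k(1) by (simp add: gromov_product_def dist_commute)
      have "dist (x n) (x (n + j)) \<le> real J * S"
        using dist_le_steps[of n j] mult_right_mono[of "real j" "real J" S] j(1) S_nonneg by linarith
      moreover have "D n \<le> D (n + j) + dist (x n) (x (n + j))" by (rule dist_triangle2)
      ultimately have 2: "M' \<le> gp (x n) (x (n + j))"
        using elim by (simp add: gromov_product_def dist_commute)
      have "M' - \<Delta> \<le> gp (x n) (y k)" by (rule four_pointD[OF 2 1])
      moreover have "M' - \<Delta> \<le> rp (y k) \<gamma>" using k(2) \<Delta>_nonneg by simp
      ultimately have "M' - \<Delta> - \<Delta> \<le> rp (x n) \<gamma>"
        by (rule ray_product_four_point[OF \<gamma>(1)])
      then show ?case by (simp add: M'_def)
    qed
  qed
  then have conv: "converges_to_boundary x \<eta>" unfolding converges_to_boundary_iff[OF \<eta>] by blast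
  have "stable_dilation f \<eta> = exp b"
  proof (rule stable_dilation_eq[OF \<eta>(1) conv, of "\<lambda>n. - \<sigma> n"])
    show "(\<lambda>n. - \<sigma> n / real n) \<longlonglongrightarrow> b"
      using tendsto_minus[OF backward_step_rate_tendsto] by (simp add: b)
    fix p
    \<comment> \<open>A sublinear lower bound is enough: \<open>f ^^ n\<close> displaces
      \<open>x 0\<close> by at most \<open>\<sigma> n\<close>, and this gives an estimate at every
      \<open>z\<close>.\<close>
    have "ereal (- \<sigma> n - 2 * dist p (x 0)) \<le> log_dilation (f ^^ n) \<eta> p" for n
      unfolding log_dilation_def
    proof (rule Liminf_bounded, rule always_eventually, rule allI)
      fix z
      have "dist ((f ^^ n) z) p \<le> dist ((f ^^ n) z) (y n) + dist (y n) (x 0) + dist (x 0) p"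
        using dist_triangle[of "(f ^^ n) z" p "y n"] dist_triangle[of "y n" p "x 0"] by linarith
      moreover have "dist ((f ^^ n) z) (y n) \<le> dist z p + dist p (x 0)"
        using non_expanding_funpow[OF nonexp, of n z "x 0"] dist_triangle[of z "x 0" p] by (simp add: y_def)
      moreover have "dist (y n) (x 0) \<le> \<sigma> n"
        using non_expanding_funpow[OF nonexp, of n "x 0" "x (0 + n)"] D_le_backward_step[of n]
        unfolding funpow_backward by (simp add: y_def)
      ultimately show "ereal (- \<sigma> n - 2 * dist p (x 0)) \<le> ereal (dist z p - dist ((f ^^ n) z) p)"
        by (simp add: dist_commute)
    qed
    then show "\<exists>C. \<forall>n. ereal (- \<sigma> n - C) \<le> log_dilation (f ^^ n) \<eta> p" by blast
  qed
  then have stable: "stable_dilation f \<eta> = 1" using b by simp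
  define a where "a = class_mod_const (busemann \<gamma>)"
  have a: "a \<in> horo_boundary" "horo_to_gromov a = Inr \<eta>"
    unfolding a_def \<eta>_def by (rule busemann_in_horo_boundary[OF \<gamma>(1)], rule horo_to_gromov_busemann[OF \<gamma>(1)])
  \<comment> \<open>At a pause far out, \<open>x n\<close> is no nearer to \<open>x m\<close> than
    \<open>x 0\<close> is, up to 1: its distance to \<open>x m\<close> is at least
    \<open>D (N + j)\<close>, hence at least \<open>D m - 1\<close>. Seen from \<open>x m\<close>,
    differences of distances are Busemann differences up to \<open>2 * \<Delta>\<close>.\<close>
  have "busemann \<gamma> (x 0) - (1 + 2 * \<Delta>) \<le> busemann \<gamma> (x n)" for n
  proof -
    obtain J where J: "\<forall>m. \<exists>j\<le>J. D (m + j + n) \<le> D (m + j) + 1" using zero_rate_pause[OF b] .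
    obtain N where N: "\<forall>m\<ge>N. D n < rp (x m) \<gamma>"
      using conv unfolding converges_to_boundary_iff[OF \<eta>] eventually_sequentially by blast
    obtain j where j: "D (N + j + n) \<le> D (N + j) + 1" using J by blast
    define m where "m = N + j + n"
    have "D (N + j) \<le> dist (x n) (x m)" using dist_mono[of 0 "N + j" n] by (simp add: m_def)
    moreover have "\<bar>(dist (x n) (x m) - D m) - (busemann \<gamma> (x n) - busemann \<gamma> (x 0))\<bar> \<le> 2 * \<Delta>"
      using N[rule_format, of m] by (intro busemann_near_end[OF \<gamma>(1)]) (simp add: m_def dist_commute)
    ultimately show ?thesis using j unfolding m_def by linarith
  qed
  \<comment> \<open>Normalising at \<open>p\<close> subtracts \<open>busemann \<gamma> p\<close>;
    the additional 1 makes the inequality strict, as avoiding a closed horoball requires.\<close>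
  then have "busemann \<gamma> (x 0) - (1 + 2 * \<Delta>) - busemann \<gamma> p - 1 < horofunction a p (x n)" for n
    unfolding a_def horofunction_class by (smt (verit))
  then have "\<forall>n. x n \<notin> {y. horofunction a p y \<le> busemann \<gamma> (x 0) - (1 + 2 * \<Delta>) - busemann \<gamma> p - 1}"
    unfolding mem_Collect_eq not_le by blast
  with a have "\<exists>a\<in>horo_boundary. horo_to_gromov a = Inr \<eta> \<and> (\<exists>c. \<forall>n. x n \<notin> {y. horofunction a p y \<le> c})"
    by blast
  moreover have "denjoy_wolff_point f \<eta>" using \<gamma>(3) by (simp add: \<eta>_def)
  ultimately show thesis using \<eta>(1) conv stable by (intro that[of \<eta>])
qed

end

theorem theorem1p6:
  fixes f :: "'a::heine_borel \<Rightarrow> 'a" and p :: 'a and x :: "nat \<Rightarrow> 'a"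
  assumes "geodesic_space TYPE('a)"
    and "gromov_hyperbolic TYPE('a)"
    and "non_expanding f"
    and "\<not> weakly_elliptic f"
    and "backward_orbit f x"
    and "bounded_step x"
    and "\<not> compact (closure (range x))"
  shows "\<exists>\<eta>\<in>gromov_boundary.
    converges_to_boundary x \<eta> \<and> brfp f \<eta> \<and>
    ((backward_step_rate x > 0 \<and>
      repelling_brfp f \<eta> \<and>
      ln (stable_dilation f \<eta>) = backward_step_rate x \<and>
      discrete_quasi_geodesic_ray x \<and>
      (\<exists>\<gamma>\<in>\<eta>. \<exists>R>0. \<forall>n. x n \<in> geodesic_region \<gamma> R))
     \<or>
     (backward_step_rate x = 0 \<and>
      parabolic f \<and>
      denjoy_wolff_point f \<eta> \<and>
      (\<exists>a\<in>horo_boundary. horo_to_gromov a = Inr \<eta> \<and>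
        (\<exists>c. \<forall>n. x n \<notin> {y. horofunction a p y \<le> c}))))"
proof -
  obtain \<delta> where \<delta>: "\<delta> > 0" "delta_hyperbolic TYPE('a) \<delta>"
    using assms(2) unfolding gromov_hyperbolic_def by blast
  obtain S where S: "\<forall>n. dist (x n) (x (Suc n)) \<le> S"
    using assms(6) unfolding bounded_step_def bdd_above_def by auto
  interpret backward_orbit_bounded_step x "3 * \<delta>" f S
  proof
    show "min (gromov_product q u v) (gromov_product q v w) - 3 * \<delta> \<le> gromov_product q u w" for q u v w :: 'a
      by (rule delta_hyperbolic_four_point[OF assms(1) \<delta>(2,1)])
  qed (use assms(1,3,5) S in \<open>simp_all add: backward_orbit_def\<close>)
  show ?thesis
  proof (cases "b > 0")
    case True
    obtain \<eta> where \<eta>: "\<eta> \<in> gromov_boundary" "converges_to_boundary x \<eta>" "stable_dilation f \<eta> = exp b"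
      "discrete_quasi_geodesic_ray x" "\<exists>\<gamma>\<in>\<eta>. \<exists>R>0. \<forall>n. x n \<in> geodesic_region \<gamma> R"
      using positive_rate[OF True] .
    have "brfp f \<eta>" by (rule brfp_limit[OF \<eta>(1,2)])
    moreover from this have "repelling_brfp f \<eta>" using \<eta>(3) True by (simp add: repelling_brfp_def)
    ultimately show ?thesis using True \<eta> by (intro bexI[OF _ \<eta>(1)]) simp
  next
    case False
    then have b: "b = 0" using backward_step_rate_nonneg by simp
    obtain \<eta> where \<eta>: "\<eta> \<in> gromov_boundary" "converges_to_boundary x \<eta>" "stable_dilation f \<eta> = 1"
      "denjoy_wolff_point f \<eta>"
      "\<exists>a\<in>horo_boundary. horo_to_gromov a = Inr \<eta> \<and> (\<exists>c. \<forall>n. x n \<notin> {y. horofunction a p y \<le> c})"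
      using zero_rate[OF b assms(7,4)] .
    have brfp: "brfp f \<eta>" by (rule brfp_limit[OF \<eta>(1,2)])
    \<comment> \<open>The limit \<open>\<eta>\<close> is itself the Denjoy-Wolff point, so its
      stable dilation 1 is the one that defines parabolicity.\<close>
    moreover have "parabolic f"
      using brfp \<eta>(3,4) unfolding parabolic_def indifferent_brfp_def denjoy_wolff_point_def by blast
    ultimately show ?thesis using b \<eta> by (intro bexI[OF _ \<eta>(1)]) simp
  qed
qed

end
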